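(* Let $n\geqslant 1$, let $c,H>0$, and let $b,m^2\geqslant 0$ be real numbers such that $b^2\geqslant 4m^2$. Let $\beta\geqslant 0$ and $p>1$ satisfy $$\frac{n}{2}-\frac{\sqrt{b^2-4m^2}}{2H}>\frac{1}{p}.$$ Let $\varrho=\varrho_{\mathrm{crit}}(n,H,b,m^2,\beta,p)$, which under the previous condition equals $$\varrho_{\mathrm{crit}}=\tfrac{1}{2}(b+nH)\big((\beta+1)p-1\big)+nH-(n-1)H(\beta+1)-\tfrac{H}{p},$$ let $\varsigma>-\frac{1}{p}$ and $\mu>0$, and set $$\Gamma(t)= \mu\,\mathrm{e}^{\varrho_{\mathrm{crit}} t}(1+t)^{\varsigma},\qquad f(t,v)=\Gamma(t)\left(\int_{\mathbb{R}^n}|v(t,y)|^p\,\mathrm{d}y\right)^{\beta}|v|^p .$$ Let $(v_0,v_1)\in \mathcal{C}^2_0(\mathbb{R}^n)\times\mathcal{C}^1_0(\mathbb{R}^n)$ be nonnegative and nontrivial functions with supports contained in $B_R=\{x\in\mathbb{R}^n:|x|\leqslant R\}$ for some $R>0$. For $\varepsilon>0$, let $v\in\mathcal{C}^2([0,T)\times\mathbb{R}^n)$ be a classical solution, with lifespan $T=T(\varepsilon)$, of the Cauchy problem $$\begin{cases}\partial_t^2 v-c^2\mathrm{e}^{2Ht}\Delta v+b\,\partial_t v+m^2v=f(t,v), & x\in\mathbb{R}^n,\ t\in(0,T),\\ v(0,x)=\varepsilon v_0(x), & x\in\mathbb{R}^n,\\ \partial_t v(0,x)=\varepsilon v_1(x),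 & x\in\mathbb{R}^n.\end{cases}$$ Then there exists a positive constant $\varepsilon_0=\varepsilon_0(n,c,H,b,m^2,\beta,p,\mu,\varsigma,v_0,v_1,R)$ such that for any $\varepsilon\in(0,\varepsilon_0]$ the classical solution $v$ blows up in finite time (that is, $T(\varepsilon)<\infty$). Furthermore, there is a positive constant $C$, independent of $\varepsilon$, such that for any $\varepsilon\in(0,\varepsilon_0]$ $$T(\varepsilon)\leqslant\begin{cases} C\,\varepsilon^{-\frac{p((\beta+1)p-1)}{1+\varsigma p}} & \text{if } \varsigma\in\big(-\tfrac1p,0\big],\\ C\,\varepsilon^{-p((\beta+1)p-1)} & \text{if } \varsigma\in\big(0,\tfrac1p\big),\\ C\,\varepsilon^{-\frac{(\beta+1)p-1}{\varsigma}} & \text{if } \varsigma\in\big[\tfrac1p,\infty\big).\end{cases}$$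
   Context: $\mathcal{C}^k_0(\mathbb{R}^n)$ denotes compactly supported $\mathcal{C}^k$ functions on $\mathbb{R}^n$. The lifespan $T(\varepsilon)\in(0,\infty]$ is the maximal existence time of the classical solution $v$ (a $\mathcal{C}^2$ function satisfying the equation and the initial conditions pointwise). The general definition of the threshold is: with $N=\frac{2}{p}+\frac{\sqrt{b^2-4m^2}}{H}$, $$\varrho_{\mathrm{crit}}(n,H,b,m^2,\beta,p)=\begin{cases}\frac12\big(b-\sqrt{b^2-4m^2}\big)\big((\beta+1)p-1\big)+nH(\beta+1)(p-1) & \text{if } n\leqslant N,\\ \frac12(b+nH)\big((\beta+1)p-1\big)+nH-(n-1)H(\beta+1)-\frac{H}{p} & \text{if } n>N;\end{cases}$$ the hypothesis on $p$ in the theorem is exactly $n>N$, so the second expression applies. With $A(t)=\frac{c}{H}(\mathrm{e}^{Ht}-1)$, by finite speed of propagation, classical solutions with data supported in $B_R$ satisfy $\operatorname{supp} v(t,\cdot)\subset B_{R+A(t)}$ for all $t\in(0,T)$; in particular the integral in $f$ is finite. *)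

theory Defs
  imports "HOL-Analysis.Analysis"
begin

text \<open>\<open>Ck_on k f S\<close>: \<open>f\<close> is of class \<open>C\<^sup>k\<close> on \<open>S\<close>. Derivatives are taken relative to \<open>S\<close>, hence are
  one-sided on the part of the boundary that belongs to \<open>S\<close> (the initial time). This is meant for
  convex sets with nonempty interior, where relative derivatives are unique.\<close>

primrec Ck_on :: "nat \<Rightarrow> ('a::real_normed_vector \<Rightarrow> real) \<Rightarrow> 'a set \<Rightarrow> bool" where
  "Ck_on 0 f S \<longleftrightarrow> continuous_on S f"
| "Ck_on (Suc k) f S \<longleftrightarrow>
     (\<exists>f'. (\<forall>x\<in>S. (f has_derivative f' x) (at x within S)) \<and> (\<forall>h. Ck_on k (\<lambda>x. f' x h) S))"

definition supp :: "('a::topological_space \<Rightarrow> real) \<Rightarrow> 'a set" where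
  "supp f = closure {x. f x \<noteq> 0}"

definition Ck_compact :: "nat \<Rightarrow> ('a::real_normed_vector \<Rightarrow> real) set" where
  "Ck_compact k = {f. Ck_on k f UNIV \<and> compact (supp f)}"

definition laplacian :: "('a::euclidean_space \<Rightarrow> real) \<Rightarrow> 'a \<Rightarrow> real" where
  "laplacian f x = (\<Sum>e\<in>Basis. (deriv ^^ 2) (\<lambda>h. f (x + h *\<^sub>R e)) 0)"

text \<open>The mass enters only through its square, so the parameter \<open>msq\<close> stands for \<open>m\<^sup>2\<close>.\<close>

definition N_crit :: "real \<Rightarrow> real \<Rightarrow> real \<Rightarrow> real \<Rightarrow> real" where
  "N_crit H b msq p = 2 / p + sqrt (b\<^sup>2 - 4 * msq) / H"

definition rho_crit :: "nat \<Rightarrow> real \<Rightarrow> real \<Rightarrow> real \<Rightarrow> real \<Rightarrow> real \<Rightarrow> real" where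
  "rho_crit n H b msq \<beta> p =
    (if real n \<le> N_crit H b msq p
     then (b - sqrt (b\<^sup>2 - 4 * msq)) / 2 * ((\<beta> + 1) * p - 1) + real n * H * (\<beta> + 1) * (p - 1)
     else (b + real n * H) / 2 * ((\<beta> + 1) * p - 1) + real n * H
            - (real n - 1) * H * (\<beta> + 1) - H / p)"

lemma rho_crit_eq:
  assumes "H > 0" and "real n / 2 - sqrt (b\<^sup>2 - 4 * msq) / (2 * H) > 1 / p"
  shows "rho_crit n H b msq \<beta> p =
    (b + real n * H) / 2 * ((\<beta> + 1) * p - 1) + real n * H - (real n - 1) * H * (\<beta> + 1) - H / p"
proof -
  have "sqrt (b\<^sup>2 - 4 * msq) / H = 2 * (sqrt (b\<^sup>2 - 4 * msq) / (2 * H))" "2 / p = 2 * (1 / p)"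
    by simp_all
  then have "N_crit H b msq p < real n"
    using assms(2) unfolding N_crit_def by linarith
  then show ?thesis by (simp add: rho_crit_def)
qed

text \<open>At a zero of \<open>v t\<close> the value is \<open>0\<close>, also when \<open>\<beta> = 0\<close> (\<open>0 powr 0 = 0\<close> in HOL is
  harmless: for continuous \<open>v t\<close> the integral vanishes only if \<open>v t\<close> does, and \<open>p > 0\<close>).\<close>

definition nonlocal_term ::
  "(real \<Rightarrow> real) \<Rightarrow> real \<Rightarrow> real \<Rightarrow> (real \<Rightarrow> 'a::euclidean_space \<Rightarrow> real) \<Rightarrow> real \<Rightarrow> 'a \<Rightarrow> real" where
  "nonlocal_term \<Gamma> \<beta> p v t x =
     \<Gamma> t * (LINT y|lborel. \<bar>v t y\<bar> powr p) powr \<beta> * \<bar>v t x\<bar> powr p"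

definition time_strip :: "ereal \<Rightarrow> (real \<times> 'a::euclidean_space) set" where
  "time_strip T = {t. 0 \<le> t \<and> ereal t < T} \<times> UNIV"

text \<open>Classical solutions on \<open>[0,T) \<times> \<real>\<^sup>n\<close> with data \<open>v(0) = g0\<close>, \<open>\<partial>\<^sub>t v(0) = g1\<close>.
  Integrability is required only so that the nonlocal factor is a genuine finite integral
  (the Bochner integral of a non-integrable function is \<open>0\<close> by convention).\<close>

definition classical_solution ::
  "real \<Rightarrow> real \<Rightarrow> real \<Rightarrow> real \<Rightarrow> (real \<Rightarrow> real) \<Rightarrow> real \<Rightarrow> real \<Rightarrow>
   ('a::euclidean_space \<Rightarrow> real) \<Rightarrow> ('a \<Rightarrow> real) \<Rightarrow> ereal \<Rightarrow> (real \<Rightarrow> 'a \<Rightarrow> real) \<Rightarrow> bool" where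
  "classical_solution c H b msq \<Gamma> \<beta> p g0 g1 T v \<longleftrightarrow>
     0 < T \<and>
     Ck_on 2 (\<lambda>(t, x). v t x) (time_strip T) \<and>
     (\<forall>t. 0 < t \<and> ereal t < T \<longrightarrow>
        integrable lborel (\<lambda>y. \<bar>v t y\<bar> powr p) \<and>
        (\<forall>x. (deriv ^^ 2) (\<lambda>s. v s x) t - c\<^sup>2 * exp (2 * H * t) * laplacian (v t) x
               + b * deriv (\<lambda>s. v s x) t + msq * v t x
             = nonlocal_term \<Gamma> \<beta> p v t x)) \<and>
     (\<forall>x. v 0 x = g0 x) \<and>
     (\<forall>x. ((\<lambda>t. v t x) has_real_derivative g1 x) (at_right 0))"

text \<open>\<open>T\<close> is the maximal existence time of \<open>v\<close>: \<open>v\<close> has no classical extension beyond \<open>T\<close>.\<close>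

definition classical_solution_with_lifespan ::
  "real \<Rightarrow> real \<Rightarrow> real \<Rightarrow> real \<Rightarrow> (real \<Rightarrow> real) \<Rightarrow> real \<Rightarrow> real \<Rightarrow>
   ('a::euclidean_space \<Rightarrow> real) \<Rightarrow> ('a \<Rightarrow> real) \<Rightarrow> ereal \<Rightarrow> (real \<Rightarrow> 'a \<Rightarrow> real) \<Rightarrow> bool" where
  "classical_solution_with_lifespan c H b msq \<Gamma> \<beta> p g0 g1 T v \<longleftrightarrow>
     classical_solution c H b msq \<Gamma> \<beta> p g0 g1 T v \<and>
     \<not> (\<exists>T' w. T < T' \<and> classical_solution c H b msq \<Gamma> \<beta> p g0 g1 T' w \<and>
              (\<forall>t x. 0 \<le> t \<and> ereal t < T \<longrightarrow> w t x = v t x))"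

end

theory Submission
  imports Defs
begin

text \<open>Write \<open>X(t) = \<integral>|v|\<^sup>p\<close>, \<open>q = (\<beta> + 1) p\<close> and \<open>M(t) = e\<^bsup>\<alpha>t\<^esup> X(t)\<close>, where \<open>e\<^bsup>-\<alpha>t\<^esup>\<close> is the
  size of \<open>X\<close> for the linear flow. The moments \<open>\<integral>v \<Phi>(l x)\<close> against the radial solution of
  \<open>\<Delta>\<Phi> = \<Phi>\<close> solve ordinary differential equations with nonnegative source; a source of mass \<open>S\<close>
  at time \<open>j\<close> makes the moment with \<open>l \<approx> e\<^bsup>-Hj\<^esup>\<close> at least \<open>S\<close> times the growing linear solution from
  then on. A Hardy type inequality for the Laplace transform in the distance to the light cone,
  discretised at these \<open>l\<close>, adds up the contributions of all \<open>j \<le> t\<close>: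
  \<open>M(t) \<ge> c \<epsilon>\<^sup>p + c \<Sum>\<^bsub>j\<le>t\<^esub> (1 + j)\<^bsup>\<sigma>p\<^esup> (inf\<^bsub>[j-1,j]\<^esub> M)\<^sup>q\<close>. Hence \<open>M\<close> starts to grow after a time
  \<open>\<epsilon>\<^bsup>-p(q-1)/(1+\<sigma>p)\<^esup>\<close>. Once \<open>M\<close> exceeds a power of \<open>t\<close>, Hoelder's inequality and the equation for
  \<open>\<integral>v\<close> force blow-up within two time units; for \<open>\<sigma> > 0\<close> already \<open>M \<ge> c \<epsilon>\<^sup>p\<close> achieves
  this at time \<open>\<epsilon>\<^bsup>-(q-1)/\<sigma>\<^esup>\<close>.\<close>

text \<open>Criticality shapes the proof. The value of \<open>\<rho>\<close> acts through
  \<open>exponent_identity\<close>: for constant \<open>M\<close> the source of a moment grows, up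
  to the polynomial weight, at the rate \<open>\<theta>\<close>, and \<open>\<theta>\<close> is also
  the rate at which \<open>M_ge_sum_moments\<close> discounts a source created at time j. All past
  times therefore contribute alike and there is no exponential gain. A moment with one fixed l
  captures the contribution of one j only, so a whole family of scales is needed to see the sum.
  With M of size \<epsilon>^p the sum is about t^(1+\<sigma>p) \<epsilon>^(pq), which tends to
  infinity with t because \<sigma> > -1/p; equating it with \<epsilon>^p gives the time named above.
  A second obstacle is a circle: confining the support requires a bound on the nonlocal factor,
  while the definition of a solution grants only integrability at each single time. The circle is
  broken by following the solution up to the first time at which it could vanish
  identically.\<close>

section \<open>A radial eigenfunction of the Laplacian\<close>

lemma one_plus_powr_le_exp:
  fixes m :: real
  assumes "m \<ge> 0"
  shows "\<exists>C\<ge>1. \<forall>s\<ge>0. (1 + s) powr m \<le> C * exp (s / 4)"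
proof -
  \<comment> \<open>The tangent of \<open>ln\<close> at \<open>K\<close> has slope
    \<open>1 / K\<close>; this \<open>K\<close> makes m times the slope at most 1/4.\<close>
  define K where "K = 4 * m + 1"
  have K: "K \<ge> 1" "m / K \<le> 1 / 4" using assms by (auto simp: K_def field_simps)
  let ?C = "exp (1 / 4 + m * ln K)"
  have "(1 + s) powr m \<le> ?C * exp (s / 4)" if s: "s \<ge> 0" for s
  proof -
    have "ln ((1 + s) / K) \<le> (1 + s) / K - 1"
      using s K by (intro ln_le_minus_one) auto
    then have "ln (1 + s) \<le> (1 + s) / K + ln K" using s K by (simp add: ln_div)
    then have "m * ln (1 + s) \<le> m * ((1 + s) / K + ln K)" using assms by (intro mult_left_mono)
    also have "\<dots> = (m / K) * (1 + s) + m * ln K" by (simp add: field_simps)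
    also have "\<dots> \<le> (1 / 4) * (1 + s) + m * ln K" using K s by (intro add_mono mult_right_mono) auto
    finally have "m * ln (1 + s) \<le> 1 / 4 + m * ln K + s / 4" by argo
    then have "exp (m * ln (1 + s)) \<le> exp (1 / 4 + m * ln K + s / 4)" by simp
    then show ?thesis using s by (simp add: powr_def exp_add)
  qed
  moreover have "?C \<ge> 1" using assms K by simp
  ultimately show ?thesis by blast
qed

text \<open>Power series coefficients of the radial solution of \<open>\<Delta>\<phi> = \<phi>\<close> in \<open>\<real>\<^sup>n\<close>: with \<open>\<phi>(x) = g(|x|\<^sup>2)\<close> the
  equation reads \<open>4 y g'' + 2 n g' = g\<close>.\<close>

primrec bcoef :: "nat \<Rightarrow> nat \<Rightarrow> real" where
  "bcoef n 0 = 1"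
| "bcoef n (Suc k) = bcoef n k / (2 * (real k + 1) * (real n + 2 * real k))"

lemma bcoef_nonneg: "bcoef n k \<ge> 0"
  by (induction k) auto

lemma bcoef_le:
  assumes "n \<ge> 1" shows "bcoef n k \<le> inverse (fact k)"
proof (induction k)
  case (Suc k)
  have "real k + 1 \<le> (real k + 1) * (2 * (real n + 2 * real k))"
    using assms by (intro mult_le_cancel_left1[THEN iffD2]) auto
  then have 1: "real k + 1 \<le> 2 * (real k + 1) * (real n + 2 * real k)" by (simp add: algebra_simps)
  have "bcoef n (Suc k) \<le> bcoef n k / (real k + 1)"
    unfolding bcoef.simps using 1 assms by (intro divide_left_mono bcoef_nonneg mult_pos_pos) auto
  also have "\<dots> \<le> inverse (fact k) / (real k + 1)" using Suc by (intro divide_right_mono) auto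
  also have "\<dots> = inverse (fact (Suc k))" by (simp add: field_simps)
  finally show ?case .
qed auto

lemma bcoef_summable:
  assumes "n \<ge> 1" shows "summable (\<lambda>k. bcoef n k * (y::real) ^ k)"
proof (rule summable_comparison_test)
  show "\<exists>N. \<forall>k\<ge>N. norm (bcoef n k * y ^ k) \<le> inverse (fact k) * \<bar>y\<bar> ^ k"
    using bcoef_le[OF assms] bcoef_nonneg
    by (intro exI[of _ 0]) (auto simp: abs_mult power_abs intro!: mult_right_mono)
  show "summable (\<lambda>k. inverse (fact k) * \<bar>y\<bar> ^ k)"
    using summable_exp_generic[of "\<bar>y\<bar>"] by (simp add: field_simps)
qed

definition gser :: "nat \<Rightarrow> real \<Rightarrow> real" where
  "gser n y = (\<Sum>k. bcoef n k * y ^ k)"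

definition gser1 :: "nat \<Rightarrow> real \<Rightarrow> real" where
  "gser1 n y = (\<Sum>k. diffs (bcoef n) k * y ^ k)"

definition gser2 :: "nat \<Rightarrow> real \<Rightarrow> real" where
  "gser2 n y = (\<Sum>k. diffs (diffs (bcoef n)) k * y ^ k)"

context
  fixes n :: nat
  assumes n: "n \<ge> 1"
begin

lemma diffs_bcoef_summable: "summable (\<lambda>k. diffs (bcoef n) k * (y::real) ^ k)"
  by (rule termdiff_converges_all) (rule bcoef_summable[OF n])

lemma diffs_diffs_bcoef_summable: "summable (\<lambda>k. diffs (diffs (bcoef n)) k * (y::real) ^ k)"
  by (rule termdiff_converges_all) (rule diffs_bcoef_summable)

lemma gser_deriv: "(gser n has_real_derivative gser1 n y) (at y)"
  unfolding gser_def[abs_def] gser1_def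
  by (rule termdiffs_strong_converges_everywhere) (rule bcoef_summable[OF n])

lemma gser1_deriv: "(gser1 n has_real_derivative gser2 n y) (at y)"
  unfolding gser1_def[abs_def] gser2_def
  by (rule termdiffs_strong_converges_everywhere) (rule diffs_bcoef_summable)

text \<open>Comparing coefficients of y^k, the equation reads (4k + 2n)(k + 1) b(k+1) = b(k), which
  is the recursion of \<open>bcoef\<close>.\<close>

lemma gser_ode: "4 * y * gser2 n y + 2 * real n * gser1 n y = gser n y"
proof -
  let ?d = "diffs (bcoef n)"
  have s: "(\<lambda>k. diffs ?d k * y ^ k) sums gser2 n y" "(\<lambda>k. ?d k * y ^ k) sums gser1 n y"
    "(\<lambda>k. bcoef n k * y ^ k) sums gser n y"
    unfolding gser_def gser1_def gser2_def
    using diffs_diffs_bcoef_summable diffs_bcoef_summable bcoef_summable[OF n]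
    by (auto intro: summable_sums)
  have "(\<lambda>k. y * (diffs ?d k * y ^ k)) sums (y * gser2 n y)" by (intro sums_mult s)
  then have "(\<lambda>k. real (Suc k) * ?d (Suc k) * y ^ Suc k) sums (y * gser2 n y)"
    by (simp add: diffs_def mult_ac)
  then have "(\<lambda>k. real k * ?d k * y ^ k) sums (y * gser2 n y)"
    by (subst (asm) sums_Suc_iff) auto
  then have "(\<lambda>k. 4 * (real k * ?d k * y ^ k) + 2 * real n * (?d k * y ^ k))
      sums (4 * (y * gser2 n y) + 2 * real n * gser1 n y)"
    by (intro sums_add sums_mult s)
  moreover have "4 * (real k * ?d k * y ^ k) + 2 * real n * (?d k * y ^ k) = bcoef n k * y ^ k" for k
  proof -
    have "(4 * real k + 2 * real n) * ?d k = bcoef n k"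
    proof -
      have "2 * (real k + 1) * (real n + 2 * real k) \<noteq> 0" using n by auto
      then show ?thesis by (simp add: diffs_def divide_simps) (simp add: algebra_simps)
    qed
    then have "(4 * real k + 2 * real n) * ?d k * y ^ k = bcoef n k * y ^ k" by simp
    then show ?thesis by (simp only: algebra_simps)
  qed
  ultimately show ?thesis using s(3) by (simp add: sums_unique2 mult.assoc)
qed

lemma gser_nonneg: "y \<ge> 0 \<Longrightarrow> gser1 n y \<ge> 0" "y \<ge> 0 \<Longrightarrow> gser2 n y \<ge> 0"
  unfolding gser1_def gser2_def
  by (rule suminf_nonneg[OF diffs_bcoef_summable] suminf_nonneg[OF diffs_diffs_bcoef_summable],
      simp add: diffs_def bcoef_nonneg del: bcoef.simps)+

lemma gser_0: "gser n 0 = 1"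
  unfolding gser_def by (simp add: powser_zero)

lemma gser_mono: "0 \<le> x \<Longrightarrow> x \<le> y \<Longrightarrow> gser n x \<le> gser n y"
  by (rule DERIV_nonneg_imp_nondecreasing[of x y])
    (use gser_deriv gser_nonneg in \<open>auto intro!: exI[of _ "gser1 n _"]\<close>)

lemma gser_ge_1: "y \<ge> 0 \<Longrightarrow> gser n y \<ge> 1"
  using gser_mono[of 0 y] gser_0 by auto

text \<open>The classical substitution \<open>r\<^sup>m \<phi>(r)\<close> removes the first-order term of the radial Laplacian;
  \<open>E\<close> is the sum of that function and its derivative, and \<open>E' \<le> (1 + m\<^sup>2/r\<^sup>2) E\<close>.\<close>

lemma gser_asymp:
  assumes m: "m = (real n - 1) / 2"
  shows "\<exists>C>0. \<forall>r\<ge>1. gser n (r\<^sup>2) \<le> C * r powr (- m) * exp r"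
proof -
  have m0: "m \<ge> 0" using n m by simp
  define E where "E r = 2 * r * gser1 n (r\<^sup>2) + gser n (r\<^sup>2) + m * gser n (r\<^sup>2) / r" for r
  \<comment> \<open>exp (r - m^2/r) solves y' = (1 + m^2/r^2) y, so \<open>Q\<close> is a quotient
    that does not increase. The factor exp (m^2/r) is at least 1 and is dropped at the end.\<close>
  define Q where "Q r = r powr m * E r * exp (m\<^sup>2 / r - r)" for r
  define E' where "E' r = 2 * gser1 n (r\<^sup>2) + 4 * r\<^sup>2 * gser2 n (r\<^sup>2) + 2 * r * gser1 n (r\<^sup>2)
      + 2 * m * gser1 n (r\<^sup>2) - m * gser n (r\<^sup>2) / r\<^sup>2" for r
  have dg: "((\<lambda>r. gser n (r\<^sup>2)) has_real_derivative 2 * r * gser1 n (r\<^sup>2)) (at r)"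
    and dg1: "((\<lambda>r. gser1 n (r\<^sup>2)) has_real_derivative 2 * r * gser2 n (r\<^sup>2)) (at r)" for r
  proof -
    have "((\<lambda>r. r\<^sup>2) has_real_derivative 2 * r) (at r)" by (auto intro!: derivative_eq_intros)
    then show "((\<lambda>r. gser n (r\<^sup>2)) has_real_derivative 2 * r * gser1 n (r\<^sup>2)) (at r)"
      "((\<lambda>r. gser1 n (r\<^sup>2)) has_real_derivative 2 * r * gser2 n (r\<^sup>2)) (at r)"
      using DERIV_chain2[OF gser_deriv, of "\<lambda>r. r\<^sup>2" "2 * r" r UNIV]
        DERIV_chain2[OF gser1_deriv, of "\<lambda>r. r\<^sup>2" "2 * r" r UNIV]
      by (simp_all only: mult.commute[of "2 * r"])
  qed
  have dE: "(E has_real_derivative E' r) (at r)" if "r > 0" for r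
    unfolding E_def[abs_def] E'_def
    using that by (auto intro!: derivative_eq_intros dg dg1) (simp add: field_simps power2_eq_square)
  have dQ: "(Q has_real_derivative r powr m * exp (m\<^sup>2 / r - r) *
      (m / r * E r + E' r - (1 + m\<^sup>2 / r\<^sup>2) * E r)) (at r)" if "r > 0" for r
    unfolding Q_def[abs_def]
    using that by (auto intro!: derivative_eq_intros dE simp: field_simps power2_eq_square powr_diff)
  have neg: "m / r * E r + E' r - (1 + m\<^sup>2 / r\<^sup>2) * E r \<le> 0" if "r > 0" for r
  proof -
    let ?g = "gser n (r\<^sup>2)" and ?g1 = "gser1 n (r\<^sup>2)" and ?g2 = "gser2 n (r\<^sup>2)"
    have ode: "4 * r\<^sup>2 * ?g2 = ?g - (4 * m + 2) * ?g1"
    proof -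
      have "real n = 2 * m + 1" using m by simp
      then show ?thesis using gser_ode[of "r\<^sup>2"] by (simp add: algebra_simps)
    qed
    have "m / r * E r + E' r - (1 + m\<^sup>2 / r\<^sup>2) * E r
      = - (m * ?g / r\<^sup>2) - m\<^sup>2 / r\<^sup>2 * (2 * r * ?g1 + m * ?g / r)"
      unfolding E_def E'_def ode using that by (simp add: field_simps power2_eq_square)
    also have "\<dots> \<le> 0"
    proof -
      have "m * ?g / r\<^sup>2 \<ge> 0" "m\<^sup>2 / r\<^sup>2 * (2 * r * ?g1 + m * ?g / r) \<ge> 0"
        using m0 that gser_nonneg(1)[of "r\<^sup>2"] gser_ge_1[of "r\<^sup>2"] by auto
      then show ?thesis by linarith
    qed
    finally show ?thesis .
  qed
  have Qle: "Q r \<le> Q 1" if "r \<ge> 1" for r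
  proof (rule DERIV_nonpos_imp_nonincreasing[of 1 r])
    fix x assume x: "1 \<le> x" "x \<le> r"
    show "\<exists>y. (Q has_real_derivative y) (at x) \<and> y \<le> 0"
      using dQ[of x] neg[of x] x by (intro exI conjI) (auto intro!: mult_nonneg_nonpos)
  qed (use that in auto)
  have E_pos: "E r \<ge> gser n (r\<^sup>2)" if "r \<ge> 1" for r
    unfolding E_def using that m0 gser_nonneg(1)[of "r\<^sup>2"] gser_ge_1[of "r\<^sup>2"] by auto
  have "gser n (r\<^sup>2) \<le> Q 1 * r powr (- m) * exp r" if r: "r \<ge> 1" for r
  proof -
    have "r powr m * gser n (r\<^sup>2) * exp (- r) \<le> r powr m * E r * exp (m\<^sup>2 / r - r)"
      using E_pos[OF r] gser_ge_1[of "r\<^sup>2"] r by (intro mult_mono) auto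
    also have "\<dots> \<le> Q 1" using Qle[OF r] by (simp add: Q_def)
    finally have "r powr m * gser n (r\<^sup>2) * exp (- r) \<le> Q 1" .
    then show ?thesis using r by (simp add: powr_minus exp_minus field_simps)
  qed
  moreover have "Q 1 > 0" using E_pos[of 1] gser_ge_1[of 1] by (auto simp: Q_def)
  ultimately show ?thesis by blast
qed

text \<open>The decay is wanted at the endpoint l instead of z. Since l/z <= 1 + (l - z) for z >= 1,
  replacing z^(-m) by l^(-m) costs a power of 1 + (l - z), which half of the gap factor e^(-(l-z))
  absorbs. The other half survives as the Laplace kernel of
  \<open>laplace_transform_bound\<close>.\<close>

lemma gser_upper:
  assumes m: "m = (real n - 1) / 2"
  shows "\<exists>C>0. \<forall>l\<ge>1. \<forall>z. 0 \<le> z \<and> z \<le> l \<longrightarrow> gser n (z\<^sup>2) \<le> C * l powr (- m) * exp ((l + z) / 2)"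
proof -
  have m0: "m \<ge> 0" using n m by simp
  obtain C where C: "C > 0" "\<And>r. r \<ge> 1 \<Longrightarrow> gser n (r\<^sup>2) \<le> C * r powr (- m) * exp r"
    using gser_asymp[OF m] by blast
  obtain D where D: "D \<ge> 1" "\<And>s. s \<ge> 0 \<Longrightarrow> (1 + s) powr m \<le> D * exp (s / 4)"
    using one_plus_powr_le_exp[OF m0] by blast
  define C' where "C' = D * (C + gser n 1)"
  have "gser n (z\<^sup>2) \<le> C' * l powr (- m) * exp ((l + z) / 2)" if l: "l \<ge> 1" and z: "0 \<le> z" "z \<le> l" for l z
  proof (cases "z \<ge> 1")
    case True
    have "l = z + (l - z)" by simp
    also have "\<dots> \<le> z + z * (l - z)" using True z mult_right_mono[of 1 z "l - z"] by simp
    finally have "l / z \<le> 1 + (l - z)" using True by (simp add: field_simps)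
    then have "(l / z) powr m \<le> (1 + (l - z)) powr m" using True z m0 by (intro powr_mono2) auto
    also have "\<dots> \<le> D * exp ((l - z) / 4)" using D(2)[of "l - z"] z by simp
    also have "\<dots> \<le> D * exp ((l - z) / 2)" using D z by (intro mult_left_mono) auto
    finally have 1: "z powr (- m) \<le> l powr (- m) * (D * exp ((l - z) / 2))"
      using True z by (simp add: powr_divide powr_minus field_simps)
    have "gser n (z\<^sup>2) \<le> C * z powr (- m) * exp z" by (rule C(2)[OF True])
    also have "\<dots> \<le> C * (l powr (- m) * (D * exp ((l - z) / 2))) * exp z"
      using C 1 by (intro mult_right_mono mult_left_mono) auto
    also have "\<dots> = D * C * l powr (- m) * exp ((l - z) / 2 + z)" by (simp only: exp_add mult_ac)
    also have "(l - z) / 2 + z = (l + z) / 2" by (simp add: field_simps)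
    also have "D * C * l powr (- m) * exp ((l + z) / 2) \<le> C' * l powr (- m) * exp ((l + z) / 2)"
      unfolding C'_def using D gser_ge_1[of 1] by (intro mult_right_mono mult_left_mono) auto
    finally show ?thesis .
  next
    case False
    have "z\<^sup>2 \<le> 1" using False z by (simp add: power_le_one)
    then have "gser n (z\<^sup>2) \<le> gser n 1" by (intro gser_mono) auto
    moreover have "l powr m \<le> (1 + l) powr m" using l m0 by (intro powr_mono2) auto
    then have "l powr m \<le> D * exp (l / 4)" using D(2)[of l] l by simp
    then have "l powr m \<le> D * exp ((l + z) / 2)"
      by (rule order.trans) (use D l z in \<open>intro mult_left_mono, auto\<close>)
    then have "1 \<le> D * l powr (- m) * exp ((l + z) / 2)"
      using l by (simp add: powr_minus field_simps)
    then have "gser n 1 * 1 \<le> gser n 1 * (D * l powr (- m) * exp ((l + z) / 2))"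
      using gser_ge_1[of 1] by (intro mult_left_mono) auto
    moreover have "gser n 1 * (D * l powr (- m) * exp ((l + z) / 2)) \<le> C' * l powr (- m) * exp ((l + z) / 2)"
      unfolding C'_def using D C gser_ge_1[of 1] by (simp add: algebra_simps)
    ultimately show ?thesis by linarith
  qed
  moreover have "C' > 0" unfolding C'_def using D C gser_ge_1[of 1] by (intro mult_pos_pos add_pos_pos) auto
  ultimately show ?thesis by blast
qed

end

section \<open>Ordinary differential inequalities\<close>

text \<open>Derivatives are required in the open interval only, since those of the moments are
  established only there; continuity carries the bounds to the endpoints.\<close>

lemma second_derivative_lower_bound:
  fixes f f' f'' :: "real \<Rightarrow> real"
  assumes cf: "continuous_on {r..u} f" and cf': "continuous_on {r..u} f'"
    and d: "\<And>t. r < t \<Longrightarrow> t < u \<Longrightarrow> (f has_real_derivative f' t) (at t)"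
    and d': "\<And>t. r < t \<Longrightarrow> t < u \<Longrightarrow> (f' has_real_derivative f'' t) (at t)"
    and lb: "\<And>t. r < t \<Longrightarrow> t < u \<Longrightarrow> f'' t \<ge> s"
    and t: "r \<le> t" "t \<le> u"
  shows "f' t \<ge> f' r + s * (t - r)" "f t \<ge> f r + f' r * (t - r) + s * (t - r)\<^sup>2 / 2"
proof -
  have 1: "f' v \<ge> f' r + s * (v - r)" if v: "r \<le> v" "v \<le> u" for v
  proof -
    have "f' r - s * (r - r) \<le> f' v - s * (v - r)"
    proof (rule DERIV_nonneg_imp_increasing_open[OF v(1)])
      show "continuous_on {r..v} (\<lambda>t. f' t - s * (t - r))"
        using v by (intro continuous_intros continuous_on_subset[OF cf']) auto
      fix x assume x: "r < x" "x < v"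
      show "\<exists>y. ((\<lambda>t. f' t - s * (t - r)) has_real_derivative y) (at x) \<and> 0 \<le> y"
        using d'[of x] lb[of x] x v
        by (intro exI[of _ "f'' x - s"]) (auto intro!: derivative_eq_intros)
    qed
    then show ?thesis by simp
  qed
  show "f' t \<ge> f' r + s * (t - r)" using 1 t by simp
  have "f r - (f' r * (r - r) + s * (r - r)\<^sup>2 / 2) \<le> f t - (f' r * (t - r) + s * (t - r)\<^sup>2 / 2)"
  proof (rule DERIV_nonneg_imp_increasing_open[OF t(1)])
    show "continuous_on {r..t} (\<lambda>t. f t - (f' r * (t - r) + s * (t - r)\<^sup>2 / 2))"
      using t by (intro continuous_intros continuous_on_subset[OF cf]) auto
    fix x assume x: "r < x" "x < t"
    show "\<exists>y. ((\<lambda>t. f t - (f' r * (t - r) + s * (t - r)\<^sup>2 / 2)) has_real_derivative y) (at x) \<and> 0 \<le> y"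
      using d[of x] 1[of x] x t
      by (intro exI[of _ "f' x - (f' r + s * (x - r))"]) (auto intro!: derivative_eq_intros)
  qed
  then show "f t \<ge> f r + f' r * (t - r) + s * (t - r)\<^sup>2 / 2" by simp
qed

text \<open>While f >= 0 the inequality makes f convex, so f cannot turn down. Vanishing initial
  data are handled by adding \<delta> e^(L(t-r)) with L^2 > K: the sum starts positive, and at its
  first zero it would still be at least its initial value.\<close>

lemma second_order_comparison:
  fixes f f' f'' k :: "real \<Rightarrow> real"
  assumes cf: "continuous_on {r..u} f" and cf': "continuous_on {r..u} f'"
    and d: "\<And>t. r < t \<Longrightarrow> t < u \<Longrightarrow> (f has_real_derivative f' t) (at t)"
    and d': "\<And>t. r < t \<Longrightarrow> t < u \<Longrightarrow> (f' has_real_derivative f'' t) (at t)"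
    and lb: "\<And>t. r < t \<Longrightarrow> t < u \<Longrightarrow> f'' t \<ge> k t * f t"
    and k: "\<And>t. r < t \<Longrightarrow> t < u \<Longrightarrow> 0 \<le> k t \<and> k t \<le> K"
    and init: "f r \<ge> 0" "f' r \<ge> 0"
    and t: "r \<le> t" "t \<le> u"
  shows "f t \<ge> 0" "f' t \<ge> 0"
proof -
  define L where "L = \<bar>K\<bar> + 1"
  have L: "L\<^sup>2 > K" "L > 0"
  proof -
    have "L\<^sup>2 = \<bar>K\<bar> * \<bar>K\<bar> + 2 * \<bar>K\<bar> + 1" by (simp add: L_def power2_eq_square algebra_simps)
    moreover have "\<bar>K\<bar> * \<bar>K\<bar> \<ge> 0" by simp
    ultimately show "L\<^sup>2 > K" by linarith
  qed (simp add: L_def)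
  have pos: "f v + \<delta> * exp (L * (v - r)) > 0" if \<delta>: "\<delta> > 0" and v: "r \<le> v" "v \<le> u" for \<delta> v
  proof (rule ccontr)
    assume neg: "\<not> ?thesis"
    define P where "P t = f t + \<delta> * exp (L * (t - r))" for t
    have cP: "continuous_on {r..u} P" unfolding P_def[abs_def] by (intro continuous_intros cf)
    define Z where "Z = {t \<in> {r..u}. P t \<le> 0}"
    have "closed Z" unfolding Z_def
      by (intro continuous_closed_preimage_constant continuous_on_closed_Collect_le cP) auto
    have "v \<in> Z" using neg v by (auto simp: Z_def P_def)
    have "bdd_below Z" by (auto simp: Z_def bdd_below_def)
    define w where "w = Inf Z"
    have "w \<in> Z" unfolding w_def using \<open>closed Z\<close> \<open>v \<in> Z\<close> \<open>bdd_below Z\<close>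
      by (intro closed_contains_Inf) auto
    then have w: "r \<le> w" "w \<le> u" "P w \<le> 0" by (auto simp: Z_def)
    have Ppos: "P t > 0" if "r \<le> t" "t < w" for t
      using that cInf_lower[OF _ \<open>bdd_below Z\<close>, of t] w by (force simp: Z_def w_def)
    have "P r > 0" using init \<delta> by (simp add: P_def add_nonneg_pos)
    let ?P' = "\<lambda>t. f' t + \<delta> * (L * exp (L * (t - r)))"
    let ?P'' = "\<lambda>t. f'' t + \<delta> * (L * (L * exp (L * (t - r))))"
    have "P w \<ge> P r + ?P' r * (w - r) + 0 * (w - r)\<^sup>2 / 2"
    proof (rule second_derivative_lower_bound(2)[where u=w and f'="?P'" and f''="?P''"])
      show "continuous_on {r..w} P" by (rule continuous_on_subset[OF cP]) (use w in auto)
      show "continuous_on {r..w} ?P'"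
        by (intro continuous_intros continuous_on_subset[OF cf']) (use w in auto)
      fix t assume t: "r < t" "t < w"
      show "(P has_real_derivative ?P' t) (at t)" unfolding P_def[abs_def]
        using t w by (auto intro!: derivative_eq_intros d)
      show "(?P' has_real_derivative ?P'' t) (at t)"
        using t w by (auto intro!: derivative_eq_intros d')
      have "0 \<le> k t * P t" using Ppos[of t] k[of t] t w by simp
      also have "\<dots> = k t * f t + k t * (\<delta> * exp (L * (t - r)))" by (simp add: P_def algebra_simps)
      also have "\<dots> \<le> f'' t + L\<^sup>2 * (\<delta> * exp (L * (t - r)))"
        using k[of t] lb[of t] t w \<delta> L by (intro add_mono mult_right_mono) auto
      finally show "0 \<le> ?P'' t" by (simp add: power2_eq_square mult_ac)
    qed (use w in auto)
    moreover have "?P' r * (w - r) \<ge> 0" using init \<delta> L w by (intro mult_nonneg_nonneg) auto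
    ultimately show False using \<open>P r > 0\<close> w by simp
  qed
  have nonneg: "f v \<ge> 0" if v: "r \<le> v" "v \<le> u" for v
  proof (rule ccontr)
    assume "\<not> f v \<ge> 0"
    \<comment> \<open>With this \<delta> the left-hand side is exactly 0, so no limit in \<delta> is
      taken.\<close>
    then have "f v + (- f v / exp (L * (v - r))) * exp (L * (v - r)) > 0"
      by (intro pos v) (auto intro: divide_neg_pos)
    then show False by simp
  qed
  then show "f t \<ge> 0" using t by simp
  have "f' t \<ge> f' r + 0 * (t - r)"
  proof (rule second_derivative_lower_bound(1)[OF cf cf' d d' _ t])
    fix v assume v: "r < v" "v < u"
    show "0 \<le> f'' v" using lb[OF v] k[OF v] nonneg[of v] v by (meson less_imp_le mult_nonneg_nonneg order.trans)
  qed auto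
  then show "f' t \<ge> 0" using init by simp
qed

text \<open>With \<open>a(t) = 3 H e\<^bsup>H(t-\<tau>)\<^esup>\<close>, the function \<open>y = exp (a/H + H/(4a) - H(t-\<tau>)/2)\<close> is the leading WKB
  solution of \<open>y'' = a\<^sup>2 y\<close>, corrected by \<open>H/(4a)\<close> so that \<open>y'' \<le> a\<^sup>2 y\<close> as long as \<open>a \<ge> 3 H\<close>.\<close>

lemma exponential_growth:
  fixes W W' W'' :: "real \<Rightarrow> real"
  assumes H: "H > 0"
    and cW: "continuous_on {\<tau>..u} W" and cW': "continuous_on {\<tau>..u} W'"
    and d: "\<And>t. \<tau> < t \<Longrightarrow> t < u \<Longrightarrow> (W has_real_derivative W' t) (at t)"
    and d': "\<And>t. \<tau> < t \<Longrightarrow> t < u \<Longrightarrow> (W' has_real_derivative W'' t) (at t)"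
    and lb: "\<And>t. \<tau> < t \<Longrightarrow> t < u \<Longrightarrow> W'' t \<ge> (3 * H * exp (H * (t - \<tau>)))\<^sup>2 * W t"
    and init: "W \<tau> \<ge> \<eta>" "W' \<tau> \<ge> \<eta>" "\<eta> \<ge> 0" and u: "\<tau> \<le> u"
  shows "W u \<ge> \<eta> / ((1 + 3 * H) * exp 4) * exp (3 * exp (H * (u - \<tau>)) - H / 2 * (u - \<tau>))"
proof -
  define a where "a t = 3 * H * exp (H * (t - \<tau>))" for t
  define y where "y t = exp (a t / H + H / (4 * a t) - H / 2 * (t - \<tau>))" for t
  define l where "l t = a t - H\<^sup>2 / (4 * a t) - H / 2" for t
  have a: "a t \<ge> 3 * H" "a t > 0" if "t \<ge> \<tau>" for t using that H by (auto simp: a_def)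
  have a0: "a t > 0" for t using H by (simp add: a_def)
  have da: "(a has_real_derivative H * a t) (at t within X)" for t X
    unfolding a_def[abs_def] by (auto intro!: derivative_eq_intros)
  have dy: "(y has_real_derivative l t * y t) (at t)" for t
  proof -
    have "((\<lambda>t. a t / H + H / (4 * a t) - H / 2 * (t - \<tau>)) has_real_derivative l t) (at t)"
      unfolding l_def using H a0[of t]
      by (auto intro!: derivative_eq_intros da simp: field_simps power2_eq_square)
    from DERIV_fun_exp[OF this] show ?thesis unfolding y_def[abs_def] by (simp only: mult.commute)
  qed
  have dl: "(l has_real_derivative H * a t + H ^ 3 / (4 * a t)) (at t)" for t
    unfolding l_def[abs_def] using H a0[of t]
    by (auto intro!: derivative_eq_intros da simp: field_simps power2_eq_square power3_eq_cube)
  have dly: "((\<lambda>t. l t * y t) has_real_derivative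
      ((l t)\<^sup>2 + H * a t + H ^ 3 / (4 * a t)) * y t) (at t)" for t
    by (auto intro!: derivative_eq_intros dl dy simp: algebra_simps power2_eq_square)
  \<comment> \<open>In terms of x = H/a the defect of \<open>y\<close> is H^2 (x^2/16 + x/2 - 1/4).
    It is negative for x <= 1/3, which is what the factor 3 in \<open>a\<close> ensures.\<close>
  have sub: "(l t)\<^sup>2 + H * a t + H ^ 3 / (4 * a t) \<le> (a t)\<^sup>2" if "t \<ge> \<tau>" for t
  proof -
    define x where "x = H / a t"
    have Hx: "H = x * a t" "x > 0" "x \<le> 1 / 3" using a[OF that] H by (auto simp: x_def field_simps)
    have "(l t)\<^sup>2 + H * a t + H ^ 3 / (4 * a t) - (a t)\<^sup>2 = H\<^sup>2 * (x\<^sup>2 / 16 + x / 2 - 1 / 4)"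
      unfolding l_def Hx(1) using a0[of t] by (simp add: field_simps power2_eq_square power3_eq_cube)
    also have "\<dots> \<le> 0"
    proof -
      have "x\<^sup>2 \<le> x * (1 / 3)" unfolding power2_eq_square using Hx by (intro mult_left_mono) auto
      then have "x\<^sup>2 / 16 + x / 2 - 1 / 4 \<le> 0" using Hx(3) by linarith
      then show ?thesis by (intro mult_nonneg_nonpos) auto
    qed
    finally show ?thesis by simp
  qed
  \<comment> \<open>Scaled so that \<open>\<kappa> * y\<close> starts below \<open>W\<close>
    together with its derivative: y(\<tau>) = e^(3 + 1/12) <= e^4, and y' = l y with l(\<tau>) <=
    3H.\<close>
  define \<kappa> where "\<kappa> = \<eta> / ((1 + 3 * H) * exp 4)"
  have \<kappa>0: "\<kappa> \<ge> 0" using init H by (simp add: \<kappa>_def)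
  have y\<tau>: "y \<tau> \<le> exp 4" "y \<tau> > 0" using H by (auto simp: y_def a_def)
  have l\<tau>: "0 \<le> l \<tau>" "l \<tau> \<le> 3 * H"
    using H by (auto simp: l_def a_def field_simps power2_eq_square)
  have init': "\<kappa> * y \<tau> \<le> \<eta>" "\<kappa> * (l \<tau> * y \<tau>) \<le> \<eta>"
  proof -
    have "1 * y \<tau> \<le> (1 + 3 * H) * exp 4" "l \<tau> * y \<tau> \<le> (1 + 3 * H) * exp 4"
      using y\<tau> l\<tau> H by (intro mult_mono; simp)+
    then have "\<kappa> * y \<tau> \<le> \<kappa> * ((1 + 3 * H) * exp 4)" "\<kappa> * (l \<tau> * y \<tau>) \<le> \<kappa> * ((1 + 3 * H) * exp 4)"
      using \<kappa>0 by (auto intro: mult_left_mono)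
    moreover have "\<kappa> * ((1 + 3 * H) * exp 4) = \<eta>" using H by (simp add: \<kappa>_def)
    ultimately show "\<kappa> * y \<tau> \<le> \<eta>" "\<kappa> * (l \<tau> * y \<tau>) \<le> \<eta>" by auto
  qed
  have "W u - \<kappa> * y u \<ge> 0"
  proof (rule second_order_comparison(1)[where r=\<tau> and u=u and k="\<lambda>t. (a t)\<^sup>2" and K="(a u)\<^sup>2"
        and f="\<lambda>t. W t - \<kappa> * y t" and f'="\<lambda>t. W' t - \<kappa> * (l t * y t)"
        and f''="\<lambda>t. W'' t - \<kappa> * (((l t)\<^sup>2 + H * a t + H ^ 3 / (4 * a t)) * y t)"])
    have "isCont y t" "isCont (\<lambda>t. l t * y t) t" for t using dy dly DERIV_isCont by blast+
    then have "continuous_on {\<tau>..u} y" "continuous_on {\<tau>..u} (\<lambda>t. l t * y t)"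
      by (auto intro: continuous_at_imp_continuous_on)
    then show "continuous_on {\<tau>..u} (\<lambda>t. W t - \<kappa> * y t)" "continuous_on {\<tau>..u} (\<lambda>t. W' t - \<kappa> * (l t * y t))"
      by (auto intro!: continuous_intros cW cW' simp del: mult.assoc)
    fix t assume t: "\<tau> < t" "t < u"
    show "((\<lambda>t. W t - \<kappa> * y t) has_real_derivative W' t - \<kappa> * (l t * y t)) (at t)"
      using d[OF t] by (intro DERIV_diff DERIV_cmult dy)
    show "((\<lambda>t. W' t - \<kappa> * (l t * y t)) has_real_derivative
        W'' t - \<kappa> * (((l t)\<^sup>2 + H * a t + H ^ 3 / (4 * a t)) * y t)) (at t)"
      using d'[OF t] by (intro DERIV_diff DERIV_cmult dly)
    have "((l t)\<^sup>2 + H * a t + H ^ 3 / (4 * a t)) * y t \<le> (a t)\<^sup>2 * y t"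
      using sub[of t] t by (intro mult_right_mono) (auto simp: y_def)
    then have "\<kappa> * (((l t)\<^sup>2 + H * a t + H ^ 3 / (4 * a t)) * y t) \<le> \<kappa> * ((a t)\<^sup>2 * y t)"
      using \<kappa>0 by (rule mult_left_mono)
    then show "(a t)\<^sup>2 * (W t - \<kappa> * y t) \<le> W'' t - \<kappa> * (((l t)\<^sup>2 + H * a t + H ^ 3 / (4 * a t)) * y t)"
      using lb[OF t, folded a_def] unfolding right_diff_distrib by (simp only: mult_ac)
    have "a t \<le> a u" unfolding a_def using t H by simp
    then show "0 \<le> (a t)\<^sup>2 \<and> (a t)\<^sup>2 \<le> (a u)\<^sup>2" using a0[of t] by (auto intro: power_mono)
  qed (use init init' u in auto)
  moreover have "y u \<ge> exp (3 * exp (H * (u - \<tau>)) - H / 2 * (u - \<tau>))"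
    using H by (simp add: y_def a_def)
  then have "\<kappa> * y u \<ge> \<kappa> * exp (3 * exp (H * (u - \<tau>)) - H / 2 * (u - \<tau>))"
    using \<kappa>0 by (rule mult_left_mono)
  ultimately show ?thesis unfolding \<kappa>_def by linarith
qed

text \<open>The solution doubles on successive intervals of lengths \<open>(1 - r) r\<^sup>i\<close>, whose total length is one.\<close>

lemma power_ode_blowup:
  fixes q :: real
  assumes q: "q > 1"
  shows "\<exists>K>0. \<forall>(y::real\<Rightarrow>real) y' y'' s k Y.
     continuous_on {s..s+1} y \<longrightarrow> continuous_on {s..s+1} y' \<longrightarrow>
     (\<forall>t. s < t \<and> t < s + 1 \<longrightarrow> (y has_real_derivative y' t) (at t)
        \<and> (y' has_real_derivative y'' t) (at t) \<and> y'' t \<ge> k * (y t) powr q) \<longrightarrow>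
     y s \<ge> Y \<longrightarrow> Y > 0 \<longrightarrow> y' s \<ge> 0 \<longrightarrow> k \<ge> 0 \<longrightarrow> k * Y powr (q - 1) < K"
proof -
  \<comment> \<open>Each doubling of y raises the lower bound for y'' by 2^q. Shortening the next
    interval by \<open>r\<close> keeps the gain k (2^i Y)^q h^2/2 the same multiple of 2^i Y at
    every stage, because 2^(q-1) r^2 = 1.\<close>
  define r where "r = 2 powr (- ((q - 1) / 2))"
  have r: "0 < r" "r < 1" using q by (auto simp: r_def powr_less_one)
  have r2: "r\<^sup>2 = 2 powr (- (q - 1))"
    unfolding r_def power2_eq_square powr_add[symmetric] by simp
  show ?thesis
  proof (intro exI[of _ "2 / (1 - r)\<^sup>2"] conjI allI impI)
    show "0 < 2 / (1 - r)\<^sup>2" using r by simp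
    fix y y' y'' :: "real \<Rightarrow> real" and s k Y :: real
    assume cy: "continuous_on {s..s+1} y" and cy': "continuous_on {s..s+1} y'"
      and d: "\<forall>t. s < t \<and> t < s + 1 \<longrightarrow> (y has_real_derivative y' t) (at t)
        \<and> (y' has_real_derivative y'' t) (at t) \<and> y'' t \<ge> k * (y t) powr q"
      and init: "y s \<ge> Y" "Y > 0" "y' s \<ge> 0" and k: "k \<ge> 0"
    show "k * Y powr (q - 1) < 2 / (1 - r)\<^sup>2"
    proof (rule ccontr)
      assume "\<not> ?thesis"
      then have big: "k * Y powr (q - 1) * (1 - r)\<^sup>2 / 2 \<ge> 1" using r by (simp add: field_simps)
      have step: "y (s + (1 - r ^ i)) \<ge> 2 ^ i * Y \<and> y' (s + (1 - r ^ i)) \<ge> 0" for i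
      proof (induction i)
        case 0 then show ?case using init by simp
      next
        case (Suc i)
        define x where "x = s + (1 - r ^ i)"
        define h where "h = (1 - r) * r ^ i"
        have x: "s \<le> x" "x + h = s + (1 - r ^ Suc i)" "x + h \<le> s + 1" "h > 0"
          using r by (auto simp: x_def h_def power_le_one algebra_simps)
        have IH: "y x \<ge> 2 ^ i * Y" "y' x \<ge> 0" using Suc by (auto simp: x_def)
        have y''0: "y'' t \<ge> 0" if "x < t" "t < x + h" for t
          using d[rule_format, of t] that x k by (smt (verit) mult_nonneg_nonneg powr_ge_zero)
        have cont: "continuous_on {x..x+h} y" "continuous_on {x..x+h} y'"
          using x by (auto intro: continuous_on_subset[OF cy] continuous_on_subset[OF cy'])
        have yx: "y t \<ge> y x" "y' t \<ge> y' x" if "x \<le> t" "t \<le> x + h" for t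
        proof -
          have "y t \<ge> y x + y' x * (t - x) + 0 * (t - x)\<^sup>2 / 2" "y' t \<ge> y' x + 0 * (t - x)"
            by (rule second_derivative_lower_bound[OF cont, where f''=y''];
                use d x y''0 that in \<open>force simp del: power_Suc\<close>)+
          then show "y t \<ge> y x" "y' t \<ge> y' x" using IH that by (auto intro: order.trans[rotated])
        qed
        have "y (x + h) \<ge> y x + y' x * (x + h - x) + (k * (2 ^ i * Y) powr q) * (x + h - x)\<^sup>2 / 2"
        proof (rule second_derivative_lower_bound(2)[OF cont, where f''=y''])
          fix t assume t: "x < t" "t < x + h"
          have "(2 ^ i * Y) powr q \<le> y t powr q"
            using yx[of t] IH t init q by (intro powr_mono2) auto
          then show "k * (2 ^ i * Y) powr q \<le> y'' t"
            using d[rule_format, of t] t x k by (meson le_less_trans less_le_trans mult_left_mono order.trans)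
        qed (use d x in auto)
        then have "y (x + h) \<ge> 2 ^ i * Y + k * (2 ^ i * Y) powr q * h\<^sup>2 / 2"
          using IH x by (smt (verit) add_diff_cancel_left' mult_nonneg_nonneg)
        moreover have "k * (2 ^ i * Y) powr q * h\<^sup>2 / 2 = 2 ^ i * Y * (k * Y powr (q - 1) * (1 - r)\<^sup>2 / 2)"
        proof -
          have "(2 ^ i * Y) powr q = (2 ^ i * Y) powr (1 + (q - 1))" by simp
          also have "\<dots> = (2 ^ i * Y) * (2 ^ i * Y) powr (q - 1)" using init by (simp only: powr_add) simp
          also have "(2 ^ i * Y) powr (q - 1) = (2 powr (q - 1)) ^ i * Y powr (q - 1)"
            using init by (simp add: powr_mult powr_power powr_realpow[symmetric] powr_powr mult.commute)
          finally have "(2 ^ i * Y) powr q = 2 ^ i * Y * ((2 powr (q - 1)) ^ i * Y powr (q - 1))" .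
          moreover have "h\<^sup>2 = (1 - r)\<^sup>2 * (r\<^sup>2) ^ i" by (simp add: h_def power_mult_distrib power_mult[symmetric] mult.commute)
          moreover have "(2 powr (q - 1)) ^ i * (r\<^sup>2) ^ i = 1"
            unfolding power_mult_distrib[symmetric] r2 by (simp add: powr_add[symmetric])
          ultimately show ?thesis by (simp add: mult_ac)
        qed
        moreover have "2 ^ i * Y * (k * Y powr (q - 1) * (1 - r)\<^sup>2 / 2) \<ge> 2 ^ i * Y * 1"
          using big init by (intro mult_left_mono) auto
        ultimately have "y (x + h) \<ge> 2 ^ i * Y + 2 ^ i * Y * 1" by linarith
        then have "y (x + h) \<ge> 2 ^ Suc i * Y" by (simp only: power_Suc)
        moreover have "y' (x + h) \<ge> 0" using yx(2)[of "x + h"] IH x(4) by simp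
        ultimately show ?case unfolding x(2) by simp
      qed
      \<comment> \<open>All stages end before s + 1, and y is continuous up to that point.\<close>
      have "bounded (y ` {s..s+1})" by (intro compact_imp_bounded compact_continuous_image cy) auto
      then obtain B where B: "\<And>t. t \<in> {s..s+1} \<Longrightarrow> \<bar>y t\<bar> \<le> B"
        unfolding bounded_real by blast
      obtain i where "B / Y < 2 ^ i" using real_arch_pow[of 2 "B / Y"] by auto
      then have "B < 2 ^ i * Y" using init by (simp add: field_simps)
      moreover have "\<bar>y (s + (1 - r ^ i))\<bar> \<le> B" using r by (intro B) (auto simp: power_le_one)
      ultimately show False using step[of i] by linarith
    qed
  qed
qed

section \<open>A weighted Laplace transform estimate\<close>

text \<open>A discrete form of the scale-invariant integral of x^s e^(-x/2) dx/x, whence the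
  independence of z. Each term is at most a multiple of F(x) - F(x e^(-H)) for the bounded
  increasing function F = x^s/(1 + x^s), so the sum telescopes.\<close>

lemma geometric_kernel_sum:
  fixes s H :: real
  assumes s: "s > 0" and H: "H > 0"
  shows "\<exists>C>0. \<forall>z>0. \<forall>N. (\<Sum>j<N. (z * exp (- H * real j)) powr s * exp (- (z * exp (- H * real j)) / 2)) \<le> C"
proof -
  obtain D where D: "D \<ge> 1" "\<And>x. x \<ge> 0 \<Longrightarrow> (1 + x) powr (2 * s) \<le> D * exp (x / 4)"
    using one_plus_powr_le_exp[of "2 * s"] s by auto
  define r where "r = exp (- H * s)"
  have r: "0 < r" "r < 1" using s H by (auto simp: r_def)
  define F where "F x = x powr s / (1 + x powr s)" for x :: real
  define C where "C = 4 * D / (1 - r)"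
  have C: "C > 0" using D r by (auto simp: C_def)
  have key: "x powr s * exp (- x / 2) \<le> C * (F x - F (x * exp (- H)))" if x: "x > 0" for x
  proof -
    define w where "w = x powr s"
    have w: "w > 0" using x by (simp add: w_def)
    have rw: "(x * exp (- H)) powr s = r * w"
      using x by (simp add: powr_mult w_def r_def exp_powr_real mult.commute)
    have "1 + w \<le> 2 * (1 + x) powr s"
    proof -
      have "w \<le> (1 + x) powr s" unfolding w_def using x s by (intro powr_mono2) auto
      moreover have "1 \<le> (1 + x) powr s" using x s by (intro ge_one_powr_ge_zero) auto
      ultimately show ?thesis by linarith
    qed
    then have "(1 + w) * (1 + w) \<le> (2 * (1 + x) powr s) * (2 * (1 + x) powr s)"
      using w by (intro mult_mono) auto
    also have "\<dots> = 4 * (1 + x) powr (2 * s)" using x by (simp flip: powr_add)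
    also have "\<dots> \<le> 4 * (D * exp (x / 4))" using D(2)[of x] x by simp
    also have "\<dots> \<le> 4 * (D * exp (x / 2))" using D x by simp
    finally have 1: "(1 + w) * (1 + w) * exp (- x / 2) \<le> 4 * D"
      by (simp add: exp_minus field_simps)
    have "(1 + w) * (1 + r * w) * exp (- x / 2) \<le> (1 + w) * (1 + w) * exp (- x / 2)"
      using w r by (intro mult_right_mono mult_left_mono) auto
    with 1 have "(1 + w) * (1 + r * w) * exp (- x / 2) \<le> 4 * D" by linarith
    then have "exp (- x / 2) \<le> 4 * D / ((1 + w) * (1 + r * w))"
      using w r by (simp add: field_simps add_pos_pos)
    then have "w * exp (- x / 2) \<le> w * (4 * D / ((1 + w) * (1 + r * w)))"
      using w by (intro mult_left_mono) auto
    also have "\<dots> = C * (w / (1 + w) - r * w / (1 + r * w))"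
    proof -
      have "1 + w \<noteq> 0" "1 + r * w \<noteq> 0" "1 - r \<noteq> 0"
        using w r mult_pos_pos[of r w] by (auto simp del: mult_pos_pos)
      moreover from this have "w / (1 + w) - r * w / (1 + r * w) = (1 - r) * w / ((1 + w) * (1 + r * w))"
        by (simp add: divide_simps) (simp add: algebra_simps)
      ultimately show ?thesis unfolding C_def by simp
    qed
    finally show ?thesis unfolding F_def rw w_def[symmetric] .
  qed
  have "(\<Sum>j<N. (z * exp (- H * real j)) powr s * exp (- (z * exp (- H * real j)) / 2)) \<le> C"
    if z: "z > 0" for z N
  proof -
    have "(\<Sum>j<N. (z * exp (- H * real j)) powr s * exp (- (z * exp (- H * real j)) / 2))
      \<le> (\<Sum>j<N. C * (F (z * exp (- H * real j)) - F (z * exp (- H * real (Suc j)))))"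
    proof (rule sum_mono)
      fix j
      have "z * exp (- H * real (Suc j)) = z * exp (- H * real j) * exp (- H)"
        by (simp add: algebra_simps flip: exp_add)
      then show "(z * exp (- H * real j)) powr s * exp (- (z * exp (- H * real j)) / 2)
        \<le> C * (F (z * exp (- H * real j)) - F (z * exp (- H * real (Suc j))))"
        using key[of "z * exp (- H * real j)"] z by (simp only:) simp
    qed
    also have "\<dots> = C * (F (z * exp (- H * real 0)) - F (z * exp (- H * real N)))"
      unfolding sum_distrib_left[symmetric] by (subst sum_lessThan_telescope') simp
    also have "\<dots> \<le> C * (1 - 0)"
      using C by (intro mult_left_mono diff_mono) (auto simp: F_def divide_simps add_pos_nonneg)
    finally show ?thesis by simp
  qed
  then show ?thesis using C by blast
qed

text \<open>By convexity the tangent to u^p at z = I/B lies below u^p; integrating this against g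
  gives the claim. An upper bound B of the mass of g suffices, because the mass occurs with the
  nonnegative factor (p - 1) z^p.\<close>

lemma weighted_Hoelder:
  fixes h g :: "'a \<Rightarrow> real"
  assumes p: "p > 1" and nn: "\<And>x. h x \<ge> 0" "\<And>x. g x \<ge> 0"
    and int: "integrable M g" "integrable M (\<lambda>x. h x * g x)" "integrable M (\<lambda>x. h x powr p * g x)"
    and B: "integral\<^sup>L M g \<le> B" "B > 0"
  shows "(integral\<^sup>L M (\<lambda>x. h x * g x)) powr p \<le> B powr (p - 1) * integral\<^sup>L M (\<lambda>x. h x powr p * g x)"
proof -
  define I where "I = integral\<^sup>L M (\<lambda>x. h x * g x)"
  define J where "J = integral\<^sup>L M (\<lambda>x. h x powr p * g x)"
  have I0: "I \<ge> 0" unfolding I_def using nn by (intro Bochner_Integration.integral_nonneg) auto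
  define z where "z = I / B"
  have z0: "z \<ge> 0" using I0 B by (simp add: z_def)
  have tangent: "p * z powr (p - 1) * u \<le> u powr p + (p - 1) * z powr p" if u: "u \<ge> 0" for u
  proof -
    define q where "q = p / (p - 1)"
    have q: "1 / p + 1 / q = 1" "q > 1" using p by (auto simp: q_def field_simps)
    have "u * z powr (p - 1) \<le> u powr p / p + (z powr (p - 1)) powr q / q"
      using Youngs_inequality[of p q u "z powr (p - 1)"] p q u by auto
    moreover have "(z powr (p - 1)) powr q = z powr p" using p by (simp add: powr_powr q_def)
    moreover have "p * (u powr p / p + z powr p / q) = u powr p + (p - 1) * z powr p"
      using p by (simp add: q_def field_simps)
    moreover have "p * (u * z powr (p - 1)) \<le> p * (u powr p / p + (z powr (p - 1)) powr q / q)"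
      using calculation(1) p by (intro mult_left_mono) auto
    ultimately show ?thesis by (simp only: mult_ac)
  qed
  have "p * z powr (p - 1) * I = integral\<^sup>L M (\<lambda>x. p * z powr (p - 1) * (h x * g x))"
    by (simp add: I_def)
  also have "\<dots> \<le> integral\<^sup>L M (\<lambda>x. h x powr p * g x + (p - 1) * z powr p * g x)"
  proof (rule integral_mono)
    fix x
    have "p * z powr (p - 1) * h x * g x \<le> (h x powr p + (p - 1) * z powr p) * g x"
      using tangent[OF nn(1)] nn(2) by (rule mult_right_mono)
    then show "p * z powr (p - 1) * (h x * g x) \<le> h x powr p * g x + (p - 1) * z powr p * g x"
      by (simp add: algebra_simps)
  qed (use int in auto)
  also have "\<dots> = J + (p - 1) * z powr p * integral\<^sup>L M g"
    using int by (simp add: J_def)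
  also have "\<dots> \<le> J + (p - 1) * z powr p * B"
    using B p by (intro add_left_mono mult_left_mono) auto
  finally have 1: "p * z powr (p - 1) * I \<le> J + (p - 1) * z powr p * B" .
  have "I = z * B" using B by (simp add: z_def)
  moreover have "z powr (p - 1) * z = z powr p"
    using z0 p by (cases "z = 0") (auto simp: powr_diff)
  ultimately have "p * z powr (p - 1) * I = p * z powr p * B" by (simp add: mult_ac)
  with 1 have "p * (z powr p * B) \<le> J + (p - 1) * (z powr p * B)" by (simp only: mult.assoc)
  then have "z powr p * B \<le> J" by (simp only: left_diff_distrib)
  then have "B powr (p - 1) * (z powr p * B) \<le> B powr (p - 1) * J" by (intro mult_left_mono) auto
  moreover have "B powr (p - 1) * (z powr p * B) = I powr p"
    using I0 B by (simp add: z_def powr_divide powr_diff)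
  ultimately show ?thesis by (simp add: I_def J_def)
qed

section \<open>Integrals of radial weights over a ball, by unit shells\<close>

lemma power_diff_le:
  fixes x y :: real
  assumes "0 \<le> y" "y \<le> x" shows "x ^ n - y ^ n \<le> real n * x ^ (n - 1) * (x - y)"
proof (induction n)
  case (Suc n)
  have "x ^ Suc n - y ^ Suc n = x * (x ^ n - y ^ n) + y ^ n * (x - y)" by (simp add: algebra_simps)
  also have "\<dots> \<le> x * (real n * x ^ (n - 1) * (x - y)) + x ^ n * (x - y)"
    using Suc assms by (intro add_mono mult_left_mono mult_right_mono power_mono) auto
  also have "\<dots> = real (Suc n) * x ^ (Suc n - 1) * (x - y)"
    by (cases n) (auto simp: algebra_simps)
  finally show ?case .
qed simp

lemma integrable_continuous_compact_support:
  fixes f :: "'a::euclidean_space \<Rightarrow> real"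
  assumes "continuous_on (cball 0 \<rho>) f" "\<And>x. norm x > \<rho> \<Longrightarrow> f x = 0"
  shows "integrable lborel f"
proof -
  have "integrable lborel (\<lambda>x. indicator (cball 0 \<rho>) x *\<^sub>R f x)"
    using assms(1) by (intro borel_integrable_compact) auto
  moreover have "(\<lambda>x. indicator (cball 0 \<rho>) x *\<^sub>R f x) = f"
    using assms(2) by (auto simp: indicator_def fun_eq_iff not_le)
  ultimately show ?thesis by simp
qed

lemma shell_measure_le:
  assumes "real i \<le> \<rho>"
  shows "measure lborel (cball (0::'a::euclidean_space) (\<rho> - real i) - cball 0 (\<rho> - real i - 1))
    \<le> real DIM('a) * unit_ball_vol (real DIM('a)) * \<rho> ^ (DIM('a) - 1)"
proof -
  let ?n = "DIM('a)" and ?w = "unit_ball_vol (real DIM('a))"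
  define x where "x = \<rho> - real i"
  \<comment> \<open>The inner ball of the last shell has a negative radius and is empty, while the
    volume formula is used with a nonnegative radius.\<close>
  define y where "y = max 0 (x - 1)"
  have xy: "0 \<le> y" "y \<le> x" "x - y \<le> 1" "x \<le> \<rho>" using assms by (auto simp: x_def y_def)
  have "measure lborel (cball (0::'a) x - cball 0 (x - 1)) \<le> ?w * x ^ ?n - ?w * y ^ ?n"
  proof (cases "x \<ge> 1")
    case True
    then show ?thesis using xy emeasure_lborel_cball_finite[of "0::'a" x]
      by (subst measure_Diff) (auto simp: content_cball y_def)
  next
    case False
    then have "cball (0::'a) (x - 1) = {}" by auto
    then show ?thesis using False xy by (auto simp: content_cball y_def zero_power)
  qed
  also have "\<dots> = ?w * (x ^ ?n - y ^ ?n)" by (simp add: algebra_simps)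
  also have "\<dots> \<le> ?w * (real ?n * x ^ (?n - 1) * (x - y))"
    using xy by (intro mult_left_mono power_diff_le) auto
  also have "\<dots> \<le> ?w * (real ?n * \<rho> ^ (?n - 1) * 1)"
    using xy by (intro mult_left_mono mult_mono power_mono) auto
  finally show ?thesis by (simp add: x_def mult_ac)
qed

text \<open>Plays the role of polar coordinates. Every unit shell has measure at most a multiple of
  \<rho>^(n-1), and on the i-th one \<rho> + 1 - |x| >= i + 1, so the decreasing function k is at
  most k(i + 1) there.\<close>

lemma radial_integral_le:
  fixes k :: "real \<Rightarrow> real"
  assumes \<rho>: "\<rho> > 0" and k: "continuous_on {1..} k" "\<And>s. s \<ge> 1 \<Longrightarrow> k s \<ge> 0"
    "\<And>s t. 1 \<le> s \<Longrightarrow> s \<le> t \<Longrightarrow> k t \<le> k s"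
    and S: "\<And>N. (\<Sum>i<N. k (real (Suc i))) \<le> S"
  shows "integrable lborel (\<lambda>x::'a::euclidean_space. indicator (cball 0 \<rho>) x * k (\<rho> + 1 - norm x))"
    and "(LINT x::'a|lborel. indicator (cball 0 \<rho>) x * k (\<rho> + 1 - norm x))
      \<le> real DIM('a) * unit_ball_vol (real DIM('a)) * \<rho> ^ (DIM('a) - 1) * S"
proof -
  let ?V = "real DIM('a) * unit_ball_vol (real DIM('a)) * \<rho> ^ (DIM('a) - 1)"
  show int: "integrable lborel (\<lambda>x::'a. indicator (cball 0 \<rho>) x * k (\<rho> + 1 - norm x))"
    unfolding real_scaleR_def[symmetric]
    by (intro borel_integrable_compact continuous_on_compose2[OF k(1)] continuous_intros) auto
  define N where "N = nat \<lfloor>\<rho>\<rfloor> + 1"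
  let ?sh = "\<lambda>i::nat. cball (0::'a) (\<rho> - real i) - cball 0 (\<rho> - real i - 1)"
  have fin: "emeasure lborel (?sh i) < \<infinity>" for i
    by (rule le_less_trans[OF emeasure_mono[of _ "cball 0 (\<rho> - real i)"] emeasure_lborel_cball_finite]) auto
  have int2: "integrable lborel (\<lambda>x. \<Sum>i<N. k (real (Suc i)) * indicator (?sh i) x)"
    using fin by (intro Bochner_Integration.integrable_sum integrable_mult_right integrable_real_indicator) auto
  have "(LINT x::'a|lborel. indicator (cball 0 \<rho>) x * k (\<rho> + 1 - norm x))
    \<le> (LINT x|lborel. (\<Sum>i<N. k (real (Suc i)) * indicator (?sh i) x))"
  proof (rule integral_mono[OF int int2])
    fix x :: 'a
    have nn: "0 \<le> k (real (Suc i)) * indicator (?sh i) x" for i using k(2)[of "real (Suc i)"] by auto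
    show "indicator (cball 0 \<rho>) x * k (\<rho> + 1 - norm x) \<le> (\<Sum>i<N. k (real (Suc i)) * indicator (?sh i) x)"
    proof (cases "x \<in> cball 0 \<rho>")
      case True
      define i where "i = nat \<lfloor>\<rho> - norm x\<rfloor>"
      have i: "real i \<le> \<rho> - norm x" "\<rho> - norm x < real i + 1" "i < N"
        using True unfolding i_def N_def
        by (auto simp: nat_less_iff less_Suc_eq_le intro!: nat_mono floor_mono)
      then have sh: "x \<in> ?sh i" by auto
      have "indicator (cball 0 \<rho>) x * k (\<rho> + 1 - norm x) \<le> k (real (Suc i)) * indicator (?sh i) x"
        using sh True i k(3)[of "real (Suc i)" "\<rho> + 1 - norm x"] by (auto simp: algebra_simps)
      also have "\<dots> \<le> (\<Sum>i<N. k (real (Suc i)) * indicator (?sh i) x)"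
        using i nn by (intro member_le_sum) auto
      finally show ?thesis .
    qed (use nn in \<open>auto intro: sum_nonneg\<close>)
  qed
  also have "\<dots> = (\<Sum>i<N. k (real (Suc i)) * measure lborel (?sh i))"
    using fin by (subst Bochner_Integration.integral_sum) auto
  also have "\<dots> \<le> (\<Sum>i<N. k (real (Suc i)) * ?V)"
  proof (intro sum_mono mult_left_mono shell_measure_le)
    fix i assume "i \<in> {..<N}"
    then show "real i \<le> \<rho>" using \<rho> by (auto simp: N_def) linarith
    show "0 \<le> k (real (Suc i))" by (rule k(2)) simp
  qed
  also have "\<dots> = ?V * (\<Sum>i<N. k (real (Suc i)))"
    unfolding sum_distrib_left by (intro sum.cong) (auto simp: mult_ac)
  also have "\<dots> \<le> ?V * S" using S \<rho> by (intro mult_left_mono) auto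
  finally show "(LINT x::'a|lborel. indicator (cball 0 \<rho>) x * k (\<rho> + 1 - norm x)) \<le> ?V * S" .
qed

text \<open>The sum analogue of the integral of e^(-ls/2) s^(-1/2), which scales like l^(-1/2). The
  terms are dominated by the increments of F(s) = sqrt (s/(1 + ls)), and F is bounded by 1/sqrt
  l.\<close>

lemma exp_sqrt_sum_le:
  assumes l: "l > 0"
  shows "(\<Sum>i<N. exp (- (l * real (Suc i)) / 2) / sqrt (real (Suc i))) \<le> 32 / sqrt l"
proof -
  define F where "F s = sqrt (s / (1 + l * s))" for s
  have key: "exp (- (l * s) / 2) / sqrt s \<le> 32 * (F s - F (s - 1))" if s: "s \<ge> 1" for s
  proof -
    let ?a = "1 + l * s" and ?b = "1 + l * (s - 1)"
    have ab: "?a \<ge> 1" "?b \<ge> 1" "?b \<le> ?a" using l s by auto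
    have F0: "F s > 0" "F (s - 1) \<ge> 0" unfolding F_def using ab s by (auto intro: divide_nonneg_pos)
    have "(F s)\<^sup>2 - (F (s - 1))\<^sup>2 = s / ?a - (s - 1) / ?b"
      unfolding F_def using ab s by (subst real_sqrt_pow2, simp)+ simp
    also have "\<dots> = 1 / (?a * ?b)" using ab by (simp add: divide_simps) (simp add: algebra_simps)
    finally have "(F s - F (s - 1)) * (F s + F (s - 1)) = 1 / (?a * ?b)"
      by (simp add: power2_eq_square algebra_simps)
    then have "F s - F (s - 1) = 1 / (?a * ?b) / (F s + F (s - 1))"
    proof (rule nonzero_eq_divide_eq[THEN iffD2, rotated])
      show "F s + F (s - 1) \<noteq> 0" using F0 by linarith
    qed
    also have "\<dots> \<ge> 1 / (?a * ?a) / (2 * F s)"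
    proof (intro frac_le)
      have "F (s - 1) \<le> F s"
      proof -
        have "(s - 1) * ?a \<le> s * ?b" by (simp add: algebra_simps)
        then have "(s - 1) / ?b \<le> s / ?a"
          using ab by (intro mult_imp_div_pos_le) (simp_all add: pos_le_divide_eq)
        then show ?thesis unfolding F_def by simp
      qed
      then show "F s + F (s - 1) \<le> 2 * F s" by simp
    qed (use ab F0 in \<open>auto intro: mult_pos_pos add_pos_nonneg\<close>)
    finally have 1: "F s - F (s - 1) \<ge> 1 / (?a * ?a) / (2 * F s)" .
    have "F s \<le> sqrt s" unfolding F_def using ab s by (simp add: divide_le_eq mult_le_cancel_left1)
    then have "1 / (?a * ?a) / (2 * sqrt s) \<le> 1 / (?a * ?a) / (2 * F s)"
      using F0 s ab by (intro divide_left_mono mult_pos_pos) auto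
    with 1 have 2: "1 / (?a * ?a) / (2 * sqrt s) \<le> F s - F (s - 1)" by linarith
    \<comment> \<open>The two factors 1 + ls lost in the increment of F are absorbed by e^(ls/2) at
      the price 16; the square root contributes the remaining 2 of the constant 32.\<close>
    have "?a \<le> 4 * exp (l * s / 4)" using exp_ge_add_one_self[of "l * s / 4"] l s by (simp add: field_simps)
    then have "?a * ?a \<le> (4 * exp (l * s / 4)) * (4 * exp (l * s / 4))" using ab by (intro mult_mono) auto
    also have "\<dots> = 16 * exp (l * s / 2)" by (simp flip: exp_add)
    finally have "?a * ?a * exp (- (l * s) / 2) \<le> 16 * exp (l * s / 2) * exp (- (l * s) / 2)"
      by (intro mult_right_mono) auto
    also have "\<dots> = 16" by (simp flip: exp_add)
    finally have "exp (- (l * s) / 2) \<le> 16 / (?a * ?a)"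
      using ab by (subst pos_le_divide_eq) (auto simp: mult_ac intro: mult_pos_pos)
    then have "exp (- (l * s) / 2) / sqrt s \<le> 16 / (?a * ?a) / sqrt s" using s by (intro divide_right_mono) auto
    also have "\<dots> = 32 * (1 / (?a * ?a) / (2 * sqrt s))" by simp
    also have "\<dots> \<le> 32 * (F s - F (s - 1))" using 2 by (rule mult_left_mono) simp
    finally show ?thesis .
  qed
  have "(\<Sum>i<N. exp (- (l * real (Suc i)) / 2) / sqrt (real (Suc i)))
    \<le> (\<Sum>i<N. 32 * (F (real (Suc i)) - F (real i)))"
    using key[of "real (Suc _)"] by (intro sum_mono) simp
  also have "\<dots> = 32 * (F (real N) - F (real 0))"
    unfolding sum_distrib_left[symmetric] by (subst sum_lessThan_telescope) simp
  also have "\<dots> \<le> 32 * (1 / sqrt l)"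
  proof -
    have "real N / (1 + l * real N) \<le> 1 / l" using l by (simp add: divide_simps add_pos_nonneg)
    then have "F (real N) \<le> sqrt (1 / l)" unfolding F_def by simp
    then show ?thesis by (simp add: F_def real_sqrt_divide)
  qed
  finally show ?thesis by simp
qed

text \<open>A discrete form of \<open>\<integral> l\<^bsup>p-2\<^esup> (\<integral> e\<^bsup>-ls\<^esup> f(s) ds)\<^sup>p dl \<le> C \<integral> f\<^sup>p\<close> in the distance \<open>s = \<rho> - |x|\<close> to the boundary
  of the support, by Schur's test with the weight \<open>s\<^bsup>-1/2\<^esup>\<close>. Shifting \<open>s\<close> by one avoids the singularity of
  the weight and only costs a constant, since the rates are bounded.\<close>

lemma laplace_transform_bound:
  fixes p H l0 :: real
  assumes p: "p > 1" and H: "H > 0" and l0: "l0 > 0"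
  shows "\<exists>C>0. \<forall>\<rho>>0. \<forall>f::'a::euclidean_space \<Rightarrow> real. continuous_on UNIV f \<longrightarrow> (\<forall>x. f x \<ge> 0) \<longrightarrow>
     (\<forall>x. norm x > \<rho> \<longrightarrow> f x = 0) \<longrightarrow>
     (\<forall>N. (\<Sum>j<N. (l0 * exp (- H * real j)) powr (p - 1) *
        (LINT x|lborel. f x * exp (- (l0 * exp (- H * real j)) * (\<rho> - norm x) / 2)) powr p)
      \<le> C * (\<rho> ^ (DIM('a) - 1)) powr (p - 1) * (LINT x|lborel. f x powr p))"
proof -
  \<comment> \<open>The exponent of the distance that remains after Hoelder's inequality with the
    weight of exponent -1/2: p/2 - 1/2.\<close>
  define s where "s = (p - 1) / 2"
  have s: "s > 0" using p by (simp add: s_def)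
  obtain G where G: "G > 0" "\<And>z N. z > 0 \<Longrightarrow>
      (\<Sum>j<N. (z * exp (- H * real j)) powr s * exp (- (z * exp (- H * real j)) / 2)) \<le> G"
    using geometric_kernel_sum[OF s H] by blast
  define D where "D = 32 * (real DIM('a) * unit_ball_vol (real DIM('a)))"
  have D: "D > 0" by (simp add: D_def)
  define C where "C = exp (l0 / 2) powr p * D powr (p - 1) * G"
  have "(\<Sum>j<N. (l0 * exp (- H * real j)) powr (p - 1) *
        (LINT x|lborel. f x * exp (- (l0 * exp (- H * real j)) * (\<rho> - norm x) / 2)) powr p)
      \<le> C * (\<rho> ^ (DIM('a) - 1)) powr (p - 1) * (LINT x|lborel. f x powr p)"
    if \<rho>: "\<rho> > 0" and cf: "continuous_on UNIV f" and f0: "\<And>x. f x \<ge> 0"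
      and supp: "\<And>x. norm x > \<rho> \<Longrightarrow> f x = 0" for \<rho> and f :: "'a \<Rightarrow> real" and N :: nat
  proof -
    define l where "l j = l0 * exp (- H * real j)" for j
    have l: "0 < l j" "l j \<le> l0" for j using l0 H by (auto simp: l_def mult_le_cancel_left1)
    define \<sigma> where "\<sigma> x = \<rho> + 1 - norm x" for x :: 'a
    define E where "E j x = exp (- (l j * \<sigma> x) / 2)" for j x
    have \<sigma>1: "\<sigma> x \<ge> 1" if "norm x \<le> \<rho>" for x using that by (simp add: \<sigma>_def)
    have cf': "continuous_on X f" for X using cf by (rule continuous_on_subset) auto
    have cp: "continuous_on X (\<lambda>x. f x powr p)" for X
      using f0 p by (intro continuous_on_powr' cf' continuous_intros) auto
    have cs: "continuous_on (cball 0 \<rho>) (\<lambda>x. \<sigma> x powr s)"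
      using \<sigma>1 by (intro continuous_on_powr' continuous_intros) (force simp: \<sigma>_def continuous_intros)+
    have cE: "continuous_on X (E j)" for X j unfolding E_def \<sigma>_def by (intro continuous_intros) auto
    have int: "integrable lborel (\<lambda>x. f x * E j x)" "integrable lborel (\<lambda>x. f x powr p * (\<sigma> x powr s * E j x))"
      "integrable lborel (\<lambda>x. f x powr p)" for j
      by (rule integrable_continuous_compact_support[of \<rho>];
          use supp cf' cp cs cE p in \<open>simp add: continuous_on_mult\<close>)+
    define B where "B j = D * \<rho> ^ (DIM('a) - 1) / sqrt (l j)" for j
    have B0: "B j > 0" for j using D \<rho> l by (simp add: B_def)
    \<comment> \<open>Hoelder's inequality with g = e^(-l\<sigma>/2) \<sigma>^(-1/2) and h = f
      \<sigma>^(1/2) on the ball. \<open>B j\<close> bounds the mass of g, which is of order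
      \<rho>^(n-1) l^(-1/2).\<close>
    have main: "(LINT x|lborel. f x * E j x) powr p
      \<le> B j powr (p - 1) * (LINT x|lborel. f x powr p * (\<sigma> x powr s * E j x))" for j
    proof -
      define g where "g x = indicator (cball 0 \<rho>) x * (exp (- (l j * \<sigma> x) / 2) / sqrt (\<sigma> x))" for x
      define h where "h x = f x * sqrt (\<sigma> x)" for x
      define k where "k t = exp (- (l j * t) / 2) / sqrt t" for t
      have gk: "g = (\<lambda>x. indicator (cball 0 \<rho>) x * k (\<rho> + 1 - norm x))"
        by (simp add: g_def k_def \<sigma>_def fun_eq_iff)
      have kmono: "k t \<le> k s" if "1 \<le> s" "s \<le> t" for s t
        unfolding k_def using that l(1)[of j] by (intro frac_le) auto
      have ck: "continuous_on {1..} k" unfolding k_def by (intro continuous_intros) auto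
      note rad = radial_integral_le[OF \<rho> ck _ kmono, where S="32 / sqrt (l j)" and 'a='a]
      have ig: "integrable lborel g" unfolding gk
        by (rule rad(1)) (use exp_sqrt_sum_le[OF l(1)] in \<open>auto simp: k_def\<close>)
      have Bg: "(LINT x|lborel. g x) \<le> B j"
      proof -
        have "(LINT x|lborel. g x) \<le> real DIM('a) * unit_ball_vol (real DIM('a)) * \<rho> ^ (DIM('a) - 1) * (32 / sqrt (l j))"
          unfolding gk by (rule rad(2)) (use exp_sqrt_sum_le[OF l(1)] in \<open>auto simp: k_def\<close>)
        then show ?thesis by (simp add: B_def D_def mult_ac)
      qed
      have hg: "h x * g x = f x * E j x" for x
        using \<sigma>1[of x] supp[of x] by (cases "norm x \<le> \<rho>") (auto simp: h_def g_def E_def)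
      have hpg: "h x powr p * g x = f x powr p * (\<sigma> x powr s * E j x)" for x
      proof (cases "norm x \<le> \<rho>")
        case True
        have "sqrt (\<sigma> x) powr p / sqrt (\<sigma> x) = \<sigma> x powr (p / 2) / \<sigma> x powr (1 / 2)"
          using \<sigma>1[OF True] by (simp add: powr_half_sqrt[symmetric] powr_powr)
        also have "\<dots> = \<sigma> x powr s" using \<sigma>1[OF True] by (simp add: powr_diff[symmetric] s_def diff_divide_distrib)
        finally show ?thesis using \<sigma>1[OF True] True f0[of x]
          by (simp add: h_def g_def E_def powr_mult field_simps)
      qed (use supp[of x] p in \<open>auto simp: h_def\<close>)
      have "(LINT x|lborel. h x * g x) powr p \<le> B j powr (p - 1) * (LINT x|lborel. h x powr p * g x)"
      proof (rule weighted_Hoelder[OF p])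
        show "h x \<ge> 0" for x using f0[of x] supp[of x] \<sigma>1[of x]
          by (cases "norm x \<le> \<rho>") (auto simp: h_def)
        show "g x \<ge> 0" for x using \<sigma>1[of x] by (auto simp: g_def indicator_def)
      qed (use ig Bg B0 int hg hpg in \<open>auto simp: hg hpg\<close>)
      then show ?thesis by (simp only: hg hpg)
    qed
    have shift: "(LINT x|lborel. f x * exp (- l j * (\<rho> - norm x) / 2)) powr p
      \<le> exp (l0 / 2) powr p * (LINT x|lborel. f x * E j x) powr p" for j
    proof -
      have eq: "f x * exp (- l j * (\<rho> - norm x) / 2) = exp (l j / 2) * (f x * E j x)" for x
        by (simp add: E_def \<sigma>_def field_simps flip: exp_add)
      have nn: "0 \<le> (LINT x|lborel. f x * E j x)"
        using f0 by (intro Bochner_Integration.integral_nonneg) (auto simp: E_def)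
      have "(LINT x|lborel. f x * exp (- l j * (\<rho> - norm x) / 2)) = exp (l j / 2) * (LINT x|lborel. f x * E j x)"
        unfolding eq by simp
      also have "\<dots> \<le> exp (l0 / 2) * (LINT x|lborel. f x * E j x)"
        using nn l by (intro mult_right_mono) auto
      finally have "(LINT x|lborel. f x * exp (- l j * (\<rho> - norm x) / 2)) powr p
        \<le> (exp (l0 / 2) * (LINT x|lborel. f x * E j x)) powr p"
        using p f0 by (intro powr_mono2 Bochner_Integration.integral_nonneg) auto
      then show ?thesis using nn by (simp add: powr_mult)
    qed
    let ?R = "(\<rho> ^ (DIM('a) - 1)) powr (p - 1)"
    \<comment> \<open>The remaining l^s joins \<sigma>^s from \<open>main\<close>. For fixed x the
      sum over j is then the one of \<open>geometric_kernel_sum\<close> with z = l0 \<sigma>(x),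
      whose bound does not depend on x.\<close>
    have lB: "l j powr (p - 1) * B j powr (p - 1) = D powr (p - 1) * ?R * l j powr s" for j
    proof -
      have "l j powr (p - 1) / sqrt (l j) powr (p - 1) = l j powr s"
      proof -
        have "sqrt (l j) powr (p - 1) = l j powr ((p - 1) / 2)"
          using l(1)[of j] by (simp add: powr_half_sqrt[symmetric] powr_powr)
        then show ?thesis using l(1)[of j] by (simp add: powr_diff[symmetric] s_def field_simps)
      qed
      then have "D powr (p - 1) * ?R * (l j powr (p - 1) / sqrt (l j) powr (p - 1)) = D powr (p - 1) * ?R * l j powr s"
        by simp
      then show ?thesis unfolding B_def using D \<rho> l(1)[of j]
        by (simp add: powr_mult powr_divide mult_ac)
    qed
    have "(\<Sum>j<N. l j powr (p - 1) * (LINT x|lborel. f x * exp (- l j * (\<rho> - norm x) / 2)) powr p)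
      \<le> (\<Sum>j<N. exp (l0 / 2) powr p * (D powr (p - 1) * ?R) * (LINT x|lborel. f x powr p * ((l j * \<sigma> x) powr s * E j x)))"
    proof (rule sum_mono)
      fix j
      have "l j powr (p - 1) * (LINT x|lborel. f x * exp (- l j * (\<rho> - norm x) / 2)) powr p
        \<le> l j powr (p - 1) * (exp (l0 / 2) powr p * (B j powr (p - 1) * (LINT x|lborel. f x powr p * (\<sigma> x powr s * E j x))))"
        by (intro mult_left_mono order.trans[OF shift] main) auto
      also have "\<dots> = exp (l0 / 2) powr p * (l j powr (p - 1) * B j powr (p - 1)) * (LINT x|lborel. f x powr p * (\<sigma> x powr s * E j x))"
        by (simp only: mult_ac)
      also have "\<dots> = exp (l0 / 2) powr p * (D powr (p - 1) * ?R) *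
          (LINT x|lborel. l j powr s * (f x powr p * (\<sigma> x powr s * E j x)))"
        unfolding lB using int(2)[of j] by simp
      also have "(LINT x|lborel. l j powr s * (f x powr p * (\<sigma> x powr s * E j x)))
        = (LINT x|lborel. f x powr p * ((l j * \<sigma> x) powr s * E j x))"
      proof (rule Bochner_Integration.integral_cong)
        show "l j powr s * (f x powr p * (\<sigma> x powr s * E j x)) = f x powr p * ((l j * \<sigma> x) powr s * E j x)" for x
          using l(1)[of j] \<sigma>1[of x] supp[of x] p by (cases "norm x \<le> \<rho>") (auto simp: powr_mult mult_ac)
      qed simp
      finally show "l j powr (p - 1) * (LINT x|lborel. f x * exp (- l j * (\<rho> - norm x) / 2)) powr p
        \<le> exp (l0 / 2) powr p * (D powr (p - 1) * ?R) * (LINT x|lborel. f x powr p * ((l j * \<sigma> x) powr s * E j x))" .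
    qed
    also have "\<dots> = exp (l0 / 2) powr p * (D powr (p - 1) * ?R) *
        (\<Sum>j<N. LINT x|lborel. f x powr p * ((l j * \<sigma> x) powr s * E j x))"
      by (simp only: sum_distrib_left)
    also have "\<dots> \<le> exp (l0 / 2) powr p * (D powr (p - 1) * ?R) * (LINT x|lborel. G * f x powr p)"
    proof (intro mult_left_mono)
      have int3: "integrable lborel (\<lambda>x. f x powr p * ((l j * \<sigma> x) powr s * E j x))" for j
      proof (rule integrable_continuous_compact_support[of \<rho>])
        have "continuous_on (cball 0 \<rho>) (\<lambda>x. (l j * \<sigma> x) powr s)"
          using \<sigma>1 l(1)[of j] by (intro continuous_on_powr' continuous_intros) (force simp: \<sigma>_def continuous_intros)+
        then show "continuous_on (cball 0 \<rho>) (\<lambda>x. f x powr p * ((l j * \<sigma> x) powr s * E j x))"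
          using cp cE by (simp add: continuous_on_mult)
      qed (use supp in auto)
      have "(\<Sum>j<N. LINT x|lborel. f x powr p * ((l j * \<sigma> x) powr s * E j x))
        = (LINT x|lborel. (\<Sum>j<N. f x powr p * ((l j * \<sigma> x) powr s * E j x)))"
        using int3 by (subst Bochner_Integration.integral_sum) auto
      also have "\<dots> \<le> (LINT x|lborel. G * f x powr p)"
      proof (rule integral_mono)
        fix x
        show "(\<Sum>j<N. f x powr p * ((l j * \<sigma> x) powr s * E j x)) \<le> G * f x powr p"
        proof (cases "norm x \<le> \<rho>")
          case True
          have "(\<Sum>j<N. (l j * \<sigma> x) powr s * E j x) \<le> G"
            using G(2)[of "l0 * \<sigma> x" N] l0 \<sigma>1[OF True] by (simp add: l_def E_def mult_ac)
          then show ?thesis unfolding sum_distrib_left[symmetric]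
            by (subst mult.commute) (intro mult_right_mono, auto)
        qed (use supp[of x] p in auto)
      qed (use int3 int(3) in auto)
      finally show "(\<Sum>j<N. LINT x|lborel. f x powr p * ((l j * \<sigma> x) powr s * E j x)) \<le> (LINT x|lborel. G * f x powr p)" .
    qed auto
    also have "(LINT x|lborel. G * f x powr p) = G * (LINT x|lborel. f x powr p)" by simp
    finally show ?thesis unfolding l_def C_def by (simp only: mult_ac)
  qed
  moreover have "C > 0" using D G by (simp add: C_def)
  ultimately show ?thesis by blast
qed

section \<open>Integration by parts\<close>

text \<open>The second difference of f over the parallelogram with sides r h and r k equals r^2
  times either mixed derivative at some point of it, by the mean value theorem used twice in either
  order. Continuity at z then forbids different values.\<close>

lemma second_derivative_symmetric:
  fixes f :: "'b::real_normed_vector \<Rightarrow> real"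
  assumes S: "open S" "z \<in> S"
    and f': "\<And>x. x \<in> S \<Longrightarrow> (f has_derivative f' x) (at x)"
    and Dh: "\<And>x. x \<in> S \<Longrightarrow> ((\<lambda>x. f' x h) has_derivative Dh x) (at x)"
    and Dk: "\<And>x. x \<in> S \<Longrightarrow> ((\<lambda>x. f' x k) has_derivative Dk x) (at x)"
    and c: "continuous_on S (\<lambda>x. Dh x k)" "continuous_on S (\<lambda>x. Dk x h)"
  shows "Dh z k = Dk z h"
proof (rule ccontr)
  assume ne: "Dh z k \<noteq> Dk z h"
  define \<epsilon> where "\<epsilon> = \<bar>Dh z k - Dk z h\<bar> / 2"
  have \<epsilon>: "\<epsilon> > 0" using ne by (simp add: \<epsilon>_def)
  obtain d0 where d0: "d0 > 0" "ball z d0 \<subseteq> S" using S open_contains_ball by blast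
  have "isCont (\<lambda>x. Dh x k) z" "isCont (\<lambda>x. Dk x h) z"
    using c S by (auto simp: continuous_on_eq_continuous_at)
  then obtain d1 d2 where d: "d1 > 0" "\<And>x. dist x z < d1 \<Longrightarrow> \<bar>Dh x k - Dh z k\<bar> < \<epsilon>"
      "d2 > 0" "\<And>x. dist x z < d2 \<Longrightarrow> \<bar>Dk x h - Dk z h\<bar> < \<epsilon>"
    using \<epsilon> unfolding continuous_at_eps_delta dist_real_def by metis
  \<comment> \<open>Keeps the parallelogram inside the ball on which both continuity estimates hold;
    the summand 1 keeps the denominator positive when h = k = 0.\<close>
  define r where "r = Min {d0, d1, d2} / (norm h + norm k + 1) / 2"
  define m where "m = Min {d0, d1, d2}"
  have m: "m > 0" "m \<le> d0" "m \<le> d1" "m \<le> d2" using d0 d by (auto simp: m_def)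
  have r: "r > 0" using m unfolding r_def m_def[symmetric]
    by (intro divide_pos_pos) (auto intro: add_nonneg_pos)
  have rm: "r * (norm h + norm k) < m"
  proof -
    have "r * (norm h + norm k) \<le> r * (norm h + norm k + 1)" using r by (intro mult_left_mono) auto
    also have "\<dots> = m / 2" unfolding r_def m_def[symmetric]
      using add_nonneg_pos[of "norm h + norm k" 1] by (simp add: field_simps)
    finally show ?thesis using m by linarith
  qed
  let ?p = "\<lambda>s t. z + s *\<^sub>R h + t *\<^sub>R k"
  have near: "dist (?p s t) z < m" if "0 \<le> s" "s \<le> r" "0 \<le> t" "t \<le> r" for s t
  proof -
    have "dist (?p s t) z = norm (s *\<^sub>R h + t *\<^sub>R k)" by (simp add: dist_norm)
    also have "\<dots> \<le> s * norm h + t * norm k" using that by (intro norm_triangle_le) auto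
    also have "\<dots> \<le> r * norm h + r * norm k" using that by (intro add_mono mult_right_mono) auto
    finally show ?thesis using rm by (simp add: algebra_simps)
  qed
  have inS: "?p s t \<in> S" if "0 \<le> s" "s \<le> r" "0 \<le> t" "t \<le> r" for s t
    using near[OF that] m d0 by (auto simp: dist_commute)
  have line_s: "((\<lambda>s. F (?p s t)) has_real_derivative F' h) (at s)"
    if "(F has_derivative F') (at (?p s t))" for F :: "'b \<Rightarrow> real" and F' s t
  proof -
    have "((\<lambda>s. F (?p s t)) has_derivative (\<lambda>x. F' (x *\<^sub>R h))) (at s)"
      by (rule has_derivative_compose[where f="\<lambda>s. ?p s t" and g=F, OF _ that]) (auto intro!: derivative_eq_intros)
    moreover have "(\<lambda>x. F' (x *\<^sub>R h)) = (*) (F' h)"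
      using has_derivative_linear[OF that] by (auto simp: linear_scale mult.commute)
    ultimately show ?thesis by (simp add: has_field_derivative_def)
  qed
  have line_t: "((\<lambda>t. F (?p s t)) has_real_derivative F' k) (at t)"
    if "(F has_derivative F') (at (?p s t))" for F :: "'b \<Rightarrow> real" and F' s t
  proof -
    have "((\<lambda>t. F (?p s t)) has_derivative (\<lambda>x. F' (x *\<^sub>R k))) (at t)"
      by (rule has_derivative_compose[where f="\<lambda>t. ?p s t" and g=F, OF _ that]) (auto intro!: derivative_eq_intros)
    moreover have "(\<lambda>x. F' (x *\<^sub>R k)) = (*) (F' k)"
      using has_derivative_linear[OF that] by (auto simp: linear_scale mult.commute)
    ultimately show ?thesis by (simp add: has_field_derivative_def)
  qed
  define \<Delta> where "\<Delta> = f (?p r r) - f (?p r 0) - (f (?p 0 r) - f (?p 0 0))"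
  have "\<exists>s t. 0 < s \<and> s < r \<and> 0 < t \<and> t < r \<and> \<Delta> = r * (r * Dh (?p s t) k)"
  proof -
    have "\<exists>s>0. s < r \<and> (f (?p r r) - f (?p r 0)) - (f (?p 0 r) - f (?p 0 0))
        = (r - 0) * (f' (?p s r) h - f' (?p s 0) h)"
      by (rule MVT2[OF r]) (auto intro!: DERIV_diff line_s[OF f'] inS simp: less_imp_le[OF r] simp del: scaleR_zero_left)
    then obtain s where s: "0 < s" "s < r" "\<Delta> = r * (f' (?p s r) h - f' (?p s 0) h)"
      by (auto simp: \<Delta>_def)
    have "\<exists>t>0. t < r \<and> f' (?p s r) h - f' (?p s 0) h = (r - 0) * Dh (?p s t) k"
      using s by (intro MVT2[OF r] line_t[OF Dh] inS) auto
    then show ?thesis using s by auto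
  qed
  then obtain s t where st: "0 < s" "s < r" "0 < t" "t < r" "\<Delta> = r * (r * Dh (?p s t) k)" by blast
  have "\<exists>s t. 0 < s \<and> s < r \<and> 0 < t \<and> t < r \<and> \<Delta> = r * (r * Dk (?p s t) h)"
  proof -
    have "\<exists>t>0. t < r \<and> (f (?p r r) - f (?p 0 r)) - (f (?p r 0) - f (?p 0 0))
        = (r - 0) * (f' (?p r t) k - f' (?p 0 t) k)"
      by (rule MVT2[OF r]) (auto intro!: DERIV_diff line_t[OF f'] inS simp: less_imp_le[OF r] simp del: scaleR_zero_left)
    then obtain t where t: "0 < t" "t < r" "\<Delta> = r * (f' (?p r t) k - f' (?p 0 t) k)"
      by (auto simp: \<Delta>_def)
    have "\<exists>s>0. s < r \<and> f' (?p r t) k - f' (?p 0 t) k = (r - 0) * Dk (?p s t) h"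
      using t by (intro MVT2[OF r] line_s[OF Dk] inS) auto
    then show ?thesis using t by auto
  qed
  then obtain s' t' where st': "0 < s'" "s' < r" "0 < t'" "t' < r" "\<Delta> = r * (r * Dk (?p s' t') h)" by blast
  have "Dh (?p s t) k = Dk (?p s' t') h" using st(5) st'(5) r by simp
  moreover have "\<bar>Dh (?p s t) k - Dh z k\<bar> < \<epsilon>" "\<bar>Dk (?p s' t') h - Dk z h\<bar> < \<epsilon>"
    using near[of s t] near[of s' t'] st(1-4) st'(1-4) m
    by (intro d(2) d(4); linarith)+
  ultimately show False unfolding \<epsilon>_def abs_if by (simp split: if_splits)
qed

section \<open>Integrals of continuous functions with compact support\<close>

abbreviation (input) sym_box :: "real \<Rightarrow> 'a::euclidean_space set" where
  "sym_box K \<equiv> cbox (- (K *\<^sub>R One)) (K *\<^sub>R One)"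

lemma mem_sym_box: "norm (x::'a::euclidean_space) \<le> K \<Longrightarrow> x \<in> sym_box K"
  using Basis_le_norm[of _ x] by (force simp: mem_box abs_le_iff)

text \<open>Continuity in a parameter and the Leibniz rule are applied on a box containing the
  support; this moves integrals there and back.\<close>

lemma integral_UNIV_eq_box:
  fixes f :: "'a::euclidean_space \<Rightarrow> real"
  assumes "\<And>x. norm x > K \<Longrightarrow> f x = 0"
  shows "integral UNIV f = integral (sym_box K) f"
proof -
  have "f x = 0" if "x \<notin> sym_box K" for x
    using assms(1)[of x] mem_sym_box[of x K] that by (cases "norm x \<le> K") auto
  then have "f = (\<lambda>x. if x \<in> sym_box K then f x else 0)"
    by auto
  then show ?thesis by (metis integral_restrict_UNIV)
qed

lemma integrable_UNIV_box:
  fixes f :: "'a::euclidean_space \<Rightarrow> real"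
  assumes "\<And>x. norm x > K \<Longrightarrow> f x = 0" "continuous_on UNIV f"
  shows "f integrable_on UNIV"
proof -
  have "f x = 0" if "x \<notin> sym_box K" for x
    using assms(1)[of x] mem_sym_box[of x K] that by (cases "norm x \<le> K") auto
  then have eq: "f = (\<lambda>x. if x \<in> sym_box K then f x else 0)"
    by auto
  have "f integrable_on sym_box K"
    using assms by (intro integrable_continuous) (auto intro: continuous_on_subset)
  then show ?thesis by (subst eq) (subst integrable_restrict_UNIV)
qed

lemma integral_UNIV_eq_lebesgue:
  fixes f :: "'a::euclidean_space \<Rightarrow> real"
  assumes "\<And>x. norm x > K \<Longrightarrow> f x = 0" "continuous_on UNIV f"
  shows "integral UNIV f = (LINT x|lborel. f x)"
  by (rule integral_lborel, rule integrable_continuous_compact_support[of K])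
    (use assms in \<open>auto intro: continuous_on_subset\<close>)

lemma continuous_on_integral_UNIV:
  fixes f :: "real \<Rightarrow> 'a::euclidean_space \<Rightarrow> real"
  assumes "continuous_on (X \<times> UNIV) (\<lambda>(t, x). f t x)" "\<And>t x. t \<in> X \<Longrightarrow> norm x > K \<Longrightarrow> f t x = 0"
  shows "continuous_on X (\<lambda>t. integral UNIV (f t))"
proof -
  have "continuous_on X (\<lambda>t. integral (sym_box K) (f t))"
    by (rule integral_continuous_on_param) (rule continuous_on_subset[OF assms(1)], auto)
  then show ?thesis
    by (rule continuous_on_cong[THEN iffD1, rotated -1])
      (auto simp: integral_UNIV_eq_box[of K] assms(2))
qed

lemma integral_UNIV_has_derivative:
  fixes f f' :: "real \<Rightarrow> 'a::euclidean_space \<Rightarrow> real"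
  assumes d: "\<And>t x. t \<in> {a..b} \<Longrightarrow> ((\<lambda>t. f t x) has_real_derivative f' t x) (at t within {a..b})"
    and c: "\<And>t. t \<in> {a..b} \<Longrightarrow> continuous_on UNIV (f t)"
    and c': "continuous_on ({a..b} \<times> UNIV) (\<lambda>(t, x). f' t x)"
    and supp: "\<And>t x. t \<in> {a..b} \<Longrightarrow> norm x > K \<Longrightarrow> f t x = 0"
      "\<And>t x. t \<in> {a..b} \<Longrightarrow> norm x > K \<Longrightarrow> f' t x = 0"
    and t: "t \<in> {a..b}"
  shows "((\<lambda>t. integral UNIV (f t)) has_real_derivative integral UNIV (f' t)) (at t within {a..b})"
proof -
  have "((\<lambda>t. integral (sym_box K) (f t)) has_real_derivative integral (sym_box K) (f' t)) (at t within {a..b})"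
    using t c by (intro leibniz_rule_field_derivative d continuous_on_subset[OF c'])
      (auto intro!: integrable_continuous intro: continuous_on_subset)
  then have "((\<lambda>t. integral UNIV (f t)) has_real_derivative integral (sym_box K) (f' t)) (at t within {a..b})"
    by (rule has_field_derivative_transform_within[OF _ zero_less_one t])
      (simp add: integral_UNIV_eq_box[of K] supp)
  then show ?thesis using t by (simp add: integral_UNIV_eq_box[of K "f' t"] supp)
qed

lemma integral_UNIV_zero_imp_zero:
  fixes f :: "'a::euclidean_space \<Rightarrow> real"
  assumes c: "continuous_on UNIV f" and nn: "\<And>x. f x \<ge> 0" and supp: "\<And>x. norm x > K \<Longrightarrow> f x = 0"
    and int: "integral UNIV f = 0"
  shows "f x0 = 0"
proof -
  define L where "L = \<bar>K\<bar> + norm x0 + 1"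
  have L: "L > K" "L > norm x0" "L > 0"
    using norm_ge_zero[of x0] abs_ge_self[of K] abs_ge_zero[of K] unfolding L_def by linarith+
  have cL: "continuous_on (sym_box L) f" using c by (rule continuous_on_subset) auto
  have "integral (sym_box L) f = 0"
    using int supp L integral_UNIV_eq_box[of L f] by fastforce
  then have "(f has_integral 0) (sym_box L)"
    using integrable_continuous[OF cL] by (simp add: has_integral_integral)
  moreover have "box (- (L *\<^sub>R One)) (L *\<^sub>R One) \<noteq> ({}::'a set)"
  proof -
    have "(One::'a) \<bullet> i = 1" if "i \<in> Basis" for i
      using that by (subst inner_sum_left, subst sum.cong[OF refl, of _ _ "\<lambda>x. if x = i then 1 else 0"])
        (auto simp: inner_Basis)
    then have "0 \<in> box (- (L *\<^sub>R One)) (L *\<^sub>R (One::'a))" using L by (simp add: mem_box)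
    then show ?thesis by blast
  qed
  ultimately show ?thesis
    using nn mem_sym_box[of x0 L] L by (intro has_integral_0_cbox_imp_0[OF cL]) auto
qed

text \<open>The integral of a compactly supported function is invariant under translations along \<open>e\<close>;
  differentiating in the translation parameter replaces Fubini and the fundamental theorem.\<close>

lemma integral_directional_derivative:
  fixes F G :: "'a::euclidean_space \<Rightarrow> real"
  assumes d: "\<And>x. ((\<lambda>h. F (x + h *\<^sub>R e)) has_real_derivative G x) (at 0)"
    and c: "continuous_on UNIV F" "continuous_on UNIV G"
    and supp: "\<And>x. norm x > K \<Longrightarrow> F x = 0" "\<And>x. norm x > K \<Longrightarrow> G x = 0"
  shows "integral UNIV G = 0"
proof -
  have d': "((\<lambda>h. F (x + h *\<^sub>R e)) has_real_derivative G (x + h *\<^sub>R e)) (at h within X)" for x h X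
  proof -
    have "((\<lambda>k. F (x + h *\<^sub>R e + k *\<^sub>R e)) has_real_derivative G (x + h *\<^sub>R e)) (at (h - h))"
      using d[of "x + h *\<^sub>R e"] by simp
    then have "((\<lambda>k. F (x + h *\<^sub>R e + (k - h) *\<^sub>R e)) has_real_derivative G (x + h *\<^sub>R e) * 1) (at h)"
      by (rule DERIV_chain2) (auto intro!: derivative_eq_intros)
    then show ?thesis by (simp add: algebra_simps has_field_derivative_at_within)
  qed
  have far: "norm (x + h *\<^sub>R e) > K" if "h \<in> {-1..1}" "norm x > K + norm e" for x h
  proof -
    have "\<bar>h\<bar> * norm e \<le> 1 * norm e" using that by (intro mult_right_mono) auto
    then show ?thesis using norm_diff_ineq[of x "h *\<^sub>R e"] that by simp
  qed
  have cc: "continuous_on X (\<lambda>x. F (x + h *\<^sub>R e))" for h X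
    by (rule continuous_on_compose2[OF c(1)]) (auto intro!: continuous_intros)
  have "((\<lambda>h. integral UNIV (\<lambda>x. F (x + h *\<^sub>R e))) has_real_derivative
      integral UNIV (\<lambda>x. G (x + 0 *\<^sub>R e))) (at 0 within {-1..1})"
  proof (rule integral_UNIV_has_derivative[where K="K + norm e"])
    show "continuous_on ({-1..1} \<times> UNIV) (\<lambda>(h, x). G (x + h *\<^sub>R e))"
      unfolding case_prod_unfold
      by (rule continuous_on_compose2[OF c(2)]) (auto intro!: continuous_intros)
  qed (use d' cc supp far in auto)
  moreover have "integral UNIV (\<lambda>x. F (x + h *\<^sub>R e)) = integral UNIV F" if h: "h \<in> {-1..1}" for h
  proof -
    have "integral UNIV (\<lambda>x. F (x + h *\<^sub>R e)) = (LINT x|lborel. F (x + h *\<^sub>R e))"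
      using h supp far cc by (intro integral_UNIV_eq_lebesgue[where K="K + norm e"]) auto
    also have "\<dots> = (LINT x|distr lborel borel ((+) (h *\<^sub>R e)). F x)"
      using borel_measurable_continuous_onI[OF c(1)] by (subst integral_distr) (auto simp: add.commute)
    also have "\<dots> = (LINT x|lborel. F x)" by (simp add: lborel_distr_plus)
    also have "\<dots> = integral UNIV F"
      using supp c by (intro integral_UNIV_eq_lebesgue[where K=K, symmetric]) auto
    finally show ?thesis .
  qed
  ultimately have "((\<lambda>h. integral UNIV F) has_real_derivative integral UNIV G) (at (0::real) within {-1..1})"
    by (subst has_field_derivative_cong_ev[where g="\<lambda>h. integral UNIV (\<lambda>x. F (x + h *\<^sub>R e))" and v="integral UNIV (\<lambda>x. G (x + 0 *\<^sub>R e))" and y=0 and t="{-1..1}"])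
      (auto simp: eventually_at_filter)
  then have "((\<lambda>h. integral UNIV F) has_real_derivative integral UNIV G) (at (0::real))"
    by (subst (asm) at_within_interior) auto
  then show ?thesis using DERIV_unique[OF _ DERIV_const] by blast
qed

section \<open>Finite speed of propagation\<close>

text \<open>A \<open>C\<^sup>2\<close> function on \<open>[0,\<tau>] \<times> \<real>\<^sup>n\<close>, given by its partial derivatives: \<open>vt\<close>, \<open>vtt\<close> in time,
  \<open>vx e\<close>, \<open>vxx e\<close> in the direction \<open>e\<close>, and the mixed derivative \<open>vtx e\<close>.\<close>

locale C2_strip =
  fixes \<tau> :: real and v vt vtt :: "real \<Rightarrow> 'a::euclidean_space \<Rightarrow> real"
    and vx vtx vxx :: "'a \<Rightarrow> real \<Rightarrow> 'a \<Rightarrow> real"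
  assumes \<tau>: "\<tau> > 0"
    and dv: "\<And>t x. t \<in> {0..\<tau>} \<Longrightarrow> ((\<lambda>s. v s x) has_real_derivative vt t x) (at t within {0..\<tau>})"
    and dvt: "\<And>t x. t \<in> {0..\<tau>} \<Longrightarrow> ((\<lambda>s. vt s x) has_real_derivative vtt t x) (at t within {0..\<tau>})"
    and dvx: "\<And>t x e. t \<in> {0..\<tau>} \<Longrightarrow> e \<in> Basis \<Longrightarrow>
      ((\<lambda>s. vx e s x) has_real_derivative vtx e t x) (at t within {0..\<tau>})"
    and xv: "\<And>t x e. t \<in> {0..\<tau>} \<Longrightarrow> e \<in> Basis \<Longrightarrow>
      ((\<lambda>h. v t (x + h *\<^sub>R e)) has_real_derivative vx e t x) (at 0)"
    and xvx: "\<And>t x e. t \<in> {0..\<tau>} \<Longrightarrow> e \<in> Basis \<Longrightarrow>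
      ((\<lambda>h. vx e t (x + h *\<^sub>R e)) has_real_derivative vxx e t x) (at 0)"
    and xvt: "\<And>t x e. 0 < t \<Longrightarrow> t \<le> \<tau> \<Longrightarrow> e \<in> Basis \<Longrightarrow>
      ((\<lambda>h. vt t (x + h *\<^sub>R e)) has_real_derivative vtx e t x) (at 0)"
    and cv: "continuous_on ({0..\<tau>} \<times> UNIV) (\<lambda>(t, x). v t x)"
    and cvt: "continuous_on ({0..\<tau>} \<times> UNIV) (\<lambda>(t, x). vt t x)"
    and cvtt: "continuous_on ({0..\<tau>} \<times> UNIV) (\<lambda>(t, x). vtt t x)"
    and cvx: "\<And>e. e \<in> Basis \<Longrightarrow> continuous_on ({0..\<tau>} \<times> UNIV) (\<lambda>(t, x). vx e t x)"
    and cvtx: "\<And>e. e \<in> Basis \<Longrightarrow> continuous_on ({0..\<tau>} \<times> UNIV) (\<lambda>(t, x). vtx e t x)"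
    and cvxx: "\<And>e. e \<in> Basis \<Longrightarrow> continuous_on ({0..\<tau>} \<times> UNIV) (\<lambda>(t, x). vxx e t x)"

lemma continuous_on_slice:
  assumes "continuous_on (X \<times> UNIV) (\<lambda>(t, x). f t x)" "t \<in> X"
  shows "continuous_on UNIV (f t)"
proof -
  have "continuous_on UNIV (\<lambda>x. (\<lambda>(t, x). f t x) (t, x))"
    by (rule continuous_on_compose2[OF assms(1)]) (use assms(2) in \<open>auto intro!: continuous_intros\<close>)
  then show ?thesis by simp
qed

text \<open>The truncation is squared so that it stays differentiable across the edge of the cone:
  at a zero the difference quotient of (max 0 h)^2 is at most |h|.\<close>

lemma max0_square_deriv:
  assumes "(f has_real_derivative f') (at t within X)"
  shows "((\<lambda>t. (max 0 (f t))\<^sup>2) has_real_derivative 2 * max 0 (f t) * f') (at t within X)"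
proof -
  have "((\<lambda>z::real. (max 0 z)\<^sup>2) has_real_derivative 2 * max 0 z) (at z)" for z
  proof -
    consider "z > 0" | "z < 0" | "z = 0" by linarith
    then show ?thesis
    proof cases
      case 1
      have "((\<lambda>z::real. z\<^sup>2) has_real_derivative 2 * max 0 z) (at z)"
        using 1 by (auto intro!: derivative_eq_intros)
      then show ?thesis
        by (rule has_field_derivative_transform_within_open[where S="{0<..}"]) (use 1 in auto)
    next
      case 2
      have "((\<lambda>z::real. 0) has_real_derivative 2 * max 0 z) (at z)" using 2 by auto
      then show ?thesis
        by (rule has_field_derivative_transform_within_open[where S="{..<0}"]) (use 2 in auto)
    next
      case 3
      have "((\<lambda>h::real. (max 0 h)\<^sup>2 / h) \<longlongrightarrow> 0) (at 0)"
      proof (rule tendsto_rabs_zero_cancel, rule tendsto_sandwich[of "\<lambda>_. 0" _ _ "\<lambda>h. \<bar>h\<bar>"])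
        show "\<forall>\<^sub>F h in at (0::real). \<bar>(max 0 h)\<^sup>2 / h\<bar> \<le> \<bar>h\<bar>"
          by (intro always_eventually) (auto simp: max_def power2_eq_square)
        show "((\<lambda>h::real. \<bar>h\<bar>) \<longlongrightarrow> 0) (at 0)" by (intro tendsto_rabs_zero tendsto_ident_at)
      qed auto
      then show ?thesis using 3 by (simp add: DERIV_def)
    qed
  qed
  from DERIV_chain2[OF this assms] show ?thesis .
qed

context C2_strip
begin

text \<open>Energy estimate with the weight \<open>\<psi> = (max 0 (r0 - A(t) - \<phi>))\<^sup>2\<close>, where \<open>\<phi>\<close> is a smoothed distance to \<open>x0\<close>
  with \<open>|\<nabla>\<phi>| \<le> 1\<close>: it is supported in a backward light cone, so the term produced by the
  derivative of \<open>\<psi>\<close> has a favourable sign and no boundary integrals occur.\<close>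

lemma finite_speed:
  fixes c H b msq p R Q :: real and q :: "real \<Rightarrow> real"
  assumes c: "c > 0" and H: "H > 0" and b: "b \<ge> 0" and msq: "msq \<ge> 0" and p: "p > 1"
    and pde: "\<And>t x. 0 < t \<Longrightarrow> t \<le> \<tau> \<Longrightarrow>
      vtt t x - (c * exp (H * t))\<^sup>2 * (\<Sum>e\<in>Basis. vxx e t x) + b * vt t x + msq * v t x = q t * \<bar>v t x\<bar> powr p"
    and q: "\<And>t. 0 < t \<Longrightarrow> t \<le> \<tau> \<Longrightarrow> \<bar>q t\<bar> \<le> Q"
    and init: "\<And>x. norm x > R \<Longrightarrow> v 0 x = 0" "\<And>x. norm x > R \<Longrightarrow> vt 0 x = 0"
    and t2: "t2 \<in> {0..\<tau>}" and x0: "norm x0 > R + c / H * (exp (H * t2) - 1)"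
  shows "v t2 x0 = 0"
proof (cases "t2 = 0")
  case True then show ?thesis using init x0 by simp
next
  case False
  then have t2': "0 < t2" "t2 \<le> \<tau>" using t2 by auto
  define A where "A t = c / H * (exp (H * t) - 1)" for t
  define a where "a t = c * exp (H * t)" for t
  have dA: "(A has_real_derivative a t) (at t within X)" for t X
    unfolding A_def[abs_def] a_def using H by (auto intro!: derivative_eq_intros)
  have da: "(a has_real_derivative H * a t) (at t within X)" for t X
    unfolding a_def[abs_def] by (auto intro!: derivative_eq_intros)
  have a0: "a t > 0" for t using c by (simp add: a_def)
  have A0: "A t \<ge> 0" if "t \<ge> 0" for t using that c H by (simp add: A_def)
  \<comment> \<open>Half the excess of |x0| over the admissible radius. It is also the value of
    \<open>g\<close> at (t2, x0), so the weight is positive there, while at time 0 the weight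
    vanishes on the ball of radius R.\<close>
  define \<delta> where "\<delta> = (norm x0 - R - A t2) / 2"
  have \<delta>: "\<delta> > 0" using x0 by (simp add: \<delta>_def A_def)
  define r0 where "r0 = norm x0 - R"
  define \<phi> where "\<phi> x = sqrt ((x - x0) \<bullet> (x - x0) + \<delta>\<^sup>2)" for x
  have \<phi>pos: "\<phi> x > 0" for x using \<delta> by (simp add: \<phi>_def add_nonneg_pos)
  have \<phi>norm: "norm (x - x0) < \<phi> x" for x
    unfolding \<phi>_def norm_eq_sqrt_inner using \<delta> by simp
  define g where "g t x = r0 - A t - \<phi> x" for t x
  define \<psi> where "\<psi> t x = (max 0 (g t x))\<^sup>2" for t x
  define \<zeta> where "\<zeta> t x = 2 * max 0 (g t x)" for t x
  define \<phi>d where "\<phi>d e x = ((x - x0) \<bullet> e) / \<phi> x" for e x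
  define K where "K = norm x0 + r0"
  have outside: "g t x < 0" if "t \<ge> 0" "norm x > K" for t x
  proof -
    have "norm x - norm x0 \<le> norm (x - x0)" by (rule norm_triangle_ineq2)
    then show ?thesis using A0[OF that(1)] \<phi>norm[of x] that by (simp add: g_def K_def)
  qed
  have d\<phi>: "((\<lambda>h. \<phi> (x + h *\<^sub>R e)) has_real_derivative \<phi>d e x) (at 0)" for x e
  proof -
    have "((\<lambda>h. ((x + h *\<^sub>R e) - x0) \<bullet> ((x + h *\<^sub>R e) - x0) + \<delta>\<^sup>2) has_real_derivative 2 * ((x - x0) \<bullet> e)) (at 0)"
      by (auto intro!: derivative_eq_intros simp: has_field_derivative_def inner_commute fun_eq_iff algebra_simps)
    from DERIV_chain2[OF DERIV_real_sqrt this] show ?thesis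
      using \<phi>pos[of x] by (simp add: \<phi>_def[abs_def] \<phi>d_def field_simps)
  qed
  have \<phi>d_sum: "(\<Sum>e\<in>Basis. (\<phi>d e x)\<^sup>2) \<le> 1" for x
  proof -
    have "(\<Sum>e\<in>Basis. (\<phi>d e x)\<^sup>2) = ((x - x0) \<bullet> (x - x0)) / (\<phi> x)\<^sup>2"
      unfolding \<phi>d_def power_divide sum_divide_distrib[symmetric]
      by (simp add: power2_eq_square euclidean_inner[of "x - x0" "x - x0"])
    also have "\<dots> \<le> 1"
    proof -
      have "(\<phi> x)\<^sup>2 = (x - x0) \<bullet> (x - x0) + \<delta>\<^sup>2" by (simp add: \<phi>_def)
      moreover have "(\<phi> x)\<^sup>2 > 0" using \<phi>pos[of x] by simp
      ultimately show ?thesis by (subst pos_divide_le_eq) auto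
    qed
    finally show ?thesis .
  qed
  have c\<phi>: "continuous_on X \<phi>" for X unfolding \<phi>_def by (intro continuous_intros)
  have cg: "continuous_on ({0..\<tau>} \<times> UNIV) (\<lambda>(t, x). g t x)"
    unfolding g_def A_def case_prod_unfold
    by (intro continuous_intros continuous_on_compose2[OF c\<phi>[of UNIV]]) auto
  have c\<psi>: "continuous_on ({0..\<tau>} \<times> UNIV) (\<lambda>(t, x). \<psi> t x)"
    and c\<zeta>: "continuous_on ({0..\<tau>} \<times> UNIV) (\<lambda>(t, x). \<zeta> t x)"
    unfolding \<psi>_def \<zeta>_def using cg unfolding case_prod_unfold
    by (intro continuous_intros; simp)+
  have ca: "continuous_on ({0..\<tau>} \<times> UNIV) (\<lambda>(t, x::'a). a t)"
    unfolding a_def case_prod_unfold by (intro continuous_intros)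
  have c\<phi>d: "continuous_on ({0..\<tau>} \<times> UNIV) (\<lambda>(t, x). \<phi>d e x)" for e
    unfolding \<phi>d_def case_prod_unfold using \<phi>pos
    by (intro continuous_intros continuous_on_compose2[OF c\<phi>[of UNIV]]) (auto simp: less_imp_neq[symmetric])
  note conts = cv cvt cvtt cvx cvtx cvxx c\<psi> c\<zeta> ca c\<phi>d
  define en where "en t x = (vt t x)\<^sup>2 + (a t)\<^sup>2 * (\<Sum>e\<in>Basis. (vx e t x)\<^sup>2) + (v t x)\<^sup>2" for t x
  define f where "f t x = \<psi> t x * en t x" for t x
  define f' where "f' t x = - a t * \<zeta> t x * en t x + \<psi> t x * (2 * vt t x * vtt t x
     + 2 * H * (a t)\<^sup>2 * (\<Sum>e\<in>Basis. (vx e t x)\<^sup>2) + (a t)\<^sup>2 * (\<Sum>e\<in>Basis. 2 * vx e t x * vtx e t x)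
     + 2 * v t x * vt t x)" for t x
  \<comment> \<open>The derivative of \<open>\<psi> * vt * vx e\<close> in the direction e, so its
    integral is 0. Subtracting 2 a^2 times the sum of these functions turns the gradient terms of
    \<open>f'\<close> into the wave operator.\<close>
  define G where "G e t x = - \<zeta> t x * \<phi>d e x * vt t x * vx e t x + \<psi> t x * vtx e t x * vx e t x
     + \<psi> t x * vt t x * vxx e t x" for e t x
  have en0: "en t x \<ge> 0" for t x unfolding en_def by (intro add_nonneg_nonneg mult_nonneg_nonneg sum_nonneg) auto
  have \<psi>0: "\<psi> t x \<ge> 0" and \<zeta>0: "\<zeta> t x \<ge> 0" for t x by (auto simp: \<psi>_def \<zeta>_def)
  have cen: "continuous_on ({0..\<tau>} \<times> UNIV) (\<lambda>(t, x). en t x)"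
    unfolding en_def using conts unfolding case_prod_unfold by (intro continuous_intros) auto
  have cf: "continuous_on ({0..\<tau>} \<times> UNIV) (\<lambda>(t, x). f t x)"
    unfolding f_def using cen conts unfolding case_prod_unfold by (intro continuous_intros) auto
  have cf': "continuous_on ({0..\<tau>} \<times> UNIV) (\<lambda>(t, x). f' t x)"
    unfolding f'_def using cen conts unfolding case_prod_unfold by (intro continuous_intros) auto
  have cG: "continuous_on ({0..\<tau>} \<times> UNIV) (\<lambda>(t, x). G e t x)" if "e \<in> Basis" for e
    unfolding G_def using that conts unfolding case_prod_unfold by (intro continuous_intros) auto
  have out: "\<psi> t x = 0" "\<zeta> t x = 0" if "t \<in> {0..\<tau>}" "norm x > K" for t x
    using outside[of t x] that by (auto simp: \<psi>_def \<zeta>_def)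
  have d\<psi>: "((\<lambda>t. \<psi> t x) has_real_derivative - a t * \<zeta> t x) (at t within X)" for t x X
  proof -
    have "((\<lambda>t. g t x) has_real_derivative - a t) (at t within X)"
      unfolding g_def by (auto intro!: derivative_eq_intros dA)
    from max0_square_deriv[OF this] show ?thesis by (simp add: \<psi>_def \<zeta>_def mult_ac)
  qed
  have x\<psi>: "((\<lambda>h. \<psi> t (x + h *\<^sub>R e)) has_real_derivative - \<zeta> t x * \<phi>d e x) (at 0)" for t x e
  proof -
    have "((\<lambda>h. g t (x + h *\<^sub>R e)) has_real_derivative - \<phi>d e x) (at 0)"
      unfolding g_def by (auto intro!: derivative_eq_intros d\<phi>)
    from max0_square_deriv[OF this] show ?thesis by (simp add: \<psi>_def \<zeta>_def mult_ac)
  qed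
  have df: "((\<lambda>t. f t x) has_real_derivative f' t x) (at t within {0..\<tau>})" if t: "t \<in> {0..\<tau>}" for t x
  proof -
    have "((\<lambda>t. en t x) has_real_derivative 2 * vt t x * vtt t x
     + (2 * H * (a t)\<^sup>2 * (\<Sum>e\<in>Basis. (vx e t x)\<^sup>2) + (a t)\<^sup>2 * (\<Sum>e\<in>Basis. 2 * vx e t x * vtx e t x))
     + 2 * v t x * vt t x) (at t within {0..\<tau>})"
    proof -
      have "((\<lambda>t. \<Sum>e\<in>Basis. (vx e t x)\<^sup>2) has_real_derivative (\<Sum>e\<in>Basis. 2 * vx e t x * vtx e t x)) (at t within {0..\<tau>})"
        using t by (intro DERIV_sum) (auto intro!: derivative_eq_intros dvx)
      moreover have "((\<lambda>t. (a t)\<^sup>2) has_real_derivative 2 * H * (a t)\<^sup>2) (at t within {0..\<tau>})"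
        by (auto intro!: derivative_eq_intros da simp: power2_eq_square)
      ultimately have "((\<lambda>t. (a t)\<^sup>2 * (\<Sum>e\<in>Basis. (vx e t x)\<^sup>2)) has_real_derivative
        (2 * H * (a t)\<^sup>2 * (\<Sum>e\<in>Basis. (vx e t x)\<^sup>2) + (a t)\<^sup>2 * (\<Sum>e\<in>Basis. 2 * vx e t x * vtx e t x))) (at t within {0..\<tau>})"
        using DERIV_mult by (fastforce simp: mult.commute)
      moreover have "((\<lambda>t. (vt t x)\<^sup>2) has_real_derivative 2 * vt t x * vtt t x) (at t within {0..\<tau>})"
        "((\<lambda>t. (v t x)\<^sup>2) has_real_derivative 2 * v t x * vt t x) (at t within {0..\<tau>})"
        using t by (auto intro!: derivative_eq_intros dv dvt)
      ultimately show ?thesis unfolding en_def by (intro DERIV_add)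
    qed
    from DERIV_mult[OF d\<psi> this] show ?thesis unfolding f_def f'_def by (simp add: algebra_simps)
  qed
  have intG: "integral UNIV (G e t) = 0" if t: "0 < t" "t \<le> \<tau>" and e: "e \<in> Basis" for t e
  proof (rule integral_directional_derivative)
    show "((\<lambda>h. \<psi> t (x + h *\<^sub>R e) * vt t (x + h *\<^sub>R e) * vx e t (x + h *\<^sub>R e)) has_real_derivative G e t x) (at 0)" for x
      using DERIV_mult[OF DERIV_mult[OF x\<psi>[of t x e] xvt[OF t e, of x]] xvx[of t e x]] t e
      unfolding G_def by (simp add: algebra_simps)
    show "continuous_on UNIV (\<lambda>x. \<psi> t x * vt t x * vx e t x)"
      using t e by (intro continuous_intros continuous_on_slice[of "{0..\<tau>}"] conts) auto
    show "continuous_on UNIV (G e t)" using t e by (intro continuous_on_slice[of "{0..\<tau>}"] cG) auto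
  qed (use out[of t] t in \<open>auto simp: G_def\<close>)
  obtain V where V: "\<And>t x. t \<in> {0..\<tau>} \<Longrightarrow> norm x \<le> K \<Longrightarrow> \<bar>v t x\<bar> \<le> V"
  proof -
    have "bounded ((\<lambda>(t, x). v t x) ` ({0..\<tau>} \<times> cball 0 K))"
      by (intro compact_imp_bounded compact_continuous_image compact_Times continuous_on_subset[OF cv]) auto
    then obtain B where "\<forall>z\<in>(\<lambda>(t, x). v t x) ` ({0..\<tau>} \<times> cball 0 K). \<bar>z\<bar> \<le> B" unfolding bounded_real by blast
    then have "\<bar>v t x\<bar> \<le> B" if "t \<in> {0..\<tau>}" "norm x \<le> K" for t x using that by force
    then show ?thesis by (rule that)
  qed
  have Q0: "Q \<ge> 0" using q[of \<tau>] \<tau> by linarith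
  \<comment> \<open>2H comes from differentiating a^2, 1 from the term v^2 of the energy, msq from
    the mass, and the last summand from |v|^p <= V^(p-1) |v| on the support of the weight. The
    damping term has a favourable sign.\<close>
  define C where "C = 2 * H + 1 + msq + Q * V powr (p - 1)"
  have pointwise: "f' t x - (\<Sum>e\<in>Basis. 2 * (a t)\<^sup>2 * G e t x) \<le> C * f t x" if t: "0 < t" "t \<le> \<tau>" for t x
  proof -
    define S2 where "S2 = (\<Sum>e\<in>Basis. (vx e t x)\<^sup>2)"
    define X where "X = (\<Sum>e\<in>Basis. \<phi>d e x * vx e t x)"
    have S20: "S2 \<ge> 0" unfolding S2_def by (intro sum_nonneg) auto
    have eq: "f' t x - (\<Sum>e\<in>Basis. 2 * (a t)\<^sup>2 * G e t x)
      = - a t * \<zeta> t x * (en t x - 2 * (a t * X) * vt t x)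
        + \<psi> t x * (2 * vt t x * (vtt t x - (a t)\<^sup>2 * (\<Sum>e\<in>Basis. vxx e t x)) + 2 * H * (a t)\<^sup>2 * S2 + 2 * v t x * vt t x)"
    proof -
      have "(\<Sum>e\<in>Basis. 2 * (a t)\<^sup>2 * G e t x) = 2 * (a t)\<^sup>2 * (- \<zeta> t x * vt t x * X
         + \<psi> t x * (\<Sum>e\<in>Basis. vx e t x * vtx e t x) + \<psi> t x * vt t x * (\<Sum>e\<in>Basis. vxx e t x))"
        unfolding G_def X_def sum_distrib_left sum.distrib[symmetric]
        by (intro sum.cong) (auto simp: algebra_simps)
      moreover have "(\<Sum>e\<in>Basis. 2 * vx e t x * vtx e t x) = 2 * (\<Sum>e\<in>Basis. vx e t x * vtx e t x)"
        by (simp add: sum_distrib_left mult.assoc)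
      ultimately show ?thesis unfolding f'_def S2_def[symmetric]
        by (simp add: algebra_simps power2_eq_square)
    qed
    \<comment> \<open>The cone shrinks at the speed a = A' and |grad \<phi>| <= 1, so the loss
      through the moving edge dominates the flux through it.\<close>
    have "2 * (a t * X) * vt t x \<le> en t x"
    proof -
      have "X\<^sup>2 \<le> (\<Sum>e\<in>Basis. (\<phi>d e x)\<^sup>2) * S2" unfolding X_def S2_def by (rule Cauchy_Schwarz_ineq_sum)
      also have "\<dots> \<le> 1 * S2" using \<phi>d_sum S20 by (intro mult_right_mono)
      finally have "(a t)\<^sup>2 * X\<^sup>2 \<le> (a t)\<^sup>2 * S2" by (intro mult_left_mono) auto
      moreover have "2 * (a t * X) * vt t x \<le> (a t * X)\<^sup>2 + (vt t x)\<^sup>2"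
        using sum_squares_bound[of "a t * X" "vt t x"] by simp
      ultimately show ?thesis unfolding en_def S2_def[symmetric] power_mult_distrib
        using zero_le_power2[of "v t x"] by linarith
    qed
    then have neg: "- a t * \<zeta> t x * (en t x - 2 * (a t * X) * vt t x) \<le> 0"
      using a0[of t] \<zeta>0[of t x] by (simp add: mult_nonneg_nonneg)
    have main: "\<psi> t x * (2 * vt t x * (vtt t x - (a t)\<^sup>2 * (\<Sum>e\<in>Basis. vxx e t x)) + 2 * H * (a t)\<^sup>2 * S2 + 2 * v t x * vt t x)
       \<le> \<psi> t x * (C * en t x)"
    proof (cases "norm x \<le> K")
      case True
      let ?v = "v t x" and ?w = "vt t x"
      have e0: "vtt t x - (a t)\<^sup>2 * (\<Sum>e\<in>Basis. vxx e t x) = q t * \<bar>?v\<bar> powr p - b * ?w - msq * ?v"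
        using pde[OF t, of x] by (simp add: a_def)
      have e1: "2 * ?w * (vtt t x - (a t)\<^sup>2 * (\<Sum>e\<in>Basis. vxx e t x))
        = 2 * ?w * (q t * \<bar>?v\<bar> powr p) - 2 * b * ?w\<^sup>2 - msq * (2 * ?v * ?w)"
        unfolding e0 by (simp add: algebra_simps power2_eq_square)
      have sq: "2 * \<bar>?v\<bar> * \<bar>?w\<bar> \<le> ?v\<^sup>2 + ?w\<^sup>2" using sum_squares_bound[of "\<bar>?v\<bar>" "\<bar>?w\<bar>"] by simp
      have absvw: "\<bar>2 * ?v * ?w\<bar> \<le> ?v\<^sup>2 + ?w\<^sup>2" using sq by (simp add: abs_mult)
      have e2: "2 * ?w * (q t * \<bar>?v\<bar> powr p) \<le> Q * V powr (p - 1) * (?v\<^sup>2 + ?w\<^sup>2)"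
      proof -
        have "\<bar>?v\<bar> powr p = \<bar>?v\<bar> powr (p - 1) * \<bar>?v\<bar>"
          using p by (cases "?v = 0") (auto simp: powr_diff)
        also have "\<dots> \<le> V powr (p - 1) * \<bar>?v\<bar>"
          using V[of t x] t True p by (intro mult_right_mono powr_mono2) auto
        finally have "\<bar>q t\<bar> * \<bar>?v\<bar> powr p \<le> Q * (V powr (p - 1) * \<bar>?v\<bar>)"
          using q[OF t] Q0 by (intro mult_mono) auto
        then have "2 * \<bar>?w\<bar> * (\<bar>q t\<bar> * \<bar>?v\<bar> powr p) \<le> 2 * \<bar>?w\<bar> * (Q * (V powr (p - 1) * \<bar>?v\<bar>))"
          by (intro mult_left_mono) auto
        also have "\<dots> = Q * V powr (p - 1) * (2 * \<bar>?v\<bar> * \<bar>?w\<bar>)" by (simp add: mult_ac)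
        also have "\<dots> \<le> Q * V powr (p - 1) * (?v\<^sup>2 + ?w\<^sup>2)" using sq Q0 by (intro mult_left_mono) auto
        finally have "2 * \<bar>?w\<bar> * (\<bar>q t\<bar> * \<bar>?v\<bar> powr p) \<le> Q * V powr (p - 1) * (?v\<^sup>2 + ?w\<^sup>2)" .
        moreover have "2 * ?w * (q t * \<bar>?v\<bar> powr p) \<le> \<bar>2 * ?w * (q t * \<bar>?v\<bar> powr p)\<bar>" by (rule abs_ge_self)
        ultimately show ?thesis by (simp add: abs_mult)
      qed
      have e3: "- (msq * (2 * ?v * ?w)) \<le> msq * (?v\<^sup>2 + ?w\<^sup>2)"
        using mult_left_mono[OF absvw msq] mult_left_mono[OF abs_ge_minus_self[of "2 * ?v * ?w"] msq] by simp
      have e4: "2 * ?v * ?w \<le> ?v\<^sup>2 + ?w\<^sup>2" using absvw by linarith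
      have e5: "2 * H * (a t)\<^sup>2 * S2 \<le> 2 * H * en t x"
        unfolding en_def S2_def[symmetric] mult.assoc using H by simp
      have e6: "(1 + msq + Q * V powr (p - 1)) * (?v\<^sup>2 + ?w\<^sup>2) \<le> (1 + msq + Q * V powr (p - 1)) * en t x"
        unfolding en_def S2_def[symmetric] using msq Q0 S20 by (intro mult_left_mono) auto
      have "2 * ?w * (vtt t x - (a t)\<^sup>2 * (\<Sum>e\<in>Basis. vxx e t x)) + 2 * H * (a t)\<^sup>2 * S2 + 2 * ?v * ?w
        \<le> (1 + msq + Q * V powr (p - 1)) * (?v\<^sup>2 + ?w\<^sup>2) + 2 * H * en t x"
      proof -
        have "2 * b * ?w\<^sup>2 \<ge> 0" using b by simp
        have arith: "r1 - r2 - r3 + r4 + r5 \<le> 1 * D + s2 + s3 + r6"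
          if "0 \<le> r2" "r1 \<le> s3" "- r3 \<le> s2" "r5 \<le> D" "r4 \<le> r6" for r1 r2 r3 r4 r5 r6 s2 s3 D :: real
          using that by linarith
        show ?thesis unfolding e1 distrib_right[of "1 + msq"] distrib_right[of 1]
          by (rule arith) fact+
      qed
      also have "\<dots> \<le> C * en t x" using e6 unfolding C_def by (simp add: algebra_simps)
      finally show ?thesis using \<psi>0 by (intro mult_left_mono)
    qed (use out[of t x] t in auto)
    have "\<psi> t x * (C * en t x) = C * f t x" by (simp add: f_def mult_ac)
    then show ?thesis using neg main unfolding eq by linarith
  qed
  define E where "E t = integral UNIV (f t)" for t
  define E' where "E' t = integral UNIV (f' t)" for t
  have fout: "f t x = 0" "f' t x = 0" "G e t x = 0" if "t \<in> {0..\<tau>}" "norm x > K" for t x e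
    using out[OF that] by (auto simp: f_def f'_def G_def)
  have dE: "(E has_real_derivative E' t) (at t within {0..\<tau>})" if "t \<in> {0..\<tau>}" for t
    unfolding E_def[abs_def] E'_def using that
    by (intro integral_UNIV_has_derivative[where K=K]) (auto intro!: df cf' fout continuous_on_slice[OF cf])
  have E'le: "E' t \<le> C * E t" if t: "0 < t" "t \<le> \<tau>" for t
  proof -
    have t': "t \<in> {0..\<tau>}" using t by auto
    have i1: "f' t integrable_on UNIV" "f t integrable_on UNIV"
      using fout[OF t'] continuous_on_slice[OF cf t'] continuous_on_slice[OF cf' t'] by (auto intro!: integrable_UNIV_box[of K])
    have iG: "G e t integrable_on UNIV" if "e \<in> Basis" for e
      using fout[OF t'] continuous_on_slice[OF cG t'] that by (auto intro!: integrable_UNIV_box[of K])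
    have iS: "(\<lambda>x. \<Sum>e\<in>Basis. 2 * (a t)\<^sup>2 * G e t x) integrable_on UNIV"
      using iG by (intro integrable_sum integrable_on_mult_right) auto
    have "integral UNIV (\<lambda>x. \<Sum>e\<in>Basis. 2 * (a t)\<^sup>2 * G e t x) = (\<Sum>e\<in>Basis. 2 * (a t)\<^sup>2 * integral UNIV (G e t))"
      using iG by (subst integral_sum) (auto intro!: integrable_on_mult_right)
    also have "\<dots> = 0" using intG[OF t] by simp
    finally have "E' t = integral UNIV (\<lambda>x. f' t x - (\<Sum>e\<in>Basis. 2 * (a t)\<^sup>2 * G e t x))"
      unfolding E'_def using i1 iS by (simp add: integral_diff)
    also have "\<dots> \<le> integral UNIV (\<lambda>x. C * f t x)"
      using pointwise[OF t] i1 iS by (intro integral_le integrable_diff) (auto intro: integrable_on_mult_right)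
    also have "\<dots> = C * E t" by (simp add: E_def)
    finally show ?thesis .
  qed
  \<comment> \<open>Outside radius R the data vanish on an open set and hence so does the gradient;
    inside it the weight vanishes.\<close>
  have E0: "E 0 = 0"
  proof -
    have "f 0 x = 0" for x
    proof (cases "norm x > R")
      case True
      have op: "open {y. norm y > R}" by (intro open_Collect_less continuous_intros)
      have "vx e 0 x = 0" if e: "e \<in> Basis" for e
      proof -
        have "((\<lambda>h. v 0 (x + h *\<^sub>R e)) has_real_derivative vx e 0 x) (at 0)" using xv[of 0 e x] e \<tau> by auto
        moreover have "((\<lambda>h. v 0 (x + h *\<^sub>R e)) has_real_derivative 0) (at 0)"
        proof (rule has_field_derivative_transform_within_open[where f="\<lambda>h. 0" and S="(\<lambda>h. x + h *\<^sub>R e) -` {y. norm y > R}"])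
          show "open ((\<lambda>h::real. x + h *\<^sub>R e) -` {y. norm y > R})"
            by (intro open_vimage op continuous_intros)
        qed (use True init in auto)
        ultimately show ?thesis by (rule DERIV_unique)
      qed
      then show ?thesis using True init by (simp add: f_def en_def)
    next
      case False
      have "norm x0 - norm x \<le> norm (x - x0)" by (simp add: norm_triangle_ineq2 norm_minus_commute)
      then have "g 0 x < 0" using False \<phi>norm[of x] by (simp add: g_def r0_def A_def)
      then show ?thesis by (simp add: f_def \<psi>_def)
    qed
    then have "f 0 = (\<lambda>x. 0)" by (rule ext)
    then show ?thesis by (simp add: E_def)
  qed
  have "E t2 * exp (- C * t2) \<le> E 0 * exp (- C * 0)"
  proof (rule DERIV_nonpos_imp_decreasing_open[of 0 t2])
    fix t assume t: "0 < t" "t < t2"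
    have "(E has_real_derivative E' t) (at t)"
      using dE[of t] t t2' by (simp add: at_within_Icc_at)
    then have "((\<lambda>t. E t * exp (- C * t)) has_real_derivative (E' t - C * E t) * exp (- C * t)) (at t)"
      by (auto intro!: derivative_eq_intros simp: algebra_simps)
    moreover have "(E' t - C * E t) * exp (- C * t) \<le> 0"
      using E'le[of t] t t2' by (intro mult_nonpos_nonneg) auto
    ultimately show "\<exists>y. ((\<lambda>t. E t * exp (- C * t)) has_real_derivative y) (at t) \<and> y \<le> 0" by blast
  next
    have "continuous_on {0..\<tau>} E" using dE by (meson DERIV_continuous_on)
    then show "continuous_on {0..t2} (\<lambda>t. E t * exp (- C * t))"
      using t2' by (intro continuous_intros) (auto intro: continuous_on_subset)
  qed (use t2' in auto)
  then have "E t2 \<le> 0" using E0 by (simp add: mult_le_0_iff)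
  moreover have f0: "f t x \<ge> 0" for t x using \<psi>0 en0 by (simp add: f_def)
  ultimately have Ez: "E t2 = 0" unfolding E_def by (intro antisym integral_nonneg integrable_UNIV_box[of K] fout continuous_on_slice[OF cf t2] t2) auto
  have "f t2 x0 = 0"
    by (rule integral_UNIV_zero_imp_zero[OF continuous_on_slice[OF cf t2] f0 fout(1)[OF t2] Ez[unfolded E_def]])
  moreover have "\<psi> t2 x0 > 0"
  proof -
    have "\<phi> x0 = \<delta>" unfolding \<phi>_def using \<delta> by simp
    then have "g t2 x0 = \<delta>" unfolding g_def r0_def \<delta>_def by (simp add: field_simps)
    then show ?thesis using \<delta> by (simp add: \<psi>_def)
  qed
  ultimately have "en t2 x0 = 0" by (simp add: f_def)
  moreover have "en t2 x0 \<ge> (v t2 x0)\<^sup>2" unfolding en_def by (simp add: sum_nonneg)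
  ultimately show ?thesis by simp
qed

end

section \<open>Moments of the solution\<close>

text \<open>The radial solution of \<open>\<Delta>\<Phi> = l\<^sup>2 \<Phi>\<close> normalised by \<open>\<Phi>(0) = 1\<close>.\<close>

definition Phi :: "real \<Rightarrow> 'a::euclidean_space \<Rightarrow> real" where
  "Phi l x = gser DIM('a) (l\<^sup>2 * (x \<bullet> x))"

definition Phi1 :: "real \<Rightarrow> 'a \<Rightarrow> 'a::euclidean_space \<Rightarrow> real" where
  "Phi1 l e x = 2 * l\<^sup>2 * (x \<bullet> e) * gser1 DIM('a) (l\<^sup>2 * (x \<bullet> x))"

definition Phi2 :: "real \<Rightarrow> 'a \<Rightarrow> 'a::euclidean_space \<Rightarrow> real" where
  "Phi2 l e x = 2 * l\<^sup>2 * gser1 DIM('a) (l\<^sup>2 * (x \<bullet> x)) + 4 * l ^ 4 * (x \<bullet> e)\<^sup>2 * gser2 DIM('a) (l\<^sup>2 * (x \<bullet> x))"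

lemma Phi_ge_1: "Phi l x \<ge> 1"
  unfolding Phi_def by (rule gser_ge_1) auto

lemma Phi_0: "Phi 0 x = 1"
  unfolding Phi_def by (simp add: gser_0)

lemma Phi_deriv:
  assumes "e \<in> Basis"
  shows "((\<lambda>h. Phi l (x + h *\<^sub>R e)) has_real_derivative Phi1 l e x) (at 0)"
    and "((\<lambda>h. Phi1 l e (x + h *\<^sub>R e)) has_real_derivative Phi2 l e x) (at 0)"
proof -
  have d: "((\<lambda>h. l\<^sup>2 * ((x + h *\<^sub>R e) \<bullet> (x + h *\<^sub>R e))) has_real_derivative 2 * l\<^sup>2 * (x \<bullet> e)) (at 0)"
    by (auto intro!: derivative_eq_intros simp: has_field_derivative_def inner_commute fun_eq_iff algebra_simps)
  have g: "((\<lambda>h. gser DIM('a) (l\<^sup>2 * ((x + h *\<^sub>R e) \<bullet> (x + h *\<^sub>R e)))) has_real_derivative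
      gser1 DIM('a) (l\<^sup>2 * (x \<bullet> x)) * (2 * l\<^sup>2 * (x \<bullet> e))) (at 0)"
    by (rule DERIV_chain2[OF _ d]) (use gser_deriv[of "DIM('a)" "l\<^sup>2 * (x \<bullet> x)"] in auto)
  then show "((\<lambda>h. Phi l (x + h *\<^sub>R e)) has_real_derivative Phi1 l e x) (at 0)"
    by (simp add: Phi_def Phi1_def mult_ac)
  have g1: "((\<lambda>h. gser1 DIM('a) (l\<^sup>2 * ((x + h *\<^sub>R e) \<bullet> (x + h *\<^sub>R e)))) has_real_derivative
      gser2 DIM('a) (l\<^sup>2 * (x \<bullet> x)) * (2 * l\<^sup>2 * (x \<bullet> e))) (at 0)"
    by (rule DERIV_chain2[OF _ d]) (use gser1_deriv[of "DIM('a)" "l\<^sup>2 * (x \<bullet> x)"] in auto)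
  have i: "((\<lambda>h. 2 * l\<^sup>2 * ((x + h *\<^sub>R e) \<bullet> e)) has_real_derivative 2 * l\<^sup>2) (at 0)"
    using assms by (auto intro!: derivative_eq_intros simp: has_field_derivative_def fun_eq_iff algebra_simps inner_Basis)
  show "((\<lambda>h. Phi1 l e (x + h *\<^sub>R e)) has_real_derivative Phi2 l e x) (at 0)"
    using DERIV_mult[OF i g1] unfolding Phi1_def Phi2_def
    by (simp add: algebra_simps power2_eq_square power4_eq_xxxx)
qed

lemma Phi2_sum: "(\<Sum>e\<in>Basis. Phi2 l e x) = l\<^sup>2 * Phi l (x::'a::euclidean_space)"
proof -
  let ?y = "l\<^sup>2 * (x \<bullet> x)"
  have "(\<Sum>e\<in>Basis. Phi2 l e x) = 2 * l\<^sup>2 * real DIM('a) * gser1 DIM('a) ?y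
      + 4 * l ^ 4 * (\<Sum>e\<in>Basis. (x \<bullet> e)\<^sup>2) * gser2 DIM('a) ?y"
    unfolding Phi2_def sum.distrib sum_distrib_left sum_distrib_right by simp
  also have "(\<Sum>e\<in>Basis. (x \<bullet> e)\<^sup>2) = x \<bullet> x"
    by (simp add: power2_eq_square euclidean_inner[of x x])
  also have "2 * l\<^sup>2 * real DIM('a) * gser1 DIM('a) ?y + 4 * l ^ 4 * (x \<bullet> x) * gser2 DIM('a) ?y
      = l\<^sup>2 * (4 * ?y * gser2 DIM('a) ?y + 2 * real DIM('a) * gser1 DIM('a) ?y)"
    by (simp add: algebra_simps power2_eq_square power4_eq_xxxx)
  also have "\<dots> = l\<^sup>2 * Phi l x" unfolding Phi_def by (subst gser_ode) auto
  finally show ?thesis .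
qed

lemma continuous_on_gser:
  assumes "n \<ge> 1" "continuous_on X f"
  shows "continuous_on X (\<lambda>x. gser n (f x))" "continuous_on X (\<lambda>x. gser1 n (f x))"
    and "continuous_on X (\<lambda>x. gser2 n (f x))"
proof -
  have "continuous_on UNIV (gser n)" "continuous_on UNIV (gser1 n)"
    using gser_deriv[OF assms(1)] gser1_deriv[OF assms(1)] by (meson DERIV_continuous_on)+
  moreover have "isCont (gser2 n) y" for y
    unfolding gser2_def[abs_def]
    by (intro DERIV_isCont[OF termdiffs_strong_converges_everywhere] diffs_diffs_bcoef_summable assms)
  then have "continuous_on UNIV (gser2 n)" by (simp add: continuous_at_imp_continuous_on)
  ultimately show "continuous_on X (\<lambda>x. gser n (f x))" "continuous_on X (\<lambda>x. gser1 n (f x))"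
    "continuous_on X (\<lambda>x. gser2 n (f x))"
    using assms(2) by (auto intro: continuous_on_compose2)
qed

lemma continuous_on_Phi [continuous_intros]:
  fixes f :: "'b::topological_space \<Rightarrow> 'a::euclidean_space"
  assumes "continuous_on X f"
  shows "continuous_on X (\<lambda>x. Phi l (f x))" "continuous_on X (\<lambda>x. Phi1 l e (f x))"
    "continuous_on X (\<lambda>x. Phi2 l e (f x))"
  unfolding Phi_def Phi1_def Phi2_def using assms
  by (auto intro!: continuous_intros continuous_on_gser)

text \<open>For l = 0 this is the plain integral of f by \<open>Phi_0\<close>; positive l emphasise
  the layer near the edge of the support.\<close>

definition moment :: "real \<Rightarrow> ('a::euclidean_space \<Rightarrow> real) \<Rightarrow> real" where
  "moment l f = integral UNIV (\<lambda>x. f x * Phi l x)"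

lemma real_derivative_unique_Icc:
  assumes "(f has_real_derivative f') (at t within {a..b})" "(f has_real_derivative f'') (at t within {a..b})"
    "t \<in> {a..b}" "a < b"
  shows "f' = f''"
  using assms(1,2) unfolding has_real_derivative_iff_has_vector_derivative
  by (rule vector_derivative_unique_within[rotated]) (use assms(3,4) in \<open>auto simp: trivial_limit_within islimpt_Icc\<close>)

locale C2_strip_compact = C2_strip +
  fixes K :: real
  assumes supp: "\<And>t x. t \<in> {0..\<tau>} \<Longrightarrow> norm x > K \<Longrightarrow> v t x = 0"
begin

lemma supp_vt: "vt t x = 0" if "t \<in> {0..\<tau>}" "norm x > K" for t x
proof -
  have "((\<lambda>s. 0) has_real_derivative vt t x) (at t within {0..\<tau>})"
    by (rule has_field_derivative_transform_within[OF dv[OF that(1)] zero_less_one that(1)]) (use that supp in auto)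
  moreover have "((\<lambda>s. 0) has_real_derivative 0) (at t within {0..\<tau>})" by simp
  ultimately show ?thesis
    using that \<tau> by (intro real_derivative_unique_Icc)
qed

lemma supp_vtt: "vtt t x = 0" if "t \<in> {0..\<tau>}" "norm x > K" for t x
proof -
  have "((\<lambda>s. 0) has_real_derivative vtt t x) (at t within {0..\<tau>})"
    by (rule has_field_derivative_transform_within[OF dvt[OF that(1)] zero_less_one that(1)]) (use that supp_vt in auto)
  moreover have "((\<lambda>s. 0) has_real_derivative 0) (at t within {0..\<tau>})" by simp
  ultimately show ?thesis
    using that \<tau> by (intro real_derivative_unique_Icc)
qed

lemma supp_x:
  fixes f :: "'a \<Rightarrow> real"
  assumes f: "\<And>x. norm x > K \<Longrightarrow> f x = 0" and d: "((\<lambda>h. f (x + h *\<^sub>R e)) has_real_derivative f') (at 0)"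
    and x: "norm x > K"
  shows "f' = 0"
proof -
  have op: "open {y::'a. norm y > K}"
    by (intro open_Collect_less continuous_on_const continuous_on_norm_id)
  have "((\<lambda>h. f (x + h *\<^sub>R e)) has_real_derivative 0) (at 0)"
  proof (rule has_field_derivative_transform_within_open[where f="\<lambda>h. 0" and S="(\<lambda>h. x + h *\<^sub>R e) -` {y. norm y > K}"])
    show "open ((\<lambda>h::real. x + h *\<^sub>R e) -` {y. norm y > K})"
      by (intro open_vimage op continuous_intros)
  qed (use x f in auto)
  then show ?thesis using d DERIV_unique by blast
qed

lemma supp_vx: "vx e t x = 0" if "t \<in> {0..\<tau>}" "norm x > K" "e \<in> Basis" for t x e
  using supp_x[OF supp xv] that by auto

lemma supp_vxx: "vxx e t x = 0" if "t \<in> {0..\<tau>}" "norm x > K" "e \<in> Basis" for t x e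
  using supp_x[OF supp_vx xvx] that by auto

text \<open>Green's identity without boundary terms: in each direction e the difference of the two
  integrands is the derivative of \<open>vx e t x * Phi l x - v t x * Phi1 l e x\<close>, and
  \<open>Phi2_sum\<close> collects the second derivatives of \<Phi>.\<close>

lemma moment_laplacian:
  assumes t: "t \<in> {0..\<tau>}"
  shows "moment l (\<lambda>x. \<Sum>e\<in>Basis. vxx e t x) = l\<^sup>2 * moment l (v t)"
proof -
  have slice: "continuous_on UNIV (v t)" "\<And>e. e \<in> Basis \<Longrightarrow> continuous_on UNIV (vx e t)"
    "\<And>e. e \<in> Basis \<Longrightarrow> continuous_on UNIV (vxx e t)"
    using continuous_on_slice[OF cv t] continuous_on_slice[OF cvx t] continuous_on_slice[OF cvxx t] by auto
  have i1: "(\<lambda>x. vxx e t x * Phi l x) integrable_on UNIV" "(\<lambda>x. v t x * Phi2 l e x) integrable_on UNIV" if "e \<in> Basis" for e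
    using that supp[OF t] supp_vxx[OF t] slice
    by (auto intro!: integrable_UNIV_box[of K] continuous_intros)
  have IBP: "integral UNIV (\<lambda>x. vxx e t x * Phi l x) = integral UNIV (\<lambda>x. v t x * Phi2 l e x)" if e: "e \<in> Basis" for e
  proof -
    have "integral UNIV (\<lambda>x. vxx e t x * Phi l x - v t x * Phi2 l e x) = 0"
    proof (rule integral_directional_derivative[where K=K])
      show "((\<lambda>h. vx e t (x + h *\<^sub>R e) * Phi l (x + h *\<^sub>R e) - v t (x + h *\<^sub>R e) * Phi1 l e (x + h *\<^sub>R e))
        has_real_derivative vxx e t x * Phi l x - v t x * Phi2 l e x) (at 0)" for x
        using DERIV_diff[OF DERIV_mult[OF xvx[OF t e, of x] Phi_deriv(1)[OF e, of l x]]
            DERIV_mult[OF xv[OF t e, of x] Phi_deriv(2)[OF e, of l x]]]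
        by (simp add: algebra_simps)
      show "continuous_on UNIV (\<lambda>x. vx e t x * Phi l x - v t x * Phi1 l e x)"
        "continuous_on UNIV (\<lambda>x. vxx e t x * Phi l x - v t x * Phi2 l e x)"
        using slice e by (auto intro!: continuous_intros)
    qed (use supp[OF t] supp_vx[OF t] supp_vxx[OF t] e in auto)
    then show ?thesis using i1[OF e] by (simp add: integral_diff)
  qed
  have "moment l (\<lambda>x. \<Sum>e\<in>Basis. vxx e t x) = (\<Sum>e\<in>Basis. integral UNIV (\<lambda>x. vxx e t x * Phi l x))"
    unfolding moment_def sum_distrib_right using i1 by (subst integral_sum) auto
  also have "\<dots> = (\<Sum>e\<in>Basis. integral UNIV (\<lambda>x. v t x * Phi2 l e x))" using IBP by simp
  also have "\<dots> = integral UNIV (\<lambda>x. \<Sum>e\<in>Basis. v t x * Phi2 l e x)"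
    using i1 by (subst integral_sum) auto
  also have "\<dots> = integral UNIV (\<lambda>x. l\<^sup>2 * (v t x * Phi l x))"
    unfolding sum_distrib_left[symmetric] Phi2_sum by (simp add: mult_ac)
  finally show ?thesis by (simp add: moment_def)
qed

lemma continuous_on_moment:
  "continuous_on {0..\<tau>} (\<lambda>t. moment l (v t))" "continuous_on {0..\<tau>} (\<lambda>t. moment l (vt t))"
proof -
  have "continuous_on ({0..\<tau>} \<times> UNIV) (\<lambda>(t, x). v t x * Phi l x)"
    "continuous_on ({0..\<tau>} \<times> UNIV) (\<lambda>(t, x). vt t x * Phi l x)"
    using cv cvt unfolding case_prod_unfold by (auto intro!: continuous_intros)
  then show "continuous_on {0..\<tau>} (\<lambda>t. moment l (v t))" "continuous_on {0..\<tau>} (\<lambda>t. moment l (vt t))"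
    unfolding moment_def using supp supp_vt by (auto intro!: continuous_on_integral_UNIV[where K=K])
qed

lemma moment_deriv:
  assumes t: "0 < t" "t < \<tau>"
  shows "((\<lambda>t. moment l (v t)) has_real_derivative moment l (vt t)) (at t)"
    and "((\<lambda>t. moment l (vt t)) has_real_derivative moment l (vtt t)) (at t)"
proof -
  have c: "continuous_on ({0..\<tau>} \<times> UNIV) (\<lambda>(t, x). v t x * Phi l x)"
    "continuous_on ({0..\<tau>} \<times> UNIV) (\<lambda>(t, x). vt t x * Phi l x)"
    "continuous_on ({0..\<tau>} \<times> UNIV) (\<lambda>(t, x). vtt t x * Phi l x)"
    using cv cvt cvtt unfolding case_prod_unfold by (auto intro!: continuous_intros)
  have "((\<lambda>t. moment l (v t)) has_real_derivative moment l (vt t)) (at t within {0..\<tau>})"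
    unfolding moment_def
    by (rule integral_UNIV_has_derivative[where K=K])
      (use c t supp supp_vt in \<open>auto intro!: continuous_on_slice[OF c(1)] DERIV_cmult_right dv\<close>)
  moreover have "((\<lambda>t. moment l (vt t)) has_real_derivative moment l (vtt t)) (at t within {0..\<tau>})"
    unfolding moment_def
    by (rule integral_UNIV_has_derivative[where K=K])
      (use c t supp_vtt supp_vt in \<open>auto intro!: continuous_on_slice[OF c(2)] DERIV_cmult_right dvt\<close>)
  ultimately show "((\<lambda>t. moment l (v t)) has_real_derivative moment l (vt t)) (at t)"
    "((\<lambda>t. moment l (vt t)) has_real_derivative moment l (vtt t)) (at t)"
    using t by (simp_all add: at_within_Icc_at)
qed

end

text \<open>The time weight and the nonlocal factor are merged into one function \<open>q\<close> of
  time. Its sign alone drives the lower bounds for the moments, so the nonlocality can be forgotten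
  until \<open>source\<close> is evaluated.\<close>

locale C2_wave = C2_strip_compact +
  fixes c H b msq p :: real and q :: "real \<Rightarrow> real"
  assumes c: "c > 0" and H: "H > 0" and b: "b \<ge> 0" and msq: "msq \<ge> 0" "b\<^sup>2 \<ge> 4 * msq" and p: "p > 1"
    and pde: "\<And>t x. 0 < t \<Longrightarrow> t \<le> \<tau> \<Longrightarrow>
      vtt t x - (c * exp (H * t))\<^sup>2 * (\<Sum>e\<in>Basis. vxx e t x) + b * vt t x + msq * v t x = q t * \<bar>v t x\<bar> powr p"
    and q0: "\<And>t. 0 < t \<Longrightarrow> t \<le> \<tau> \<Longrightarrow> q t \<ge> 0"
begin

text \<open>The factor e^(bt/2) removes the damping: the equation of the moment gets the potential
  (c l e^(Ht))^2 + b^2/4 - m^2, nonnegative because b^2 >= 4 m^2.\<close>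

definition W where "W l t = exp (b * t / 2) * moment l (v t)"
definition W1 where "W1 l t = exp (b * t / 2) * (moment l (vt t) + b / 2 * moment l (v t))"
definition W2 where "W2 l t = exp (b * t / 2) * (moment l (vtt t) + b * moment l (vt t) + b\<^sup>2 / 4 * moment l (v t))"

lemma continuous_on_W: "continuous_on {0..\<tau>} (W l)" "continuous_on {0..\<tau>} (W1 l)"
  unfolding W_def W1_def by (auto intro!: continuous_intros continuous_on_moment)

lemma W_deriv:
  assumes t: "0 < t" "t < \<tau>"
  shows "(W l has_real_derivative W1 l t) (at t)" "(W1 l has_real_derivative W2 l t) (at t)"
  unfolding W_def[abs_def] W1_def[abs_def] W2_def
  by (auto intro!: derivative_eq_intros moment_deriv[OF t] simp: field_simps power2_eq_square)

definition source where "source t = q t * (LINT x|lborel. \<bar>v t x\<bar> powr p)"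

lemma W2_eq:
  assumes t: "0 < t" "t \<le> \<tau>"
  shows "W2 l t = ((c * l * exp (H * t))\<^sup>2 + (b\<^sup>2 / 4 - msq)) * W l t
    + exp (b * t / 2) * (q t * moment l (\<lambda>x. \<bar>v t x\<bar> powr p))"
proof -
  have t': "t \<in> {0..\<tau>}" using t by auto
  have slice: "continuous_on UNIV (v t)" "continuous_on UNIV (vt t)"
    "\<And>e. e \<in> Basis \<Longrightarrow> continuous_on UNIV (vxx e t)"
    using continuous_on_slice[OF cv t'] continuous_on_slice[OF cvt t'] continuous_on_slice[OF cvxx t'] by auto
  have cp: "continuous_on UNIV (\<lambda>x. \<bar>v t x\<bar> powr p)"
    using slice p by (intro continuous_on_powr' continuous_intros) auto
  have int: "(\<lambda>x. (\<Sum>e\<in>Basis. vxx e t x) * Phi l x) integrable_on UNIV" "(\<lambda>x. v t x * Phi l x) integrable_on UNIV"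
    "(\<lambda>x. vt t x * Phi l x) integrable_on UNIV" "(\<lambda>x. \<bar>v t x\<bar> powr p * Phi l x) integrable_on UNIV"
    using supp[OF t'] supp_vt[OF t'] supp_vxx[OF t'] slice cp
    by (auto intro!: integrable_UNIV_box[of K] continuous_intros)
  have eq: "vtt t x = (c * exp (H * t))\<^sup>2 * (\<Sum>e\<in>Basis. vxx e t x) - b * vt t x - msq * v t x + q t * \<bar>v t x\<bar> powr p" for x
    using pde[OF t, of x] by simp
  have "moment l (vtt t) = integral UNIV (\<lambda>x. (c * exp (H * t))\<^sup>2 * ((\<Sum>e\<in>Basis. vxx e t x) * Phi l x)
     - b * (vt t x * Phi l x) - msq * (v t x * Phi l x) + q t * (\<bar>v t x\<bar> powr p * Phi l x))"
    unfolding moment_def by (rule arg_cong[where f="integral UNIV"], rule ext, subst eq) (simp only: algebra_simps)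
  also have "\<dots> = (c * exp (H * t))\<^sup>2 * moment l (\<lambda>x. \<Sum>e\<in>Basis. vxx e t x) - b * moment l (vt t)
      - msq * moment l (v t) + q t * moment l (\<lambda>x. \<bar>v t x\<bar> powr p)"
    unfolding moment_def using int
    by (simp add: integral_add integral_diff integrable_on_mult_right integrable_diff)
  finally have main: "moment l (vtt t) = \<dots>" .
  show ?thesis unfolding W2_def W_def main moment_laplacian[OF t']
    by (simp add: algebra_simps power_mult_distrib)
qed

text \<open>\<Phi> >= 1, hence one lower bound serves all l at once.\<close>

lemma moment_source:
  assumes t: "0 < t" "t \<le> \<tau>"
  shows "q t * moment l (\<lambda>x. \<bar>v t x\<bar> powr p) \<ge> source t" "source t \<ge> 0"
proof -
  have t': "t \<in> {0..\<tau>}" using t by auto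
  have cp: "continuous_on UNIV (\<lambda>x. \<bar>v t x\<bar> powr p)"
    using continuous_on_slice[OF cv t'] p by (intro continuous_on_powr' continuous_intros) auto
  have "(LINT x|lborel. \<bar>v t x\<bar> powr p) = integral UNIV (\<lambda>x. \<bar>v t x\<bar> powr p)"
    using supp[OF t'] cp p by (intro integral_UNIV_eq_lebesgue[symmetric, of K]) auto
  also have "\<dots> \<le> moment l (\<lambda>x. \<bar>v t x\<bar> powr p)"
    unfolding moment_def
  proof (rule integral_le)
    show "(\<lambda>x. \<bar>v t x\<bar> powr p) integrable_on UNIV"
      "(\<lambda>x. \<bar>v t x\<bar> powr p * Phi l x) integrable_on UNIV"
      using supp[OF t'] by (auto intro!: integrable_UNIV_box[of K] cp continuous_on_mult[OF cp] continuous_on_Phi continuous_on_id)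
  qed (use Phi_ge_1 in \<open>auto simp: mult_le_cancel_left1\<close>)
  finally show "q t * moment l (\<lambda>x. \<bar>v t x\<bar> powr p) \<ge> source t"
    unfolding source_def using q0[OF t] by (intro mult_left_mono)
  show "source t \<ge> 0" unfolding source_def using q0[OF t]
    by (intro mult_nonneg_nonneg Bochner_Integration.integral_nonneg) auto
qed

context
  fixes l :: real
  assumes init: "moment l (v 0) \<ge> 0" "moment l (vt 0) \<ge> 0"
begin

lemma W_init: "W l 0 \<ge> 0" "W1 l 0 \<ge> 0"
  using init b by (auto simp: W_def W1_def)

lemma W_nonneg: assumes "t \<in> {0..\<tau>}" shows "W l t \<ge> 0" "W1 l t \<ge> 0"
proof -
  let ?k = "\<lambda>t. (c * l * exp (H * t))\<^sup>2 + (b\<^sup>2 / 4 - msq)"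
  note cmp = second_order_comparison[OF continuous_on_W W_deriv, where k="?k" and K="?k \<tau>"]
  have 1: "?k t * W l t \<le> W2 l t" if "0 < t" "t < \<tau>" for t
    using W2_eq[of t l] moment_source(1)[of t l] moment_source(2)[of t] that by simp
  have 2: "0 \<le> ?k t \<and> ?k t \<le> ?k \<tau>" if "0 < t" "t < \<tau>" for t
  proof -
    have "(exp (H * t))\<^sup>2 \<le> (exp (H * \<tau>))\<^sup>2" using that H by (intro power_mono) auto
    then have "(c * l * exp (H * t))\<^sup>2 \<le> (c * l * exp (H * \<tau>))\<^sup>2"
      unfolding power_mult_distrib by (intro mult_left_mono) auto
    moreover have "0 \<le> (c * l * exp (H * t))\<^sup>2" by simp
    ultimately show ?thesis using msq by linarith
  qed
  show "W l t \<ge> 0" "W1 l t \<ge> 0"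
    using assms by (auto intro: cmp[OF _ _ _ _ 1 2 W_init])
qed

lemma W2_ge:
  assumes t: "0 < t" "t \<le> \<tau>"
  shows "W2 l t \<ge> (c * l * exp (H * t))\<^sup>2 * W l t + exp (b * t / 2) * source t"
proof -
  have "(b\<^sup>2 / 4 - msq) * W l t \<ge> 0" using W_nonneg[of t] t msq by auto
  moreover have "exp (b * t / 2) * source t \<le> exp (b * t / 2) * (q t * moment l (\<lambda>x. \<bar>v t x\<bar> powr p))"
    using moment_source(1)[OF t, of l] by simp
  ultimately show ?thesis unfolding W2_eq[OF t] distrib_right by linarith
qed

lemma W2_ge_source:
  assumes t: "0 < t" "t \<le> \<tau>"
  shows "W2 l t \<ge> exp (b * t / 2) * source t"
proof -
  have "(c * l * exp (H * t))\<^sup>2 * W l t \<ge> 0" using W_nonneg[of t] t by auto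
  then show ?thesis using W2_ge[OF t] by linarith
qed

text \<open>Convexity together with a nonnegative initial slope. With l = 0 this keeps the solution
  from vanishing identically.\<close>

lemma W_mono:
  assumes "t \<in> {0..\<tau>}" shows "W l t \<ge> W l 0"
proof -
  have "W l t \<ge> W l 0 + W1 l 0 * (t - 0) + 0 * (t - 0)\<^sup>2 / 2"
  proof (rule second_derivative_lower_bound(2)[where u=\<tau> and f''="W2 l"])
    fix t assume "0 < t" "t < \<tau>"
    then show "0 \<le> W2 l t" using W2_ge_source[of t] moment_source(2)[of t] by (meson exp_ge_zero less_imp_le mult_nonneg_nonneg order.trans)
  qed (use assms W_deriv continuous_on_W in auto)
  moreover have "W1 l 0 * t \<ge> 0" using W_init assms by auto
  ultimately show ?thesis by simp
qed

end

end

section \<open>Regularity and support of classical solutions\<close>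

lemma slice_derivative:
  fixes G :: "real \<times> 'a::real_normed_vector \<Rightarrow> real"
  assumes d: "(G has_derivative D) (at (t, x) within I \<times> UNIV)" and t: "t \<in> I"
  shows "((\<lambda>s. G (s, x)) has_real_derivative D (1, 0)) (at t within I)"
    and "((\<lambda>h. G (t, x + h *\<^sub>R e)) has_real_derivative D (0, e)) (at 0 within X)"
proof -
  have lin: "linear D" using d by (rule has_derivative_linear)
  have "((\<lambda>s. G (s, x)) has_derivative (\<lambda>s. D (s, 0))) (at t within I)"
  proof (rule has_derivative_in_compose[where f="\<lambda>s. (s, x)"])
    show "((\<lambda>s. (s, x)) has_derivative (\<lambda>s. (s, 0))) (at t within I)"
      by (intro has_derivative_Pair has_derivative_ident has_derivative_const)
    have "(\<lambda>s. (s, x)) ` I \<subseteq> I \<times> UNIV" by blast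
    then show "(G has_derivative D) (at (t, x) within (\<lambda>s. (s, x)) ` I)" by (rule has_derivative_subset[OF d])
  qed
  moreover have "D (s, 0) = D (1, 0) * s" for s
    using linear_scale[OF lin, of s "(1, 0)"] by simp
  then have "(\<lambda>s. D (s, 0)) = (*) (D (1, 0))" by (rule ext)
  ultimately show "((\<lambda>s. G (s, x)) has_real_derivative D (1, 0)) (at t within I)"
    by (simp add: has_field_derivative_def)
  have "((\<lambda>h. G (t, x + h *\<^sub>R e)) has_derivative (\<lambda>h. D (0, h *\<^sub>R e))) (at 0 within X)"
  proof (rule has_derivative_in_compose[where f="\<lambda>h. (t, x + h *\<^sub>R e)"])
    show "((\<lambda>h. (t, x + h *\<^sub>R e)) has_derivative (\<lambda>h. (0, h *\<^sub>R e))) (at 0 within X)"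
    proof -
      have "((\<lambda>h. x + h *\<^sub>R e) has_derivative (\<lambda>h. h *\<^sub>R e)) (at 0 within X)"
        by (auto intro!: derivative_eq_intros)
      from has_derivative_Pair[OF has_derivative_const this] show ?thesis .
    qed
    have "(\<lambda>h. (t, x + h *\<^sub>R e)) ` X \<subseteq> I \<times> UNIV" using t by blast
    then have "(G has_derivative D) (at (t, x) within (\<lambda>h. (t, x + h *\<^sub>R e)) ` X)"
      by (rule has_derivative_subset[OF d])
    then show "(G has_derivative D) (at (t, x + 0 *\<^sub>R e) within (\<lambda>h. (t, x + h *\<^sub>R e)) ` X)" by simp
  qed
  moreover have "D (0, h *\<^sub>R e) = D (0, e) * h" for h
    using linear_scale[OF lin, of h "(0, e)"] by simp
  then have "(\<lambda>h. D (0, h *\<^sub>R e)) = (*) (D (0, e))" by (rule ext)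
  ultimately show "((\<lambda>h. G (t, x + h *\<^sub>R e)) has_real_derivative D (0, e)) (at 0 within X)"
    by (simp add: has_field_derivative_def)
qed

lemma slice_derivative_shift:
  fixes G :: "real \<times> 'a::real_normed_vector \<Rightarrow> real"
  assumes d: "(G has_derivative D) (at (t, x + h *\<^sub>R e) within I \<times> UNIV)" and t: "t \<in> I"
  shows "((\<lambda>h. G (t, x + h *\<^sub>R e)) has_real_derivative D (0, e)) (at h)"
proof -
  have "((\<lambda>k. G (t, x + h *\<^sub>R e + k *\<^sub>R e)) has_real_derivative D (0, e)) (at (h - h))"
    using slice_derivative(2)[OF d t] by simp
  then have "((\<lambda>k. G (t, x + h *\<^sub>R e + (k - h) *\<^sub>R e)) has_real_derivative D (0, e) * 1) (at h)"
    by (rule DERIV_chain2) (auto intro!: derivative_eq_intros)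
  then show ?thesis by (simp add: algebra_simps)
qed

lemma second_deriv_eqI:
  fixes f :: "real \<Rightarrow> real"
  assumes "open U" "t \<in> U" "\<And>s. s \<in> U \<Longrightarrow> (f has_real_derivative f' s) (at s)"
    "(f' has_real_derivative D) (at t)"
  shows "(deriv ^^ 2) f t = D"
proof -
  have "\<forall>\<^sub>F s in nhds t. deriv f s = f' s"
    using assms(1-3) by (auto simp: eventually_nhds intro!: DERIV_imp_deriv)
  then have "deriv (deriv f) t = deriv f' t" by (rule deriv_cong_ev) simp
  also have "\<dots> = D" using assms(4) by (rule DERIV_imp_deriv)
  finally show ?thesis by (simp add: numeral_2_eq_2)
qed

text \<open>Translates the derivatives relative to the strip, and the iterated \<open>deriv\<close>
  of the equation, into one family of partial derivatives. Stopping at a finite time below T makes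
  the time interval compact.\<close>

lemma classical_solution_C2_strip:
  fixes v :: "real \<Rightarrow> 'a::euclidean_space \<Rightarrow> real"
  assumes sol: "classical_solution c H b msq \<Gamma> \<beta> p g0 g1 T v" and \<tau>: "0 < \<tau>" "ereal \<tau> < T"
  obtains vt vtt vx vtx vxx where "C2_strip \<tau> v vt vtt vx vtx vxx"
    "\<And>t x. 0 < t \<Longrightarrow> t \<le> \<tau> \<Longrightarrow>
      vtt t x - (c * exp (H * t))\<^sup>2 * (\<Sum>e\<in>Basis. vxx e t x) + b * vt t x + msq * v t x
        = (\<Gamma> t * (LINT y|lborel. \<bar>v t y\<bar> powr p) powr \<beta>) * \<bar>v t x\<bar> powr p"
    "\<And>x. v 0 x = g0 x" "\<And>x. vt 0 x = g1 x"
proof -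
  define I where "I = {t. 0 \<le> t \<and> ereal t < T}"
  define S where "S = I \<times> (UNIV :: 'a set)"
  define Io where "Io = {t. 0 < t \<and> ereal t < T}"
  have Io: "open Io" "Io \<subseteq> I"
  proof -
    have "open {t::real. ereal t < T}" by (intro open_Collect_less continuous_intros)
    then show "open Io" unfolding Io_def by (intro open_Collect_conj) (auto intro: open_Collect_less continuous_intros)
  qed (auto simp: Io_def I_def)
  have at_Io: "at t within I = at t" if "t \<in> Io" for t
    using Io that by (intro at_within_interior) (auto intro: interiorI)
  have sub: "{0..\<tau>} \<subseteq> I"
    using \<tau> by (auto simp: I_def) (meson ereal_less_eq(3) le_less_trans)
  define f where "f = (\<lambda>(t, x). v t x)"
  have "Ck_on 2 f S" using sol unfolding classical_solution_def time_strip_def f_def S_def I_def by blast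
  then obtain f' where f': "\<And>z. z \<in> S \<Longrightarrow> (f has_derivative f' z) (at z within S)"
      and "\<forall>h. \<exists>f''. (\<forall>z\<in>S. ((\<lambda>z. f' z h) has_derivative f'' z) (at z within S)) \<and> (\<forall>k. continuous_on S (\<lambda>z. f'' z k))"
    by (auto simp: numeral_2_eq_2)
  then obtain F where F: "\<And>h z. z \<in> S \<Longrightarrow> ((\<lambda>z. f' z h) has_derivative F h z) (at z within S)"
      and cF: "\<And>h k. continuous_on S (\<lambda>z. F h z k)"
    by metis
  have cf: "continuous_on S f" using f' has_derivative_continuous_on by blast
  have cf': "continuous_on S (\<lambda>z. f' z h)" for h using F has_derivative_continuous_on by blast
  \<comment> \<open>The symmetry lemma needs an open neighbourhood, so the mixed derivatives are
    identified at positive times only; this is why \<open>xvt\<close> of \<open>C2_strip\<close>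
    leaves out t = 0.\<close>
  have sym: "F h z k = F k z h" if z: "fst z \<in> Io" for h k z
  proof (rule second_derivative_symmetric[where S="Io \<times> UNIV"])
    show "open (Io \<times> (UNIV::'a set))" using Io by (intro open_Times) auto
    have at: "at y within S = at y" if "y \<in> Io \<times> UNIV" for y
      using Io that by (intro at_within_interior) (auto simp: S_def interior_Times intro: interiorI)
    have in_S: "y \<in> S" if "y \<in> Io \<times> UNIV" for y using that Io by (auto simp: S_def)
    fix y assume y: "y \<in> Io \<times> (UNIV::'a set)"
    show "(f has_derivative f' y) (at y)" using f'[OF in_S[OF y]] at[OF y] by simp
    show "((\<lambda>z. f' z h) has_derivative F h y) (at y)" "((\<lambda>z. f' z k) has_derivative F k y) (at y)"
      using F[OF in_S[OF y]] at[OF y] by simp_all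
  next
    show "z \<in> Io \<times> UNIV" using z by (cases z) auto
    show "continuous_on (Io \<times> UNIV) (\<lambda>x. F h x k)" "continuous_on (Io \<times> UNIV) (\<lambda>x. F k x h)"
      using Io by (auto intro!: continuous_on_subset[OF cF] simp: S_def)
  qed
  define vt where "vt t x = f' (t, x) (1, 0)" for t x
  define vx where "vx e t x = f' (t, x) (0, e)" for e t x
  define vtt where "vtt t x = F (1, 0) (t, x) (1, 0)" for t x
  define vtx where "vtx e t x = F (0, e) (t, x) (1, 0)" for e t x
  define vxx where "vxx e t x = F (0, e) (t, x) (0, e)" for e t x
  have fS: "(f has_derivative f' (t, x)) (at (t, x) within I \<times> UNIV)"
    "((\<lambda>z. f' z h) has_derivative F h (t, x)) (at (t, x) within I \<times> UNIV)" if "t \<in> I" for t x h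
    using f' F that by (auto simp: S_def)
  have dt: "((\<lambda>s. v s x) has_real_derivative vt t x) (at t within I)"
    "((\<lambda>s. vt s x) has_real_derivative vtt t x) (at t within I)"
    "((\<lambda>s. vx e s x) has_real_derivative vtx e t x) (at t within I)" if "t \<in> I" for t x e
    using slice_derivative(1)[OF fS(1)[OF that] that] slice_derivative(1)[OF fS(2)[OF that] that]
    by (auto simp: f_def vt_def vtt_def vx_def vtx_def)
  have dx: "((\<lambda>h. v t (x + h *\<^sub>R e)) has_real_derivative vx e t (x + h *\<^sub>R e)) (at h)"
    "((\<lambda>h. vx e t (x + h *\<^sub>R e)) has_real_derivative vxx e t (x + h *\<^sub>R e)) (at h)"
    "((\<lambda>h. vt t (x + h *\<^sub>R e)) has_real_derivative F (1, 0) (t, x + h *\<^sub>R e) (0, e)) (at h)" if "t \<in> I" for t x e h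
    using slice_derivative_shift[OF fS(1)[OF that] that] slice_derivative_shift[OF fS(2)[OF that] that]
    by (auto simp: f_def vt_def vxx_def vx_def)
  have cont: "continuous_on ({0..\<tau>} \<times> UNIV) g" if "continuous_on S g" for g :: "real \<times> 'a \<Rightarrow> real"
    using sub by (intro continuous_on_subset[OF that]) (auto simp: S_def)
  have eqs: "(\<lambda>(t, x). v t x) = f" "(\<lambda>(t, x). vt t x) = (\<lambda>z. f' z (1, 0))"
    "(\<lambda>(t, x). vtt t x) = (\<lambda>z. F (1, 0) z (1, 0))" "(\<lambda>(t, x). vx e t x) = (\<lambda>z. f' z (0, e))"
    "(\<lambda>(t, x). vtx e t x) = (\<lambda>z. F (0, e) z (1, 0))" "(\<lambda>(t, x). vxx e t x) = (\<lambda>z. F (0, e) z (0, e))" for e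
    by (auto simp: f_def vt_def vtt_def vx_def vtx_def vxx_def)
  show ?thesis
  proof (rule that)
    show "C2_strip \<tau> v vt vtt vx vtx vxx"
    proof
      show "0 < \<tau>" by (rule \<tau>(1))
      fix t x e assume t: "t \<in> {0..\<tau>}"
      then have tI: "t \<in> I" using sub by auto
      show "((\<lambda>s. v s x) has_real_derivative vt t x) (at t within {0..\<tau>})"
        "((\<lambda>s. vt s x) has_real_derivative vtt t x) (at t within {0..\<tau>})"
        "((\<lambda>s. vx e s x) has_real_derivative vtx e t x) (at t within {0..\<tau>})"
        by (rule DERIV_subset[OF dt(1)[OF tI] sub] DERIV_subset[OF dt(2)[OF tI] sub] DERIV_subset[OF dt(3)[OF tI] sub])+
      show "((\<lambda>h. v t (x + h *\<^sub>R e)) has_real_derivative vx e t x) (at 0)"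
        "((\<lambda>h. vx e t (x + h *\<^sub>R e)) has_real_derivative vxx e t x) (at 0)"
        using dx(1)[OF tI, where x=x and e=e and h=0] dx(2)[OF tI, where x=x and e=e and h=0] by simp_all
    next
      fix t x e assume t: "0 < t" "t \<le> \<tau>"
      then have "t \<in> {0..\<tau>}" by auto
      then have "t \<in> I" using sub by blast
      moreover from this have "t \<in> Io" using t by (simp add: I_def Io_def)
      ultimately show "((\<lambda>h. vt t (x + h *\<^sub>R e)) has_real_derivative vtx e t x) (at 0)"
        using dx(3)[of t, where x=x and e=e and h=0] sym[of "(t, x)" "(1, 0)" "(0, e)"] by (simp add: vtx_def)
    qed (unfold eqs, (rule cont, rule cf cf' cF)+)
  next
    fix t x assume t: "0 < t" "t \<le> \<tau>"
    then have "t \<in> {0..\<tau>}" by auto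
    then have "t \<in> I" using sub by blast
    moreover from this have "t \<in> Io" using t by (simp add: I_def Io_def)
    ultimately have tI: "t \<in> I" "t \<in> Io" by auto
    have at: "((\<lambda>s. v s x) has_real_derivative vt s x) (at s)"
      "((\<lambda>s. vt s x) has_real_derivative vtt s x) (at s)" if "s \<in> Io" for s
      using dt(1,2)[of s x] at_Io[OF that] Io that by auto
    have 1: "(deriv ^^ 2) (\<lambda>s. v s x) t = vtt t x"
      using Io(1) tI(2) at(1) at(2)[OF tI(2)] by (rule second_deriv_eqI)
    have 2: "deriv (\<lambda>s. v s x) t = vt t x" using at(1)[OF tI(2)] by (rule DERIV_imp_deriv)
    have 3: "laplacian (v t) x = (\<Sum>e\<in>Basis. vxx e t x)"
      unfolding laplacian_def
    proof (rule sum.cong[OF refl])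
      fix e :: 'a
      show "(deriv ^^ 2) (\<lambda>h. v t (x + h *\<^sub>R e)) 0 = vxx e t x"
        using dx(1)[OF tI(1), where x=x and e=e] dx(2)[OF tI(1), where x=x and e=e and h=0]
        by (intro second_deriv_eqI[of UNIV, where f'="\<lambda>h. vx e t (x + h *\<^sub>R e)"]) auto
    qed
    have "(c * exp (H * t))\<^sup>2 = c\<^sup>2 * exp (2 * H * t)"
      by (simp add: power_mult_distrib mult.assoc flip: exp_double)
    moreover have "(deriv ^^ 2) (\<lambda>s. v s x) t - c\<^sup>2 * exp (2 * H * t) * laplacian (v t) x
               + b * deriv (\<lambda>s. v s x) t + msq * v t x = nonlocal_term \<Gamma> \<beta> p v t x"
      using sol t tI unfolding classical_solution_def Io_def by blast
    ultimately show "vtt t x - (c * exp (H * t))\<^sup>2 * (\<Sum>e\<in>Basis. vxx e t x) + b * vt t x + msq * v t x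
        = (\<Gamma> t * (LINT y|lborel. \<bar>v t y\<bar> powr p) powr \<beta>) * \<bar>v t x\<bar> powr p"
      unfolding 1 2 3 nonlocal_term_def by simp
  next
    fix x
    show "v 0 x = g0 x" using sol by (auto simp: classical_solution_def)
    \<comment> \<open>The prescribed velocity is a derivative from the right, whereas
      \<open>vt 0\<close> is a derivative within an interval containing 0. Both restrict to
      \<open>{0<..<\<tau>}\<close>, where the derivative at 0 is unique.\<close>
    have d1: "((\<lambda>t. v t x) has_real_derivative g1 x) (at 0 within {0<..<\<tau>})"
      by (rule DERIV_subset[of _ _ 0 "{0<..}"]) (use sol in \<open>simp_all add: classical_solution_def subset_eq\<close>)
    have "0 \<in> I" using sub \<tau> by auto
    then have d2: "((\<lambda>t. v t x) has_real_derivative vt 0 x) (at 0 within {0<..<\<tau>})"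
      by (rule DERIV_subset[OF dt(1)]) (rule subset_trans[OF _ sub], simp add: subset_eq)
    have nb: "at 0 within {0<..<\<tau>} \<noteq> bot"
      using \<tau> by (simp add: trivial_limit_within islimpt_greaterThanLessThan1)
    show "vt 0 x = g1 x"
      by (rule vector_derivative_unique_within[OF nb d2[unfolded has_real_derivative_iff_has_vector_derivative]
            d1[unfolded has_real_derivative_iff_has_vector_derivative]])
  qed
qed

lemma compact_support_moment_nonneg:
  fixes f :: "'a::euclidean_space \<Rightarrow> real"
  assumes "continuous_on UNIV f" "\<And>x. f x \<ge> 0" "\<And>x. norm x > K \<Longrightarrow> f x = 0"
  shows "moment l f \<ge> integral UNIV f" "integral UNIV f \<ge> 0"
proof -
  show "moment l f \<ge> integral UNIV f"
    unfolding moment_def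
  proof (rule integral_le)
    show "f x \<le> f x * Phi l x" for x using mult_left_mono[OF Phi_ge_1 assms(2)] by simp
  qed (use assms in \<open>auto intro!: integrable_UNIV_box[of K] continuous_intros\<close>)
  show "integral UNIV f \<ge> 0"
    using assms by (intro integral_nonneg integrable_UNIV_box[of K]) auto
qed

text \<open>The nonlocal factor of the equation is not known to be bounded a priori; near a time \<open>t\<close> it can be
  read off from the equation at any point \<open>x\<close> with \<open>v(t,x) \<noteq> 0\<close>.\<close>

lemma (in C2_strip) coefficient_bounded:
  assumes c: "c > 0" and p: "p > 1"
    and pde: "\<And>t x. 0 < t \<Longrightarrow> t \<le> \<tau> \<Longrightarrow>
      vtt t x - (c * exp (H * t))\<^sup>2 * (\<Sum>e\<in>Basis. vxx e t x) + b * vt t x + msq * v t x = q t * \<bar>v t x\<bar> powr p"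
    and nz: "\<And>t. t \<in> {0..\<tau>} \<Longrightarrow> \<exists>x. v t x \<noteq> 0"
  shows "\<exists>Q. \<forall>t. 0 < t \<and> t \<le> \<tau> \<longrightarrow> \<bar>q t\<bar> \<le> Q"
proof -
  define P where "P a b \<longleftrightarrow> (\<exists>Q. \<forall>t\<in>{a..b}. 0 < t \<and> t \<le> \<tau> \<longrightarrow> \<bar>q t\<bar> \<le> Q)" for a b
  have "P 0 \<tau>"
  \<comment> \<open>Bisection takes the place of a covering argument: a bound near each time is
    enough.\<close>
  proof (rule Bolzano[where P=P])
    show "0 \<le> \<tau>" using \<tau> by simp
  next
    fix a b c assume "P a b" "P b c" "a \<le> b" "b \<le> c"
    then obtain Q Q' where "\<forall>t\<in>{a..b}. 0 < t \<and> t \<le> \<tau> \<longrightarrow> \<bar>q t\<bar> \<le> Q" "\<forall>t\<in>{b..c}. 0 < t \<and> t \<le> \<tau> \<longrightarrow> \<bar>q t\<bar> \<le> Q'"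
      by (auto simp: P_def)
    then have "\<forall>t\<in>{a..c}. 0 < t \<and> t \<le> \<tau> \<longrightarrow> \<bar>q t\<bar> \<le> max Q Q'"
      by (metis atLeastAtMost_iff le_max_iff_disj linear)
    then show "P a c" unfolding P_def by blast
  next
    fix t assume t: "0 \<le> t" "t \<le> \<tau>"
    then obtain x where x: "v t x \<noteq> 0" using nz[of t] by auto
    define L where "L s = vtt s x - (c * exp (H * s))\<^sup>2 * (\<Sum>e\<in>Basis. vxx e s x) + b * vt s x + msq * v s x" for s
    have sl: "continuous_on {0..\<tau>} (\<lambda>s. g s x)" if "continuous_on ({0..\<tau>} \<times> UNIV) (\<lambda>(t, x). g t x)" for g :: "real \<Rightarrow> 'a \<Rightarrow> real"
    proof -
      have "continuous_on {0..\<tau>} (\<lambda>s. (\<lambda>(t, x). g t x) (s, x))"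
        by (rule continuous_on_compose2[OF that]) (auto intro!: continuous_intros)
      then show ?thesis by simp
    qed
    have cv': "continuous_on {0..\<tau>} (\<lambda>s. v s x)" by (rule sl[OF cv])
    have "continuous_on {0..\<tau>} L" unfolding L_def
      by (intro continuous_intros sl cv cvt cvtt cvxx)
    then have cL: "continuous (at t within {0..\<tau>}) L" using t by (simp add: continuous_on_eq_continuous_within)
    have cvt': "continuous (at t within {0..\<tau>}) (\<lambda>s. v s x)" using cv' t by (simp add: continuous_on_eq_continuous_within)
    have "continuous (at t within {0..\<tau>}) (\<lambda>s. L s / \<bar>v s x\<bar> powr p)"
      using x by (intro continuous_at_within_divide cL continuous_at_within_powr continuous_rabs cvt' continuous_const) (auto)
    then obtain d1 where d1: "d1 > 0" "\<And>s. s \<in> {0..\<tau>} \<Longrightarrow> dist s t < d1 \<Longrightarrow> dist (L s / \<bar>v s x\<bar> powr p) (L t / \<bar>v t x\<bar> powr p) < 1"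
      unfolding continuous_within_eps_delta by (metis zero_less_one)
    obtain d2 where d2: "d2 > 0" "\<And>s. s \<in> {0..\<tau>} \<Longrightarrow> dist s t < d2 \<Longrightarrow> dist (v s x) (v t x) < \<bar>v t x\<bar>"
      using cvt' x unfolding continuous_within_eps_delta by (metis zero_less_abs_iff)
    show "\<exists>d>0. \<forall>a b. a \<le> t \<and> t \<le> b \<and> b - a < d \<longrightarrow> P a b"
    proof (intro exI[of _ "min d1 d2"] conjI allI impI)
      fix a b assume ab: "a \<le> t \<and> t \<le> b \<and> b - a < min d1 d2"
      have "\<bar>q s\<bar> \<le> \<bar>L t / \<bar>v t x\<bar> powr p\<bar> + 1" if s: "s \<in> {a..b}" "0 < s" "s \<le> \<tau>" for s
      proof -
        have ds: "dist s t < d1" "dist s t < d2" "s \<in> {0..\<tau>}" using ab s by (auto simp: dist_real_def)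
        have "v s x \<noteq> 0" using d2(2)[OF ds(3,2)] by (auto simp: dist_real_def)
        then have qs: "q s = L s / \<bar>v s x\<bar> powr p" using pde[OF s(2,3), of x] by (simp add: L_def)
        show ?thesis using d1(2)[OF ds(3,1)] unfolding qs dist_real_def by linarith
      qed
      then show "P a b" unfolding P_def by blast
    qed (use d1 d2 in auto)
  qed
  then obtain Q where "\<forall>t\<in>{0..\<tau>}. 0 < t \<and> t \<le> \<tau> \<longrightarrow> \<bar>q t\<bar> \<le> Q" unfolding P_def by blast
  then show ?thesis by (intro exI[of _ Q]) auto
qed

text \<open>Finite speed of propagation holds up to the first time at which \<open>v\<close> vanishes identically. There
  is no such time, because until then \<open>e\<^bsup>bt/2\<^esup> \<integral>v\<close> is nondecreasing.\<close>

lemma classical_solution_C2_wave: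
  fixes v :: "real \<Rightarrow> 'a::euclidean_space \<Rightarrow> real"
  assumes sol: "classical_solution c H b msq \<Gamma> \<beta> p g0 g1 T v"
    and par: "c > 0" "H > 0" "b \<ge> 0" "msq \<ge> 0" "b\<^sup>2 \<ge> 4 * msq" "p > 1" and \<Gamma>: "\<And>t. t > 0 \<Longrightarrow> \<Gamma> t \<ge> 0"
    and g: "\<And>x. g0 x \<ge> 0" "\<And>x. g1 x \<ge> 0" "\<And>x. norm x > R \<Longrightarrow> g0 x = 0" "\<And>x. norm x > R \<Longrightarrow> g1 x = 0" "g0 x1 \<noteq> 0"
    and \<tau>: "0 < \<tau>" "ereal \<tau> < T"
  obtains vt vtt vx vtx vxx where
    "C2_wave \<tau> v vt vtt vx vtx vxx (R + c / H * (exp (H * \<tau>) - 1)) c H b msq p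
       (\<lambda>t. \<Gamma> t * (LINT y|lborel. \<bar>v t y\<bar> powr p) powr \<beta>)"
    "\<And>x. v 0 x = g0 x" "\<And>x. vt 0 x = g1 x"
    "\<And>t x. t \<in> {0..\<tau>} \<Longrightarrow> norm x > R + c / H * (exp (H * t) - 1) \<Longrightarrow> v t x = 0"
proof -
  define A where "A t = c / H * (exp (H * t) - 1)" for t
  define q where "q t = \<Gamma> t * (LINT y|lborel. \<bar>v t y\<bar> powr p) powr \<beta>" for t
  have q0: "q t \<ge> 0" if "t > 0" for t using \<Gamma>[OF that] by (simp add: q_def)
  have Amono: "A s \<le> A t" if "s \<le> t" for s t
    using that par unfolding A_def by (intro mult_left_mono) auto
  have T: "ereal s < T" if "s \<le> \<tau>" for s
    using that \<tau> by (meson ereal_less_eq(3) le_less_trans)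
  have v0: "v 0 x = g0 x" for x using sol by (auto simp: classical_solution_def)
  \<comment> \<open>A conditional version: nonvanishing on [0, s] bounds the coefficient by
    \<open>coefficient_bounded\<close>, and with that bound \<open>finite_speed\<close>
    applies.\<close>
  have supp: "v t x = 0"
    if s: "0 < s" "s \<le> \<tau>" and nz: "\<And>t. t \<in> {0..s} \<Longrightarrow> \<exists>x. v t x \<noteq> 0"
      and t: "t \<in> {0..s}" and x: "norm x > R + A t" for s t x
  proof -
    obtain vt vtt vx vtx vxx where st: "C2_strip s v vt vtt vx vtx vxx"
      and pde: "\<And>t x. 0 < t \<Longrightarrow> t \<le> s \<Longrightarrow>
      vtt t x - (c * exp (H * t))\<^sup>2 * (\<Sum>e\<in>Basis. vxx e t x) + b * vt t x + msq * v t x = q t * \<bar>v t x\<bar> powr p"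
      and init: "\<And>x. v 0 x = g0 x" "\<And>x. vt 0 x = g1 x"
      by (rule classical_solution_C2_strip[OF sol s(1) T[OF s(2)], folded q_def], rule that, assumption+)
    interpret C2_strip s v vt vtt vx vtx vxx by (rule st)
    obtain Q where Q: "\<And>t. 0 < t \<Longrightarrow> t \<le> s \<Longrightarrow> \<bar>q t\<bar> \<le> Q"
      using coefficient_bounded[OF par(1,6) pde nz] by blast
    show ?thesis
      by (rule finite_speed[OF par(1-4,6) pde Q _ _ t]) (use init g x in \<open>auto simp: A_def\<close>)
  qed
  have wave: "\<exists>vt vtt vx vtx vxx. C2_wave s v vt vtt vx vtx vxx (R + A s) c H b msq p q \<and> (\<forall>x. vt 0 x = g1 x)"
    if s: "0 < s" "s \<le> \<tau>" and nz: "\<And>t. t \<in> {0..s} \<Longrightarrow> \<exists>x. v t x \<noteq> 0" for s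
  proof -
    obtain vt vtt vx vtx vxx where st: "C2_strip s v vt vtt vx vtx vxx"
      and pde: "\<And>t x. 0 < t \<Longrightarrow> t \<le> s \<Longrightarrow>
      vtt t x - (c * exp (H * t))\<^sup>2 * (\<Sum>e\<in>Basis. vxx e t x) + b * vt t x + msq * v t x = q t * \<bar>v t x\<bar> powr p"
      and init: "\<And>x. v 0 x = g0 x" "\<And>x. vt 0 x = g1 x"
      by (rule classical_solution_C2_strip[OF sol s(1) T[OF s(2)], folded q_def], rule that, assumption+)
    have sp: "v t x = 0" if "t \<in> {0..s}" "norm x > R + A s" for t x
      using that supp[OF s nz, of t x] Amono[of t s] by auto
    have "C2_wave s v vt vtt vx vtx vxx (R + A s) c H b msq p q"
      by (intro C2_wave.intro C2_strip_compact.intro st C2_strip_compact_axioms.intro C2_wave_axioms.intro)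
        (use sp par pde q0 in auto)
    then show ?thesis using init by blast
  qed
  have cg0: "continuous_on UNIV g0"
  proof -
    obtain vt vtt vx vtx vxx where st: "C2_strip \<tau> v vt vtt vx vtx vxx"
      by (rule classical_solution_C2_strip[OF sol \<tau>], rule that, assumption)
    have "continuous_on UNIV (v 0)" using continuous_on_slice[OF C2_strip.cv[OF st]] \<tau> by auto
    moreover have "v 0 = g0" using v0 by (rule ext)
    ultimately show ?thesis by simp
  qed
  have m0: "integral UNIV g0 > 0"
    using integral_UNIV_zero_imp_zero[OF cg0 g(1) g(3), where ?x0.0=x1] g(5) compact_support_moment_nonneg(2)[OF cg0 g(1,3)]
    by force
  have nz: "\<exists>x. v t x \<noteq> 0" if t: "t \<in> {0..\<tau>}" for t
  proof (rule ccontr)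
    assume neg: "\<not> ?thesis"
    define Z where "Z = {t \<in> {0..\<tau>}. \<forall>x. v t x = 0}"
    have "t \<in> Z" using t neg by (auto simp: Z_def)
    obtain vt vtt vx vtx vxx where st: "C2_strip \<tau> v vt vtt vx vtx vxx"
      by (rule classical_solution_C2_strip[OF sol \<tau>], rule that, assumption)
    interpret C2_strip \<tau> v vt vtt vx vtx vxx by (rule st)
    have "closed Z"
    proof -
      have "continuous_on {0..\<tau>} (\<lambda>s. v s x)" for x
      proof -
        have "continuous_on {0..\<tau>} (\<lambda>s. (\<lambda>(t, x). v t x) (s, x))"
          by (rule continuous_on_compose2[OF cv]) (auto intro!: continuous_intros)
        then show ?thesis by simp
      qed
      then have "closed {t \<in> {0..\<tau>}. v t x = 0}" for x
        by (intro continuous_closed_preimage_constant) auto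
      moreover have "Z = (\<Inter>x. {t \<in> {0..\<tau>}. v t x = 0})" by (auto simp: Z_def)
      ultimately show ?thesis by auto
    qed
    have bdd: "bdd_below Z" by (auto simp: Z_def bdd_below_def)
    define w where "w = Inf Z"
    have "w \<in> Z" unfolding w_def using \<open>closed Z\<close> \<open>t \<in> Z\<close> bdd by (intro closed_contains_Inf) auto
    then have w: "0 \<le> w" "w \<le> \<tau>" "\<And>x. v w x = 0" by (auto simp: Z_def)
    have "w \<noteq> 0" using w(3)[of x1] v0[of x1] g(5) by auto
    then have w0: "w > 0" using w by simp
    have below: "\<exists>x. v t x \<noteq> 0" if "0 \<le> t" "t < w" for t
    proof (rule ccontr)
      assume "\<not> ?thesis"
      then have "t \<in> Z" using that w by (auto simp: Z_def)
      then show False using cInf_lower[OF _ bdd, of t] that by (simp add: w_def)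
    qed
    define m where "m t = moment 0 (v t)" for t
    \<comment> \<open>One ball contains the supports up to and including w: before w by
      \<open>supp\<close>, at w because v vanishes there.\<close>
    have cm: "continuous_on {0..w} m"
      unfolding m_def[abs_def] moment_def
    proof (rule continuous_on_integral_UNIV[where K="R + A w"])
      have "continuous_on ({0..\<tau>} \<times> UNIV) (\<lambda>(t, x). v t x * Phi 0 x)"
        using cv unfolding case_prod_unfold by (auto intro!: continuous_intros)
      then show "continuous_on ({0..w} \<times> UNIV) (\<lambda>(t, x). v t x * Phi 0 x)"
        by (rule continuous_on_subset) (use w in auto)
      fix t and x :: 'a assume t: "t \<in> {0..w}" and x: "norm x > R + A w"
      have "v t x = 0"
      proof (cases "t < w")
        case True
        have "v t x = 0"
        \<comment> \<open>\<open>supp\<close> asks for an interval of positive length, and t may be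
          0.\<close>
        proof (rule supp[of "max t (w / 2)"])
          fix r assume r: "r \<in> {0..max t (w / 2)}"
          have "max t (w / 2) < w" using True w0 by simp
          then show "\<exists>x. v r x \<noteq> 0" using below[of r] r by fastforce
        qed (use True w w0 t x Amono[of t w] in auto)
        then show ?thesis .
      qed (use t w in auto)
      then show "v t x * Phi 0 x = 0" by simp
    qed
    define \<delta> where "\<delta> = exp (- (b * w / 2)) * integral UNIV g0"
    have \<delta>: "\<delta> > 0" using m0 by (simp add: \<delta>_def)
    \<comment> \<open>The bound is uniform in t < w, so it persists as t tends to w and contradicts
      m(w) = 0.\<close>
    have mge: "m t \<ge> \<delta>" if t: "0 < t" "t < w" for t
    proof -
      have "\<And>s. s \<in> {0..t} \<Longrightarrow> \<exists>x. v s x \<noteq> 0" using below t by auto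
      with t w obtain vt vtt vx vtx vxx where wv: "C2_wave t v vt vtt vx vtx vxx (R + A t) c H b msq p q"
        and vt0: "\<forall>x. vt 0 x = g1 x" using wave[of t] by auto
      interpret C2_wave t v vt vtt vx vtx vxx "R + A t" c H b msq p q by (rule wv)
      have "v 0 = g0" "vt 0 = g1" using v0 vt0 by auto
      have cg1: "continuous_on UNIV g1"
        using continuous_on_slice[OF C2_strip.cvt[OF C2_strip_axioms], of 0] t \<open>vt 0 = g1\<close> by auto
      have i: "moment 0 (v 0) \<ge> 0" "moment 0 (vt 0) \<ge> 0"
        unfolding \<open>v 0 = g0\<close> \<open>vt 0 = g1\<close>
        by (rule order.trans[OF compact_support_moment_nonneg(2)[where K=R] compact_support_moment_nonneg(1)[where K=R]];
            use cg0 cg1 g in simp)+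
      have "W 0 0 \<le> W 0 t" using W_mono[OF i, of t] t by auto
      then have "moment 0 g0 \<le> exp (b * t / 2) * m t"
        unfolding W_def m_def \<open>v 0 = g0\<close> by simp
      moreover have "integral UNIV g0 \<le> moment 0 g0"
        by (rule compact_support_moment_nonneg(1)[where K=R]) (use cg0 g in simp_all)
      ultimately have "integral UNIV g0 \<le> exp (b * t / 2) * m t" by linarith
      also have "\<dots> \<le> exp (b * w / 2) * m t"
      proof (rule mult_right_mono)
        show "exp (b * t / 2) \<le> exp (b * w / 2)" using t par by (simp add: mult_left_mono)
        have "W 0 t \<ge> 0" using W_nonneg(1)[OF i, of t] t by auto
        then show "0 \<le> m t" by (simp add: W_def m_def zero_le_mult_iff)
      qed
      finally show ?thesis unfolding \<delta>_def by (simp add: exp_minus field_simps)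
    qed
    have "m w = 0" unfolding m_def moment_def using w by simp
    obtain d where d: "d > 0" "\<And>t. t \<in> {0..w} \<Longrightarrow> dist t w < d \<Longrightarrow> dist (m t) (m w) < \<delta>"
      using cm \<delta> w w0 unfolding continuous_on_iff by (metis atLeastAtMost_iff order_refl)
    define t where "t = max (w / 2) (w - d / 2)"
    have "t \<in> {0..w}" "dist t w < d" "0 < t" "t < w" using w0 d by (auto simp: t_def dist_real_def)
    then show False using d(2)[of t] mge[of t] \<open>m w = 0\<close> by (simp add: dist_real_def)
  qed
  from wave[OF \<tau>(1) order_refl nz] obtain vt vtt vx vtx vxx
    where fin: "C2_wave \<tau> v vt vtt vx vtx vxx (R + A \<tau>) c H b msq p q" "\<forall>x. vt 0 x = g1 x" by blast
  show ?thesis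
  proof (rule that[OF fin(1)[unfolded A_def q_def[abs_def]]])
    show "v t x = 0" if "t \<in> {0..\<tau>}" "norm x > R + c / H * (exp (H * t) - 1)" for t x
      using supp[OF \<tau>(1) order_refl nz that(1), of x] that(2) by (simp add: A_def)
  qed (use fin v0 in simp_all)
qed

section \<open>The normalised mass\<close>

locale blowup_params =
  fixes c H b msq \<beta> p \<mu> \<sigma> R :: real and v0 v1 :: "'a::euclidean_space \<Rightarrow> real"
  assumes c: "c > 0" and H: "H > 0" and b: "b \<ge> 0" and msq: "msq \<ge> 0" "b\<^sup>2 \<ge> 4 * msq"
    and \<beta>: "\<beta> \<ge> 0" and p: "p > 1" and \<mu>: "\<mu> > 0" and R: "R > 0"
    and n_large: "real DIM('a) / 2 > 1 / p"
    and v0: "continuous_on UNIV v0" "\<And>x. v0 x \<ge> 0" "\<And>x. norm x > R \<Longrightarrow> v0 x = 0" "\<exists>x. v0 x \<noteq> 0"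
    and v1: "continuous_on UNIV v1" "\<And>x. v1 x \<ge> 0" "\<And>x. norm x > R \<Longrightarrow> v1 x = 0" "\<exists>x. v1 x \<noteq> 0"
begin

definition n :: real where "n = real DIM('a)"
definition q :: real where "q = (\<beta> + 1) * p"
text \<open>The growth rate of the source when \<open>M\<close> is constant, and the discount rate
  of past sources in \<open>M_ge_sum_moments\<close>.\<close>

definition \<theta> :: real where "\<theta> = H * (n / 2 - 1 / p)"
text \<open>Heuristically, a linear wave decays like e^(-(b+nH)t/2), by damping, WKB amplitude and
  radial spreading, and lives on a layer of bounded width along a sphere of radius about e^(Ht), of
  volume about e^((n-1)Ht).\<close>

definition \<alpha> :: real where "\<alpha> = p * (b + n * H) / 2 - (n - 1) * H"
definition \<rho> :: real where
  "\<rho> = (b + n * H) / 2 * (q - 1) + n * H - (n - 1) * H * (\<beta> + 1) - H / p"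
definition \<Gamma> :: "real \<Rightarrow> real" where "\<Gamma> t = \<mu> * exp (\<rho> * t) * (1 + t) powr \<sigma>"
text \<open>\<open>lam j\<close> satisfies \<open>c lam\<^sub>j e\<^bsup>Hj\<^esup> = 3 H\<close>: from time \<open>j\<close> on, \<open>exponential_growth\<close> applies to its moment.\<close>

definition lam :: "nat \<Rightarrow> real" where "lam j = 3 * H / c * exp (- H * real j)"
definition M :: "(real \<Rightarrow> 'a \<Rightarrow> real) \<Rightarrow> real \<Rightarrow> real" where
  "M v t = exp (\<alpha> * t) * (LINT x|lborel. \<bar>v t x\<bar> powr p)"

definition sol :: "real \<Rightarrow> ereal \<Rightarrow> (real \<Rightarrow> 'a \<Rightarrow> real) \<Rightarrow> bool" where
  "sol \<epsilon> T v \<longleftrightarrow> classical_solution c H b msq \<Gamma> \<beta> p (\<lambda>x. \<epsilon> * v0 x) (\<lambda>x. \<epsilon> * v1 x) T v"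

lemma \<theta>: "\<theta> > 0"
  unfolding \<theta>_def n_def using H n_large by simp

lemma q: "q > 1"
proof -
  have "(\<beta> + 1) * p \<ge> 1 * p" using \<beta> p by (intro mult_right_mono) auto
  then show ?thesis using p unfolding q_def by linarith
qed

text \<open>What the critical exponent is chosen for: with X = e^(-\<alpha>t) M, the source e^(bt/2)
  \<Gamma> X^(\<beta>+1) has exponential rate \<theta>.\<close>

lemma exponent_identity: "b / 2 + \<rho> - \<alpha> * (\<beta> + 1) = \<theta>"
  unfolding \<rho>_def \<alpha>_def \<theta>_def q_def using p by (simp add: field_simps)

lemma lam_pos: "lam j > 0" using c H by (simp add: lam_def)

lemma c_lam: "c * lam j * exp (H * t) = 3 * H * exp (H * (t - real j))"
  using c by (simp add: lam_def algebra_simps flip: exp_add)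

text \<open>Nonnegative times at distance at most 2 qualify, since 3 + s <= 3(1 + s).\<close>

lemma weight_shift:
  assumes "0 \<le> t" "0 \<le> s" "1 + t \<le> 3 * (1 + s)" "1 + s \<le> 3 * (1 + t)"
  shows "(1 + s) powr \<sigma> \<ge> 3 powr (- \<bar>\<sigma>\<bar>) * (1 + t) powr \<sigma>"
proof (cases "\<sigma> \<ge> 0")
  case True
  have "3 powr (- \<bar>\<sigma>\<bar>) * (1 + t) powr \<sigma> = ((1 + t) / 3) powr \<sigma>"
    using True assms by (simp add: powr_divide powr_minus field_simps)
  also have "\<dots> \<le> (1 + s) powr \<sigma>" using assms True by (intro powr_mono2) auto
  finally show ?thesis .
next
  case False
  have "3 powr (- \<bar>\<sigma>\<bar>) * (1 + t) powr \<sigma> = (3 * (1 + t)) powr \<sigma>"     using False assms by (subst powr_mult) auto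
  also have "\<dots> \<le> (1 + s) powr \<sigma>" using False assms by (intro powr_mono2') auto
  finally show ?thesis .
qed

text \<open>Put y = e^(H(\<tau>-j)). From the size \<eta>(j) at time j, the moment at scale
  \<open>lam j\<close> grows by \<open>exponential_growth\<close> to about \<eta>(j) e^(3y)
  y^(-1/2), while \<open>gser_upper\<close> bounds it, up to e^(b\<tau>/2), by e^(3y) y^(-m) times
  the Laplace transform of |v| in the distance to the edge. The factors e^(3y) cancel, and
  \<open>laplace_transform_bound\<close> adds up the p-th powers over j.\<close>

lemma M_ge_sum_moments:
  shows "\<exists>c1>0. \<forall>\<tau> v vt vtt vx vtx vxx K qq (\<eta>::nat \<Rightarrow> real).
    C2_wave \<tau> v vt vtt vx vtx vxx K c H b msq p qq \<longrightarrow> K \<le> R + c / H * exp (H * \<tau>) \<longrightarrow>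
    (\<forall>l. moment l (v 0) \<ge> 0 \<and> moment l (vt 0) \<ge> 0) \<longrightarrow>
    (\<forall>j. real j \<le> \<tau> \<longrightarrow> 0 \<le> \<eta> j \<and> \<eta> j \<le> C2_wave.W v b (lam j) (real j) \<and> \<eta> j \<le> C2_wave.W1 v vt b (lam j) (real j)) \<longrightarrow>
    c1 * (\<Sum>j<Suc (nat \<lfloor>\<tau>\<rfloor>). (\<eta> j * exp (- \<theta> * real j)) powr p) \<le> M (v :: real \<Rightarrow> 'a \<Rightarrow> real) \<tau>"
proof -
  define m where "m = (n - 1) / 2"
  have m0: "m \<ge> 0" using DIM_positive[where 'a='a] by (simp add: m_def n_def)
  obtain Cg where Cg: "Cg > 0" "\<And>l z. 1 \<le> l \<Longrightarrow> 0 \<le> z \<Longrightarrow> z \<le> l \<Longrightarrow> gser DIM('a) (z\<^sup>2) \<le> Cg * l powr (- m) * exp ((l + z) / 2)"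
    using gser_upper[of "DIM('a)" m] unfolding m_def n_def by auto
  obtain Cs where Cs: "Cs > 0" "\<And>r (f::'a \<Rightarrow> real) N. r > 0 \<Longrightarrow> continuous_on UNIV f \<Longrightarrow> (\<And>x. f x \<ge> 0) \<Longrightarrow>
     (\<And>x. norm x > r \<Longrightarrow> f x = 0) \<Longrightarrow>
     (\<Sum>j<N. (lam j) powr (p - 1) * (LINT x|lborel. f x * exp (- (lam j) * (r - norm x) / 2)) powr p)
      \<le> Cs * (r ^ (DIM('a) - 1)) powr (p - 1) * (LINT x|lborel. f x powr p)"
    using laplace_transform_bound[where 'a='a, OF p H, of "3 * H / c"] c H unfolding lam_def by auto
  define \<kappa> where "\<kappa> = 1 / ((1 + 3 * H) * exp 4 * Cg * exp (3 * H * R / c))"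
  have \<kappa>: "\<kappa> > 0" using H Cg by (simp add: \<kappa>_def)
  define K1 where "K1 = R + c / H"
  have K1: "K1 > 0" using R c H by (simp add: K1_def add_pos_pos)
  define c1 where "c1 = (3 * H / c) powr (p - 1) * \<kappa> powr p / (Cs * (K1 ^ (DIM('a) - 1)) powr (p - 1))"
  have c1: "c1 > 0" using \<kappa> c H Cs K1 by (simp add: c1_def)
  show ?thesis
  proof (intro exI[of _ c1] conjI c1 allI impI)
    fix \<tau> and v vt vtt :: "real \<Rightarrow> 'a \<Rightarrow> real" and vx vtx vxx K qq and \<eta> :: "nat \<Rightarrow> real"
    assume wave: "C2_wave \<tau> v vt vtt vx vtx vxx K c H b msq p qq" and K: "K \<le> R + c / H * exp (H * \<tau>)"
      and init: "\<forall>l. moment l (v 0) \<ge> 0 \<and> moment l (vt 0) \<ge> 0"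
      and \<eta>: "\<forall>j. real j \<le> \<tau> \<longrightarrow> 0 \<le> \<eta> j \<and> \<eta> j \<le> C2_wave.W v b (lam j) (real j) \<and> \<eta> j \<le> C2_wave.W1 v vt b (lam j) (real j)"
    interpret w: C2_wave \<tau> v vt vtt vx vtx vxx K c H b msq p qq by (rule wave)
    have \<tau>0: "\<tau> > 0" by (rule w.\<tau>)
    define r where "r = R + c / H * exp (H * \<tau>)"
    have r0: "r > 0" using R c H by (simp add: r_def add_pos_pos)
    have r_le: "r \<le> K1 * exp (H * \<tau>)"
    proof -
      have "R * 1 \<le> R * exp (H * \<tau>)" using R H \<tau>0 by (intro mult_left_mono) auto
      then show ?thesis by (simp add: r_def K1_def algebra_simps)
    qed
    define f where "f x = \<bar>v \<tau> x\<bar>" for x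
    have cvf: "continuous_on UNIV (v \<tau>)" using continuous_on_slice[OF w.cv] \<tau>0 by auto
    have cf: "continuous_on UNIV f" unfolding f_def by (intro continuous_intros cvf)
    have fsupp: "f x = 0" if "norm x > r" for x using w.supp[of \<tau> x] \<tau>0 K that by (simp add: f_def r_def)
    define I where "I j = (LINT x|lborel. f x * exp (- (lam j) * (r - norm x) / 2))" for j
    have I_ge: "I j \<ge> \<kappa> * \<eta> j * exp (- b * \<tau> / 2) * exp ((m - 1 / 2) * H * (\<tau> - real j))" if j: "real j \<le> \<tau>" for j
    proof -
      define l where "l = lam j"
      have l0: "l > 0" by (simp add: l_def lam_pos)
      define y where "y = exp (H * (\<tau> - real j))"
      have y1: "y \<ge> 1" using H j by (simp add: y_def)
      \<comment> \<open>The radius is taken without the -1 of the light cone, which makes this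
        identity exact: the growth exponent 3y of the moment equals l r up to the bounded term l
        R.\<close>
      have lr: "l * r = 3 * y + l * R"
        using c_lam[of j \<tau>] c H by (simp add: r_def l_def y_def field_simps)
      have lR: "0 \<le> l * R" "l * R \<le> 3 * H * R / c"
        using H R c l0 by (auto simp: l_def lam_def field_simps mult_le_cancel_left1)
      have lr1: "l * r \<ge> 1" "l * r \<ge> 3 * y" using lr lR y1 by linarith+
      have i1: "moment l (v 0) \<ge> 0" "moment l (vt 0) \<ge> 0" using init by auto
      have "w.W l \<tau> \<ge> \<eta> j / ((1 + 3 * H) * exp 4) * exp (3 * exp (H * (\<tau> - real j)) - H / 2 * (\<tau> - real j))"
      proof (rule exponential_growth[OF H, where W'="w.W1 l" and W''="w.W2 l"])
        show "continuous_on {real j..\<tau>} (w.W l)" "continuous_on {real j..\<tau>} (w.W1 l)"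
          by (auto intro: continuous_on_subset[OF w.continuous_on_W(1)] continuous_on_subset[OF w.continuous_on_W(2)])
        fix t assume t: "real j < t" "t < \<tau>"
        then have t0: "0 < t" by (meson le_less_trans of_nat_0_le_iff)
        show "(w.W l has_real_derivative w.W1 l t) (at t)" "(w.W1 l has_real_derivative w.W2 l t) (at t)"
          using w.W_deriv[OF t0 t(2)] by auto
        have "(c * l * exp (H * t))\<^sup>2 * w.W l t + exp (b * t / 2) * w.source t \<le> w.W2 l t"
          using w.W2_ge[OF i1 t0] t by auto
        moreover have "exp (b * t / 2) * w.source t \<ge> 0" using w.moment_source(2)[OF t0] t by auto
        ultimately show "(3 * H * exp (H * (t - real j)))\<^sup>2 * w.W l t \<le> w.W2 l t"
          using c_lam[of j t] by (simp add: l_def)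
      qed (use \<eta> j in \<open>auto simp: l_def\<close>)
      then have lower: "\<eta> j / ((1 + 3 * H) * exp 4) * (exp (3 * y) * exp (- (H / 2 * (\<tau> - real j)))) \<le> w.W l \<tau>"
        by (simp add: y_def flip: exp_add)
      have moment_le: "moment l (v \<tau>) \<le> Cg * (l * r) powr (- m) * exp (l * r) * I j"
      proof -
        have "moment l (v \<tau>) = (LINT x|lborel. v \<tau> x * Phi l x)"
          unfolding moment_def using cvf fsupp
          by (intro integral_UNIV_eq_lebesgue[of r]) (auto intro!: continuous_intros simp: f_def)
        also have "\<dots> \<le> (LINT x|lborel. (Cg * (l * r) powr (- m) * exp (l * r)) * (f x * exp (- l * (r - norm x) / 2)))"
        proof (rule integral_mono)
          show "integrable lborel (\<lambda>x. v \<tau> x * Phi l x)"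
            using cvf fsupp by (intro integrable_continuous_compact_support[of r])
              (auto intro!: continuous_intros intro: continuous_on_subset simp: f_def)
          show "integrable lborel (\<lambda>x. Cg * (l * r) powr (- m) * exp (l * r) * (f x * exp (- l * (r - norm x) / 2)))"
            using cf fsupp by (intro integrable_continuous_compact_support[of r])
              (auto intro!: continuous_intros intro: continuous_on_subset)
          fix x :: 'a
          show "v \<tau> x * Phi l x \<le> Cg * (l * r) powr (- m) * exp (l * r) * (f x * exp (- l * (r - norm x) / 2))"
          proof (cases "norm x \<le> r")
            case True
            have "Phi l x = gser DIM('a) ((l * norm x)\<^sup>2)"
              by (simp add: Phi_def power_mult_distrib power2_norm_eq_inner)
            also have "\<dots> \<le> Cg * (l * r) powr (- m) * exp ((l * r + l * norm x) / 2)"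
              using lr1 l0 True by (intro Cg(2)) (auto intro: mult_left_mono)
            also have "exp ((l * r + l * norm x) / 2) = exp (l * r) * exp (- l * (r - norm x) / 2)"
              by (simp add: field_simps flip: exp_add)
            finally have "Phi l x \<le> Cg * (l * r) powr (- m) * (exp (l * r) * exp (- l * (r - norm x) / 2))" .
            then have "f x * Phi l x \<le> f x * (Cg * (l * r) powr (- m) * (exp (l * r) * exp (- l * (r - norm x) / 2)))"
              by (intro mult_left_mono) (auto simp: f_def)
            moreover have "v \<tau> x * Phi l x \<le> f x * Phi l x"
              using Phi_ge_1[of l x] by (intro mult_right_mono) (auto simp: f_def)
            ultimately show ?thesis by (simp add: mult_ac)
          qed (use fsupp[of x] in \<open>auto simp: f_def\<close>)
        qed
        also have "\<dots> = Cg * (l * r) powr (- m) * exp (l * r) * I j" by (simp add: I_def l_def)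
        finally show ?thesis .
      qed
      have I0: "I j \<ge> 0" unfolding I_def by (intro Bochner_Integration.integral_nonneg) (auto simp: f_def)
      have "Cg * (l * r) powr (- m) * exp (l * r) * I j \<le> Cg * exp (- m * (H * (\<tau> - real j))) * (exp (3 * y) * exp (3 * H * R / c)) * I j"
      proof (intro mult_right_mono mult_mono mult_left_mono I0)
        have "(l * r) powr (- m) \<le> y powr (- m)" using lr1 y1 m0 by (intro powr_mono2') auto
        also have "\<dots> = exp (- m * (H * (\<tau> - real j)))" by (simp add: y_def exp_powr_real mult.commute)
        finally show "(l * r) powr (- m) \<le> exp (- m * (H * (\<tau> - real j)))" .
        show "exp (l * r) \<le> exp (3 * y) * exp (3 * H * R / c)"
          unfolding lr using lR by (simp flip: exp_add)
      qed (use Cg in auto)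
      then have "w.W l \<tau> \<le> exp (b * \<tau> / 2) * (Cg * exp (- m * (H * (\<tau> - real j))) * (exp (3 * y) * exp (3 * H * R / c)) * I j)"
        unfolding w.W_def using moment_le by (intro mult_left_mono) auto
      with lower have "\<eta> j / ((1 + 3 * H) * exp 4) * (exp (3 * y) * exp (- (H / 2 * (\<tau> - real j))))
        \<le> exp (b * \<tau> / 2) * (Cg * exp (- m * (H * (\<tau> - real j))) * (exp (3 * y) * exp (3 * H * R / c)) * I j)"
        by linarith
      then have "(\<eta> j / ((1 + 3 * H) * exp 4) * exp (- (H / 2 * (\<tau> - real j)))) * exp (3 * y)
        \<le> (exp (b * \<tau> / 2) * (Cg * exp (- m * (H * (\<tau> - real j))) * exp (3 * H * R / c) * I j)) * exp (3 * y)"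
        by (simp only: mult_ac)
      then have fin: "\<eta> j / ((1 + 3 * H) * exp 4) * exp (- (H / 2 * (\<tau> - real j)))
        \<le> exp (b * \<tau> / 2) * (Cg * exp (- m * (H * (\<tau> - real j))) * exp (3 * H * R / c) * I j)"
        by (rule mult_right_le_imp_le) simp
      define z where "z = exp (- b * \<tau> / 2) * exp (m * (H * (\<tau> - real j))) / (Cg * exp (3 * H * R / c))"
      have z0: "z > 0" using Cg by (simp add: z_def)
      have "z * (\<eta> j / ((1 + 3 * H) * exp 4) * exp (- (H / 2 * (\<tau> - real j))))
        \<le> z * (exp (b * \<tau> / 2) * (Cg * exp (- m * (H * (\<tau> - real j))) * exp (3 * H * R / c) * I j))"
        using fin z0 by (intro mult_left_mono) auto
      also have "\<dots> = I j"
      proof -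
        define X where "X = H * (\<tau> - real j)"
        have r: "exp (- b * \<tau> / 2) = inverse (exp (b * \<tau> / 2))" "exp (- m * X) = inverse (exp (m * X))"
          by (simp_all flip: exp_minus)
        show ?thesis unfolding z_def X_def[symmetric] r using Cg by (simp add: divide_simps)
      qed
      finally have "z * (\<eta> j / ((1 + 3 * H) * exp 4) * exp (- (H / 2 * (\<tau> - real j)))) \<le> I j" .
      moreover have "z * (\<eta> j / ((1 + 3 * H) * exp 4) * exp (- (H / 2 * (\<tau> - real j))))
        = \<kappa> * \<eta> j * exp (- b * \<tau> / 2) * exp ((m - 1 / 2) * H * (\<tau> - real j))"
      proof -
        have "exp (m * (H * (\<tau> - real j))) * exp (- (H / 2 * (\<tau> - real j))) = exp ((m - 1 / 2) * H * (\<tau> - real j))"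
          by (simp add: algebra_simps flip: exp_add)
        then show ?thesis unfolding z_def \<kappa>_def by (simp add: field_simps)
      qed
      ultimately show ?thesis by simp
    qed
    define N where "N = Suc (nat \<lfloor>\<tau>\<rfloor>)"
    have jN: "real j \<le> \<tau>" if "j < N" for j
      using that \<tau>0 unfolding N_def by (auto simp: less_Suc_eq_le) (metis le_nat_floor nat_le_iff floor_le_iff of_nat_floor order.trans of_nat_mono less_imp_le)
    let ?X = "LINT x|lborel. \<bar>v \<tau> x\<bar> powr p"
    have X0: "?X \<ge> 0" by (intro Bochner_Integration.integral_nonneg) auto
    define E where "E = exp (- (b * p * \<tau> / 2) + p * (m - 1 / 2) * H * \<tau>)"
    have term_le: "(3 * H / c) powr (p - 1) * \<kappa> powr p * E * (\<eta> j * exp (- \<theta> * real j)) powr p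
      \<le> lam j powr (p - 1) * I j powr p" if j: "j < N" for j
    proof -
      have \<eta>0: "\<eta> j \<ge> 0" using \<eta> jN[OF j] by auto
      have "(\<kappa> * \<eta> j * exp (- b * \<tau> / 2) * exp ((m - 1 / 2) * H * (\<tau> - real j))) powr p \<le> I j powr p"
        using I_ge[OF jN[OF j]] \<kappa> \<eta>0 p by (intro powr_mono2) auto
      then have "lam j powr (p - 1) * (\<kappa> * \<eta> j * exp (- b * \<tau> / 2) * exp ((m - 1 / 2) * H * (\<tau> - real j))) powr p
        \<le> lam j powr (p - 1) * I j powr p" by (intro mult_left_mono) auto
      moreover have "lam j powr (p - 1) * (\<kappa> * \<eta> j * exp (- b * \<tau> / 2) * exp ((m - 1 / 2) * H * (\<tau> - real j))) powr p
        = (3 * H / c) powr (p - 1) * \<kappa> powr p * E * (\<eta> j * exp (- \<theta> * real j)) powr p"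
      proof -
        have 1: "lam j powr (p - 1) = (3 * H / c) powr (p - 1) * exp (- H * real j * (p - 1))"
          unfolding lam_def using c H by (subst powr_mult) (auto simp: exp_powr_real)
        have 2: "(\<kappa> * \<eta> j * exp (- b * \<tau> / 2) * exp ((m - 1 / 2) * H * (\<tau> - real j))) powr p
          = \<kappa> powr p * \<eta> j powr p * exp (- b * \<tau> / 2 * p) * exp ((m - 1 / 2) * H * (\<tau> - real j) * p)"
          using \<kappa> \<eta>0 by (simp add: powr_mult exp_powr_real)
        have 3: "(\<eta> j * exp (- \<theta> * real j)) powr p = \<eta> j powr p * exp (- \<theta> * real j * p)"
          using \<eta>0 by (simp add: powr_mult exp_powr_real)
        \<comment> \<open>The decay in j has two origins: H(p-1) from l^(p-1), and p(m-1/2)H from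
          the power y^(m-1/2) that is left after e^(3y) cancels.\<close>
        have \<theta>p: "\<theta> * p = H * (p - 1) + p * (m - 1 / 2) * H"
          unfolding \<theta>_def m_def using p by (simp add: field_simps)
        have "- H * real j * (p - 1) + (- b * \<tau> / 2 * p + (m - 1 / 2) * H * (\<tau> - real j) * p)
          = - (b * p * \<tau> / 2) + p * (m - 1 / 2) * H * \<tau> - real j * (H * (p - 1) + p * (m - 1 / 2) * H)"
          by (simp add: field_simps)
        also have "\<dots> = (- (b * p * \<tau> / 2) + p * (m - 1 / 2) * H * \<tau>) + (- \<theta> * real j * p)"
          unfolding \<theta>p[symmetric] by simp
        finally have 4: "exp (- H * real j * (p - 1)) * (exp (- b * \<tau> / 2 * p) * exp ((m - 1 / 2) * H * (\<tau> - real j) * p))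
          = E * exp (- \<theta> * real j * p)"
          unfolding E_def exp_add[symmetric] by (rule arg_cong)
        have "lam j powr (p - 1) * (\<kappa> * \<eta> j * exp (- b * \<tau> / 2) * exp ((m - 1 / 2) * H * (\<tau> - real j))) powr p
          = (3 * H / c) powr (p - 1) * \<kappa> powr p * \<eta> j powr p *
            (exp (- H * real j * (p - 1)) * (exp (- b * \<tau> / 2 * p) * exp ((m - 1 / 2) * H * (\<tau> - real j) * p)))"
          unfolding 1 2 by (simp only: mult_ac)
        also have "\<dots> = (3 * H / c) powr (p - 1) * \<kappa> powr p * E * (\<eta> j * exp (- \<theta> * real j)) powr p"
          unfolding 3 4 by (simp only: mult_ac)
        finally show ?thesis .
      qed
      ultimately show ?thesis by simp
    qed
    let ?S = "\<Sum>j<N. (\<eta> j * exp (- \<theta> * real j)) powr p"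
    have "(3 * H / c) powr (p - 1) * \<kappa> powr p * E * ?S \<le> (\<Sum>j<N. lam j powr (p - 1) * I j powr p)"
      unfolding sum_distrib_left by (intro sum_mono term_le) auto
    also have "\<dots> \<le> Cs * (r ^ (DIM('a) - 1)) powr (p - 1) * (LINT x|lborel. f x powr p)"
      unfolding I_def using r0 cf fsupp by (intro Cs(2)) (auto simp: f_def)
    also have "\<dots> \<le> Cs * ((K1 ^ (DIM('a) - 1)) powr (p - 1) * exp (H * (n - 1) * (p - 1) * \<tau>)) * ?X"
    proof -
      have "r ^ (DIM('a) - 1) \<le> (K1 * exp (H * \<tau>)) ^ (DIM('a) - 1)" using r_le r0 by (intro power_mono) auto
      also have "\<dots> = K1 ^ (DIM('a) - 1) * exp (H * (n - 1) * \<tau>)"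
        by (simp add: power_mult_distrib n_def of_nat_diff flip: exp_of_nat_mult)
      finally have "(r ^ (DIM('a) - 1)) powr (p - 1) \<le> (K1 ^ (DIM('a) - 1) * exp (H * (n - 1) * \<tau>)) powr (p - 1)"
        using r0 p by (intro powr_mono2) auto
      also have "\<dots> = (K1 ^ (DIM('a) - 1)) powr (p - 1) * exp (H * (n - 1) * (p - 1) * \<tau>)"
        using K1 by (simp add: powr_mult exp_powr_real mult_ac)
      finally show ?thesis unfolding f_def using Cs X0 by (intro mult_right_mono mult_left_mono) auto
    qed
    finally have main: "(3 * H / c) powr (p - 1) * \<kappa> powr p * E * ?S
      \<le> Cs * ((K1 ^ (DIM('a) - 1)) powr (p - 1) * exp (H * (n - 1) * (p - 1) * \<tau>)) * ?X" .
    \<comment> \<open>This fixes \<open>\<alpha>\<close>: it balances the \<tau>-dependence of the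
      Laplace transforms against the volume factor r^((n-1)(p-1)).\<close>
    have E2: "exp (\<alpha> * \<tau>) * E = exp (H * (n - 1) * (p - 1) * \<tau>)"
    proof -
      have "\<alpha> * \<tau> + (- (b * p * \<tau> / 2) + p * (m - 1 / 2) * H * \<tau>) = H * (n - 1) * (p - 1) * \<tau>"
        unfolding \<alpha>_def m_def by (simp add: field_simps)
      then show ?thesis unfolding E_def by (simp flip: exp_add)
    qed
    let ?Kp = "(K1 ^ (DIM('a) - 1)) powr (p - 1)"
    have Kp: "?Kp > 0" using K1 by simp
    have "exp (\<alpha> * \<tau>) * ((3 * H / c) powr (p - 1) * \<kappa> powr p * E * ?S)
      \<le> exp (\<alpha> * \<tau>) * (Cs * (?Kp * exp (H * (n - 1) * (p - 1) * \<tau>)) * ?X)"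
      using main by (intro mult_left_mono) auto
    then have "((3 * H / c) powr (p - 1) * \<kappa> powr p * ?S) * (exp (\<alpha> * \<tau>) * E)
      \<le> (Cs * ?Kp * (exp (\<alpha> * \<tau>) * ?X)) * exp (H * (n - 1) * (p - 1) * \<tau>)"
      by (simp only: mult_ac)
    then have "(3 * H / c) powr (p - 1) * \<kappa> powr p * ?S \<le> Cs * ?Kp * M v \<tau>"
      unfolding E2 M_def by (rule mult_right_le_imp_le) simp
    then have "c1 * ?S \<le> M v \<tau>"
      using Cs Kp unfolding c1_def by (simp add: field_simps)
    then show "c1 * (\<Sum>j<Suc (nat \<lfloor>\<tau>\<rfloor>). (\<eta> j * exp (- \<theta> * real j)) powr p) \<le> M v \<tau>"
      unfolding N_def .
  qed
qed

lemma \<Gamma>_nonneg: "\<Gamma> t \<ge> 0"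
  using \<mu> by (simp add: \<Gamma>_def)

text \<open>Because \<Phi> >= 1, \<epsilon>J bounds the initial moments of position and velocity
  from below for every l simultaneously.\<close>

definition J :: real where "J = min (integral UNIV v0) (integral UNIV v1)"

lemma J: "J > 0"
proof -
  have "integral UNIV f > 0"
    if f: "continuous_on UNIV f" "\<And>x. f x \<ge> 0" "\<And>x. norm x > R \<Longrightarrow> f x = 0" "\<exists>x. f x \<noteq> 0" for f :: "'a \<Rightarrow> real"
  proof -
    obtain x where "f x \<noteq> 0" using f(4) by blast
    then have "integral UNIV f \<noteq> 0" using integral_UNIV_zero_imp_zero[OF f(1-3), of R x] by auto
    then show ?thesis using compact_support_moment_nonneg(2)[where K=R, OF f(1,2)] f(3) by force
  qed
  then show ?thesis unfolding J_def using v0 v1 by simp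
qed

lemma sol_wave:
  assumes s: "sol \<epsilon> T v" and \<epsilon>: "\<epsilon> > 0" and \<tau>: "0 < \<tau>" "ereal \<tau> < T"
  obtains vt vtt vx vtx vxx where
    "C2_wave \<tau> v vt vtt vx vtx vxx (R + c / H * (exp (H * \<tau>) - 1)) c H b msq p
       (\<lambda>t. \<Gamma> t * (LINT y|lborel. \<bar>v t y\<bar> powr p) powr \<beta>)"
    "\<And>l. moment l (v 0) \<ge> \<epsilon> * J" "\<And>l. moment l (vt 0) \<ge> \<epsilon> * J"
proof -
  obtain x1 where x1: "v0 x1 \<noteq> 0" using v0(4) by blast
  have mom: "moment l (\<lambda>x. \<epsilon> * f x) \<ge> \<epsilon> * integral UNIV f"
    if f: "continuous_on UNIV f" "\<And>x. f x \<ge> 0" "\<And>x. norm x > R \<Longrightarrow> f x = 0" for f :: "'a \<Rightarrow> real" and l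
  proof -
    have "integral UNIV (\<lambda>x. \<epsilon> * f x) \<le> moment l (\<lambda>x. \<epsilon> * f x)"
      using f \<epsilon> by (intro compact_support_moment_nonneg(1)[where K=R] continuous_intros) auto
    then show ?thesis by simp
  qed
  have J_le: "\<epsilon> * J \<le> \<epsilon> * integral UNIV v0" "\<epsilon> * J \<le> \<epsilon> * integral UNIV v1"
    using \<epsilon> by (auto simp: J_def)
  obtain vt vtt vx vtx vxx where w:
    "C2_wave \<tau> v vt vtt vx vtx vxx (R + c / H * (exp (H * \<tau>) - 1)) c H b msq p
       (\<lambda>t. \<Gamma> t * (LINT y|lborel. \<bar>v t y\<bar> powr p) powr \<beta>)"
    and i: "\<And>x. v 0 x = \<epsilon> * v0 x" "\<And>x. vt 0 x = \<epsilon> * v1 x"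
  proof (rule classical_solution_C2_wave[OF s[unfolded sol_def] c H b msq p \<Gamma>_nonneg _ _ _ _ _ \<tau>])
    show "\<epsilon> * v0 x1 \<noteq> 0" using x1 \<epsilon> by simp
    fix vt vtt vx vtx vxx
    assume "C2_wave \<tau> v vt vtt vx vtx vxx (R + c / H * (exp (H * \<tau>) - 1)) c H b msq p
       (\<lambda>t. \<Gamma> t * (LINT y|lborel. \<bar>v t y\<bar> powr p) powr \<beta>)"
      "\<And>x. v 0 x = \<epsilon> * v0 x" "\<And>x. vt 0 x = \<epsilon> * v1 x"
    then show thesis by (rule that)
  qed (use v0 v1 \<epsilon> in auto)
  have "v 0 = (\<lambda>x. \<epsilon> * v0 x)" "vt 0 = (\<lambda>x. \<epsilon> * v1 x)" using i by auto
  then show ?thesis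
    using mom[OF v0(1-3)] mom[OF v1(1-3)] J_le by (intro that[OF w]) (auto intro: order.trans)
qed

section \<open>An iterative inequality for \<open>M\<close> and a blow-up criterion\<close>

lemma M_nonneg: "M v t \<ge> 0"
  unfolding M_def by (intro mult_nonneg_nonneg Bochner_Integration.integral_nonneg) auto

lemma source_eq:
  "exp (b * s / 2) * (\<Gamma> s * (LINT y|lborel. \<bar>v s y\<bar> powr p) powr \<beta> * (LINT x|lborel. \<bar>v s x\<bar> powr p))
    = \<mu> * exp (\<theta> * s) * (1 + s) powr \<sigma> * M v s powr (\<beta> + 1)"
proof -
  define X where "X = (LINT y|lborel. \<bar>v s y\<bar> powr p)"
  have X0: "X \<ge> 0" unfolding X_def by (intro Bochner_Integration.integral_nonneg) auto
  have 1: "X powr \<beta> * X = X powr (\<beta> + 1)" using X0 \<beta> by (cases "X = 0") (auto simp: powr_add)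
  have 2: "M v s powr (\<beta> + 1) = exp (\<alpha> * s * (\<beta> + 1)) * X powr (\<beta> + 1)"
    unfolding M_def X_def[symmetric] using X0 by (simp add: powr_mult exp_powr_real)
  have "b * s / 2 + \<rho> * s = \<theta> * s + \<alpha> * s * (\<beta> + 1)"
    unfolding exponent_identity[symmetric] by (simp add: field_simps)
  then have 3: "exp (b * s / 2) * exp (\<rho> * s) = exp (\<theta> * s) * exp (\<alpha> * s * (\<beta> + 1))"
    by (simp flip: exp_add)
  have "exp (b * s / 2) * (\<Gamma> s * X powr \<beta> * X) = \<mu> * (exp (b * s / 2) * exp (\<rho> * s)) * (1 + s) powr \<sigma> * (X powr \<beta> * X)"
    unfolding \<Gamma>_def by (simp only: mult_ac)
  also have "\<dots> = \<mu> * exp (\<theta> * s) * (1 + s) powr \<sigma> * M v s powr (\<beta> + 1)"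
    unfolding 1 2 3 by (simp only: mult_ac)
  finally show ?thesis by (simp add: X_def)
qed

text \<open>On (j-1, j) the source lifts \<open>W\<close> and \<open>W1\<close> at scale
  \<open>lam j\<close>, both nonnegative before, to at least \<open>\<eta> j\<close>. Its factor
  e^(\<theta>j) cancels the discount e^(-\<theta>j), so all j enter alike; the term j = 0 carries
  the initial data.\<close>

lemma M_iteration_frame:
  shows "\<exists>c1>0. \<forall>\<epsilon> T v t (g :: nat \<Rightarrow> real). \<epsilon> > 0 \<longrightarrow> sol \<epsilon> T v \<longrightarrow> 0 < t \<longrightarrow> ereal t < T \<longrightarrow>
    (\<forall>j s. 1 \<le> j \<longrightarrow> real j \<le> t \<longrightarrow> real j - 1 < s \<longrightarrow> s < real j \<longrightarrow> 0 \<le> g j \<and> g j \<le> M v s) \<longrightarrow>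
    c1 * (\<epsilon> powr p + (\<Sum>j=1..nat \<lfloor>t\<rfloor>. ((1 + real j) powr \<sigma> * g j powr (\<beta> + 1)) powr p)) \<le> M v t"
proof -
  obtain c0 where c0: "c0 > 0" and sum_moments: "\<And>\<tau> v vt vtt vx vtx vxx K qq \<eta>.
    C2_wave \<tau> v vt vtt vx vtx vxx K c H b msq p qq \<Longrightarrow> K \<le> R + c / H * exp (H * \<tau>) \<Longrightarrow>
    (\<forall>l. moment l (v 0) \<ge> 0 \<and> moment l (vt 0) \<ge> 0) \<Longrightarrow>
    (\<And>j. real j \<le> \<tau> \<Longrightarrow> 0 \<le> \<eta> j \<and> \<eta> j \<le> C2_wave.W v b (lam j) (real j) \<and> \<eta> j \<le> C2_wave.W1 v vt b (lam j) (real j)) \<Longrightarrow>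
    c0 * (\<Sum>j<Suc (nat \<lfloor>\<tau>\<rfloor>). (\<eta> j * exp (- \<theta> * real j)) powr p) \<le> M v \<tau>"
    using M_ge_sum_moments by blast
  \<comment> \<open>e^(-\<theta>) and 3^(-|\<sigma>|) compare the source on (j-1, j) with its value
    at j; 1/2 is the Taylor coefficient in the bound for \<open>W\<close>.\<close>
  define k where "k = \<mu> * exp (- \<theta>) * 3 powr (- \<bar>\<sigma>\<bar>) / 2"
  have k: "k > 0" using \<mu> by (simp add: k_def)
  define c1 where "c1 = c0 * min (J powr p) (k powr p)"
  have c1: "c1 > 0" using c0 k J by (simp add: c1_def)
  show ?thesis
  proof (intro exI[of _ c1] conjI c1 allI impI)
    fix \<epsilon> T v t and g :: "nat \<Rightarrow> real"
    assume \<epsilon>: "\<epsilon> > 0" and s: "sol \<epsilon> T v" and t: "0 < t" "ereal t < T"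
      and g: "\<forall>j s. 1 \<le> j \<longrightarrow> real j \<le> t \<longrightarrow> real j - 1 < s \<longrightarrow> s < real j \<longrightarrow> 0 \<le> g j \<and> g j \<le> M v s"
    obtain vt vtt vx vtx vxx where
      wave: "C2_wave t v vt vtt vx vtx vxx (R + c / H * (exp (H * t) - 1)) c H b msq p
         (\<lambda>t. \<Gamma> t * (LINT y|lborel. \<bar>v t y\<bar> powr p) powr \<beta>)"
      and init: "\<And>l. moment l (v 0) \<ge> \<epsilon> * J" "\<And>l. moment l (vt 0) \<ge> \<epsilon> * J"
      using sol_wave[OF s \<epsilon> t] by blast
    interpret w: C2_wave t v vt vtt vx vtx vxx "R + c / H * (exp (H * t) - 1)" c H b msq p
       "\<lambda>t. \<Gamma> t * (LINT y|lborel. \<bar>v t y\<bar> powr p) powr \<beta>" by (rule wave)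
    have \<epsilon>J: "\<epsilon> * J > 0" using \<epsilon> J by simp
    have i0: "moment l (v 0) \<ge> 0" "moment l (vt 0) \<ge> 0" for l using init[of l] \<epsilon>J by linarith+
    define \<eta> where "\<eta> j = (if j = 0 then \<epsilon> * J else k * exp (\<theta> * real j) * ((1 + real j) powr \<sigma> * g j powr (\<beta> + 1)))" for j
    have "c0 * (\<Sum>j<Suc (nat \<lfloor>t\<rfloor>). (\<eta> j * exp (- \<theta> * real j)) powr p) \<le> M v t"
    proof (rule sum_moments[OF wave])
      show "R + c / H * (exp (H * t) - 1) \<le> R + c / H * exp (H * t)"
        by (intro add_left_mono mult_left_mono) (use c H in auto)
      show "\<forall>l. moment l (v 0) \<ge> 0 \<and> moment l (vt 0) \<ge> 0" using i0 by blast
      fix j assume jt: "real j \<le> t"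
      show "0 \<le> \<eta> j \<and> \<eta> j \<le> w.W (lam j) (real j) \<and> \<eta> j \<le> w.W1 (lam j) (real j)"
      proof (cases "j = 0")
        case True
        have "b / 2 * moment (lam 0) (v 0) \<ge> 0" using b i0 by simp
        then show ?thesis using True init[of "lam 0"] \<epsilon>J by (simp add: \<eta>_def w.W_def w.W1_def)
      next
        case False
        then have j1: "1 \<le> j" by simp
        let ?W = "w.W (lam j)" and ?W1 = "w.W1 (lam j)"
        define S where "S = 2 * \<eta> j"
        have \<eta>0: "\<eta> j \<ge> 0" using k False by (simp add: \<eta>_def)
        have S_eq: "S = \<mu> * exp (\<theta> * (real j - 1)) * (3 powr (- \<bar>\<sigma>\<bar>) * (1 + real j) powr \<sigma>) * g j powr (\<beta> + 1)"
        proof -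
          have "exp (\<theta> * (real j - 1)) = exp (- \<theta>) * exp (\<theta> * real j)" by (simp add: algebra_simps flip: exp_add)
          then show ?thesis unfolding S_def \<eta>_def k_def using False by simp
        qed
        have S_le: "w.W2 (lam j) r \<ge> S" if r: "real j - 1 < r" "r < real j" for r
        proof -
          have r0: "0 < r" "r \<le> t" using r j1 jt by auto
          have gr: "0 \<le> g j" "g j \<le> M v r" using g j1 jt r by auto
          have "S \<le> \<mu> * exp (\<theta> * r) * (1 + r) powr \<sigma> * M v r powr (\<beta> + 1)"
            unfolding S_eq
          proof (intro mult_mono mult_left_mono)
            show "3 powr (- \<bar>\<sigma>\<bar>) * (1 + real j) powr \<sigma> \<le> (1 + r) powr \<sigma>"
              using r r0 j1 by (intro weight_shift) auto
            show "g j powr (\<beta> + 1) \<le> M v r powr (\<beta> + 1)" using gr \<beta> by (intro powr_mono2) auto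
            show "exp (\<theta> * (real j - 1)) \<le> exp (\<theta> * r)" using r \<theta> by simp
          qed (use \<mu> in auto)
          also have "\<dots> = exp (b * r / 2) * w.source r"
            unfolding w.source_def source_eq[symmetric] by simp
          also have "\<dots> \<le> w.W2 (lam j) r" by (rule w.W2_ge_source[OF i0 r0])
          finally show ?thesis .
        qed
        have j1t: "real j - 1 \<in> {0..t}" using j1 jt by auto
        have nn: "?W (real j - 1) \<ge> 0" "?W1 (real j - 1) \<ge> 0" using w.W_nonneg[OF i0 j1t] by auto
        have cW: "continuous_on {real j - 1..real j} ?W" "continuous_on {real j - 1..real j} ?W1"
          using j1 jt by (auto intro: continuous_on_subset[OF w.continuous_on_W(1)] continuous_on_subset[OF w.continuous_on_W(2)])
        have d: "(?W has_real_derivative ?W1 r) (at r)" "(?W1 has_real_derivative w.W2 (lam j) r) (at r)"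
          if "real j - 1 < r" "r < real j" for r
          using that j1 jt by (auto intro!: w.W_deriv)
        have "?W1 (real j) \<ge> ?W1 (real j - 1) + S * (real j - (real j - 1))"
          by (rule second_derivative_lower_bound(1)[OF cW d S_le]) auto
        moreover have "?W (real j) \<ge> ?W (real j - 1) + ?W1 (real j - 1) * (real j - (real j - 1)) + S * (real j - (real j - 1))\<^sup>2 / 2"
          by (rule second_derivative_lower_bound(2)[OF cW d S_le]) auto
        ultimately show ?thesis using nn \<eta>0 by (simp add: S_def)
      qed
    qed
    moreover have "(\<Sum>j<Suc (nat \<lfloor>t\<rfloor>). (\<eta> j * exp (- \<theta> * real j)) powr p)
      = (\<epsilon> * J) powr p + (\<Sum>j=1..nat \<lfloor>t\<rfloor>. (k * ((1 + real j) powr \<sigma> * g j powr (\<beta> + 1))) powr p)"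
    proof -
      have "{..<Suc (nat \<lfloor>t\<rfloor>)} = insert 0 {1..nat \<lfloor>t\<rfloor>}" by auto
      then have "(\<Sum>j<Suc (nat \<lfloor>t\<rfloor>). (\<eta> j * exp (- \<theta> * real j)) powr p)
        = (\<eta> 0 * exp (- \<theta> * real 0)) powr p + (\<Sum>j=1..nat \<lfloor>t\<rfloor>. (\<eta> j * exp (- \<theta> * real j)) powr p)"
        by simp
      moreover have "(\<eta> j * exp (- \<theta> * real j)) powr p = (k * ((1 + real j) powr \<sigma> * g j powr (\<beta> + 1))) powr p"
        if "j \<in> {1..nat \<lfloor>t\<rfloor>}" for j
      proof -
        have "exp (\<theta> * real j) * exp (- \<theta> * real j) = 1" by (simp flip: exp_add)
        then have "\<eta> j * exp (- \<theta> * real j) = k * ((1 + real j) powr \<sigma> * g j powr (\<beta> + 1))"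
          using that by (simp add: \<eta>_def mult_ac)
        then show ?thesis by (rule arg_cong)
      qed
      then have "(\<Sum>j=1..nat \<lfloor>t\<rfloor>. (\<eta> j * exp (- \<theta> * real j)) powr p)
        = (\<Sum>j=1..nat \<lfloor>t\<rfloor>. (k * ((1 + real j) powr \<sigma> * g j powr (\<beta> + 1))) powr p)"
        by (rule sum.cong[OF refl])
      moreover have "\<eta> 0 * exp (- \<theta> * real 0) = \<epsilon> * J" by (simp add: \<eta>_def)
      ultimately show ?thesis by (simp only:)
    qed
    moreover have "min (J powr p) (k powr p) * (\<epsilon> powr p + (\<Sum>j=1..nat \<lfloor>t\<rfloor>. ((1 + real j) powr \<sigma> * g j powr (\<beta> + 1)) powr p))
      \<le> (\<epsilon> * J) powr p + (\<Sum>j=1..nat \<lfloor>t\<rfloor>. (k * ((1 + real j) powr \<sigma> * g j powr (\<beta> + 1))) powr p)"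
    proof -
      have "(k * ((1 + real j) powr \<sigma> * g j powr (\<beta> + 1))) powr p = k powr p * ((1 + real j) powr \<sigma> * g j powr (\<beta> + 1)) powr p" for j
        using k by (simp add: powr_mult)
      moreover have "(\<epsilon> * J) powr p = J powr p * \<epsilon> powr p" using \<epsilon> J by (simp add: powr_mult)
      ultimately show ?thesis unfolding distrib_left
        by (simp only: sum_distrib_left[symmetric]) (intro add_mono mult_right_mono sum_nonneg, auto)
    qed
    ultimately show "c1 * (\<epsilon> powr p + (\<Sum>j=1..nat \<lfloor>t\<rfloor>. ((1 + real j) powr \<sigma> * g j powr (\<beta> + 1)) powr p)) \<le> M v t"
      using c0 unfolding c1_def mult.assoc by (smt (verit) mult_left_mono)
  qed
qed

text \<open>During one time unit the source lifts U = \<open>W 0\<close> to a level Y. During the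
  next one, Hoelder's inequality on the support, of volume O(e^(nHr)), bounds M from below by a
  multiple of (e^(-\<theta>r) U)^p, hence U'' >= k U^q. The exponentials in k and Y^(q-1) cancel, so
  the bound of \<open>power_ode_blowup\<close> leaves only powers of 1 + t0 and m.\<close>

lemma M_blowup_criterion:
  shows "\<exists>K>0. \<forall>\<epsilon> T v t0 m. \<epsilon> > 0 \<longrightarrow> sol \<epsilon> T v \<longrightarrow> 0 \<le> t0 \<longrightarrow> ereal (t0 + 2) < T \<longrightarrow> 0 < m \<longrightarrow>
    (\<forall>s. t0 < s \<longrightarrow> s < t0 + 2 \<longrightarrow> m \<le> M v s) \<longrightarrow>
    (1 + t0) powr (\<sigma> * q) * m powr ((\<beta> + 1) * (q - 1)) < K"
proof -
  obtain K0 where K0: "K0 > 0" and blow: "\<And>(y::real\<Rightarrow>real) y' y'' s k Y.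
     continuous_on {s..s+1} y \<Longrightarrow> continuous_on {s..s+1} y' \<Longrightarrow>
     (\<And>t. s < t \<Longrightarrow> t < s + 1 \<Longrightarrow> (y has_real_derivative y' t) (at t)) \<Longrightarrow>
     (\<And>t. s < t \<Longrightarrow> t < s + 1 \<Longrightarrow> (y' has_real_derivative y'' t) (at t)) \<Longrightarrow>
     (\<And>t. s < t \<Longrightarrow> t < s + 1 \<Longrightarrow> y'' t \<ge> k * (y t) powr q) \<Longrightarrow>
     y s \<ge> Y \<Longrightarrow> Y > 0 \<Longrightarrow> y' s \<ge> 0 \<Longrightarrow> k \<ge> 0 \<Longrightarrow> k * Y powr (q - 1) < K0"
    using power_ode_blowup[OF q] by metis
  \<comment> \<open>The support is estimated by its size at t0 + 2; e^(2H) compares e^(H(t0+2)) with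
    e^(Hr) for r > t0.\<close>
  define K1 where "K1 = (R + c / H) * exp (2 * H)"
  have K1: "K1 > 0" using R c H by (simp add: K1_def add_pos_pos)
  define B where "B = unit_ball_vol n * K1 ^ DIM('a)"
  have B: "B > 0" using K1 by (simp add: B_def n_def)
  define c3 where "c3 = B powr (- (p - 1))"
  have c3: "c3 > 0" using B by (simp add: c3_def)
  define k0 where "k0 = \<mu> * 3 powr (- \<bar>\<sigma>\<bar>) * c3 powr (\<beta> + 1) * exp (2 * \<theta> * (1 - q))"
  have k0: "k0 > 0" using \<mu> c3 by (simp add: k0_def)
  define g0 where "g0 = \<mu> * 3 powr (- \<bar>\<sigma>\<bar>) / 2"
  have g0: "g0 > 0" using \<mu> by (simp add: g0_def)
  define K where "K = K0 / (k0 * g0 powr (q - 1))"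
  have K: "K > 0" using K0 k0 g0 by (simp add: K_def)
  show ?thesis
  proof (intro exI[of _ K] conjI K allI impI)
    fix \<epsilon> T v t0 m
    assume \<epsilon>: "\<epsilon> > 0" and s: "sol \<epsilon> T v" and t0: "0 \<le> t0" "ereal (t0 + 2) < T" and m: "0 < m"
      and Mm: "\<forall>s. t0 < s \<longrightarrow> s < t0 + 2 \<longrightarrow> m \<le> M v s"
    have t2: "0 < t0 + 2" using t0 by simp
    obtain vt vtt vx vtx vxx where
      wave: "C2_wave (t0 + 2) v vt vtt vx vtx vxx (R + c / H * (exp (H * (t0 + 2)) - 1)) c H b msq p
         (\<lambda>t. \<Gamma> t * (LINT y|lborel. \<bar>v t y\<bar> powr p) powr \<beta>)"
      and init: "\<And>l. moment l (v 0) \<ge> \<epsilon> * J" "\<And>l. moment l (vt 0) \<ge> \<epsilon> * J"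
      using sol_wave[OF s \<epsilon> t2 t0(2)] by blast
    interpret w: C2_wave "t0 + 2" v vt vtt vx vtx vxx "R + c / H * (exp (H * (t0 + 2)) - 1)" c H b msq p
       "\<lambda>t. \<Gamma> t * (LINT y|lborel. \<bar>v t y\<bar> powr p) powr \<beta>" by (rule wave)
    have \<epsilon>J: "\<epsilon> * J > 0" using \<epsilon> J by simp
    have i0: "moment l (v 0) \<ge> 0" "moment l (vt 0) \<ge> 0" for l using init[of l] \<epsilon>J by linarith+
    let ?U = "w.W 0" and ?U1 = "w.W1 0" and ?U2 = "w.W2 0"
    have U2: "?U2 r \<ge> \<mu> * exp (\<theta> * r) * (3 powr (- \<bar>\<sigma>\<bar>) * (1 + t0) powr \<sigma>) * M v r powr (\<beta> + 1)"
      if r: "t0 < r" "r < t0 + 2" for r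
    proof -
      have r0: "0 < r" "r \<le> t0 + 2" using r t0 by auto
      have "\<mu> * exp (\<theta> * r) * (3 powr (- \<bar>\<sigma>\<bar>) * (1 + t0) powr \<sigma>) * M v r powr (\<beta> + 1)
        \<le> \<mu> * exp (\<theta> * r) * (1 + r) powr \<sigma> * M v r powr (\<beta> + 1)"
        using \<mu> r t0 by (intro mult_right_mono mult_left_mono weight_shift) auto
      also have "\<dots> = exp (b * r / 2) * w.source r"
        unfolding w.source_def source_eq[symmetric] by simp
      also have "\<dots> \<le> ?U2 r" by (rule w.W2_ge_source[OF i0 r0])
      finally show ?thesis .
    qed
    have M_ge: "M v r \<ge> c3 * (exp (- \<theta> * r) * ?U r) powr p" if r: "t0 < r" "r < t0 + 2" for r
    proof -
      have r': "r \<in> {0..t0 + 2}" using r t0 by auto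
      define \<rho>r where "\<rho>r = K1 * exp (H * r)"
      have \<rho>r0: "\<rho>r > 0" using K1 by (simp add: \<rho>r_def)
      have \<rho>r: "R + c / H * (exp (H * (t0 + 2)) - 1) \<le> \<rho>r"
      proof -
        have "R + c / H * (exp (H * (t0 + 2)) - 1) \<le> R * exp (H * (t0 + 2)) + c / H * exp (H * (t0 + 2))"
          using R c H t0 by (intro add_mono mult_left_mono) auto
        also have "\<dots> = (R + c / H) * exp (H * (t0 + 2))" by (simp add: algebra_simps)
        also have "\<dots> \<le> (R + c / H) * (exp (2 * H) * exp (H * r))"
          using R c H r unfolding exp_add[symmetric]
          by (intro mult_left_mono) (auto simp: algebra_simps add_nonneg_nonneg)
        finally show ?thesis by (simp add: \<rho>r_def K1_def mult_ac)
      qed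
      define f where "f x = \<bar>v r x\<bar>" for x
      have cvr: "continuous_on UNIV (v r)" using continuous_on_slice[OF w.cv r'] .
      then have cf: "continuous_on X f" for X
        unfolding f_def by (intro continuous_intros) (rule continuous_on_subset, auto)
      have vs: "v r x = 0" if "norm x > \<rho>r" for x using w.supp[OF r', of x] that \<rho>r by simp
      then have fs: "f x = 0" if "norm x > \<rho>r" for x using that by (simp add: f_def)
      let ?g = "indicator (cball 0 \<rho>r) :: 'a \<Rightarrow> real"
      let ?F = "LINT x|lborel. f x" and ?X = "LINT x|lborel. \<bar>v r x\<bar> powr p"
      have fg: "f x * ?g x = f x" "f x powr p * ?g x = f x powr p" for x
        using fs[of x] by (auto simp: indicator_def)
      have if1: "integrable lborel f" using fs by (intro integrable_continuous_compact_support[of \<rho>r] cf) auto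
      have if2: "integrable lborel (\<lambda>x. f x powr p)"
        using fs p by (intro integrable_continuous_compact_support[of \<rho>r] continuous_on_powr' cf continuous_intros) (auto simp: f_def)
      have X0: "?X \<ge> 0" by (intro Bochner_Integration.integral_nonneg) auto
      have Hoelder: "?F powr p \<le> (B * exp (n * H * r)) powr (p - 1) * ?X"
      proof -
        have "(LINT x|lborel. f x * ?g x) powr p \<le> (B * exp (n * H * r)) powr (p - 1) * (LINT x|lborel. f x powr p * ?g x)"
        proof (rule weighted_Hoelder[OF p])
          show "integrable lborel ?g" using emeasure_lborel_cball_finite by (intro integrable_real_indicator) auto
          have "\<rho>r ^ DIM('a) = K1 ^ DIM('a) * exp (n * H * r)"
            by (simp add: \<rho>r_def power_mult_distrib n_def mult.assoc flip: exp_of_nat_mult)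
          then show "(LINT x|lborel. ?g x) \<le> B * exp (n * H * r)"
            using \<rho>r0 by (simp add: content_cball B_def n_def)
          show "integrable lborel (\<lambda>x. f x * ?g x)" "integrable lborel (\<lambda>x. f x powr p * ?g x)"
            unfolding fg using if1 if2 by simp_all
        qed (use B in \<open>auto simp: f_def\<close>)
        then show ?thesis unfolding fg by (simp add: f_def)
      qed
      have "moment 0 (v r) = (LINT x|lborel. v r x)"
        unfolding moment_def Phi_0 mult_1_right using vs cvr by (rule integral_UNIV_eq_lebesgue)
      also have "\<dots> \<le> ?F"
      proof (rule integral_mono)
        show "integrable lborel (v r)" using vs
          by (intro integrable_continuous_compact_support[of \<rho>r] continuous_on_subset[OF cvr]) auto
        show "integrable lborel (\<lambda>x. f x)" using if1 .
      qed (simp add: f_def)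
      finally have "?U r \<le> exp (b * r / 2) * ?F" unfolding w.W_def by (intro mult_left_mono) auto
      then have "exp (- \<theta> * r) * ?U r \<le> exp (- \<theta> * r) * (exp (b * r / 2) * ?F)" by (intro mult_left_mono) auto
      moreover have "?U r \<ge> 0" using w.W_nonneg(1)[OF i0 r'] .
      ultimately have "(exp (- \<theta> * r) * ?U r) powr p \<le> (exp (- \<theta> * r) * (exp (b * r / 2) * ?F)) powr p"
        using p by (intro powr_mono2) auto
      also have "\<dots> = exp ((- \<theta> * r) * p) * (exp (b * r / 2 * p) * ?F powr p)"
        by (simp add: powr_mult exp_powr_real Bochner_Integration.integral_nonneg f_def)
      also have "\<dots> \<le> exp ((- \<theta> * r) * p) * (exp (b * r / 2 * p) * ((B * exp (n * H * r)) powr (p - 1) * ?X))"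
        by (intro mult_left_mono Hoelder) auto
      also have "(B * exp (n * H * r)) powr (p - 1) = B powr (p - 1) * exp (n * H * r * (p - 1))"
        using B by (simp add: powr_mult exp_powr_real)
      finally have "c3 * (exp (- \<theta> * r) * ?U r) powr p
        \<le> c3 * (exp ((- \<theta> * r) * p) * (exp (b * r / 2 * p) * (B powr (p - 1) * exp (n * H * r * (p - 1)) * ?X)))"
        using c3 by (intro mult_left_mono) auto
      also have "\<dots> = (c3 * B powr (p - 1)) * (exp ((- \<theta> * r) * p) * exp (b * r / 2 * p) * exp (n * H * r * (p - 1))) * ?X"
        by (simp only: mult_ac)
      also have "c3 * B powr (p - 1) = 1" unfolding c3_def using B by (simp flip: powr_add)
      also have "exp ((- \<theta> * r) * p) * exp (b * r / 2 * p) * exp (n * H * r * (p - 1)) = exp (\<alpha> * r)"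
      proof -
        have "\<theta> * p = H * (n * p / 2 - 1)" unfolding \<theta>_def using p by (simp add: field_simps)
        then have e: "(- \<theta> * r) * p = - (H * (n * p / 2 - 1)) * r"
          by (metis (no_types, opaque_lifting) mult.assoc mult.commute mult_minus_left)
        have "- (H * (n * p / 2 - 1)) * r + b * r / 2 * p + n * H * r * (p - 1) = \<alpha> * r"
          unfolding \<alpha>_def by (simp add: field_simps)
        then show ?thesis unfolding e by (simp flip: exp_add)
      qed
      finally show ?thesis by (simp add: M_def)
    qed
    have d: "(?U has_real_derivative ?U1 r) (at r)" "(?U1 has_real_derivative ?U2 r) (at r)" if "t0 < r" "r < t0 + 2" for r
      using that t0 by (auto intro!: w.W_deriv)
    have cU: "continuous_on {a..a'} ?U" "continuous_on {a..a'} ?U1" if "t0 \<le> a" "a' \<le> t0 + 2" for a a'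
      using that t0 by (auto intro: continuous_on_subset[OF w.continuous_on_W(1)] continuous_on_subset[OF w.continuous_on_W(2)])
    have nn: "?U r \<ge> 0" "?U1 r \<ge> 0" if "t0 \<le> r" "r \<le> t0 + 2" for r
      using w.W_nonneg[OF i0, of r] that t0 by auto
    define Y where "Y = g0 * (1 + t0) powr \<sigma> * m powr (\<beta> + 1) * exp (\<theta> * t0)"
    have Y: "Y > 0" using g0 m t0 by (simp add: Y_def)
    have UY: "?U (t0 + 1) \<ge> Y"
    proof -
      have "?U (t0 + 1) \<ge> ?U t0 + ?U1 t0 * (t0 + 1 - t0) + (2 * Y) * (t0 + 1 - t0)\<^sup>2 / 2"
      proof (rule second_derivative_lower_bound(2)[where u="t0 + 1" and f''="?U2"])
        fix r assume r: "t0 < r" "r < t0 + 1"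
        show "(?U has_real_derivative ?U1 r) (at r)" "(?U1 has_real_derivative ?U2 r) (at r)" using d[of r] r by auto
        have "2 * Y = \<mu> * exp (\<theta> * t0) * (3 powr (- \<bar>\<sigma>\<bar>) * (1 + t0) powr \<sigma>) * m powr (\<beta> + 1)"
          unfolding Y_def g0_def by simp
        also have "\<dots> \<le> \<mu> * exp (\<theta> * r) * (3 powr (- \<bar>\<sigma>\<bar>) * (1 + t0) powr \<sigma>) * M v r powr (\<beta> + 1)"
        proof (intro mult_mono mult_left_mono)
          show "m powr (\<beta> + 1) \<le> M v r powr (\<beta> + 1)" using r m \<beta> Mm by (intro powr_mono2) auto
        qed (use \<mu> \<theta> r in auto)
        also have "\<dots> \<le> ?U2 r" using U2[of r] r by simp
        finally show "2 * Y \<le> ?U2 r" .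
      qed (use cU in auto)
      then show ?thesis using nn[of t0] by simp
    qed
    \<comment> \<open>As 1 - q < 0, e^(\<theta>(1-q)r) is smallest at the end t0 + 2 of the
      interval; \<open>k0\<close> contains the part belonging to the two time units.\<close>
    define k where "k = k0 * (1 + t0) powr \<sigma> * exp (\<theta> * (1 - q) * t0)"
    have k: "k \<ge> 0" using k0 by (simp add: k_def)
    have "k * Y powr (q - 1) < K0"
    proof (rule blow[where s="t0 + 1" and y="?U" and y'="?U1" and y''="?U2"])
      fix r assume r: "t0 + 1 < r" "r < t0 + 1 + 1"
      show "(?U has_real_derivative ?U1 r) (at r)" "(?U1 has_real_derivative ?U2 r) (at r)" using d[of r] r by auto
      have U0: "?U r \<ge> 0" using nn[of r] r by auto
      have "(c3 * (exp (- \<theta> * r) * ?U r) powr p) powr (\<beta> + 1) = c3 powr (\<beta> + 1) * (exp (- \<theta> * r * q) * ?U r powr q)"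
        using c3 U0 by (simp add: powr_mult powr_powr exp_powr_real q_def mult_ac)
      moreover have "(c3 * (exp (- \<theta> * r) * ?U r) powr p) powr (\<beta> + 1) \<le> M v r powr (\<beta> + 1)"
        using M_ge[of r] r c3 \<beta> by (intro powr_mono2) auto
      ultimately have 1: "c3 powr (\<beta> + 1) * (exp (- \<theta> * r * q) * ?U r powr q) \<le> M v r powr (\<beta> + 1)" by simp
      have "exp (2 * \<theta> * (1 - q)) * exp (\<theta> * (1 - q) * t0) \<le> exp (\<theta> * r) * exp (- \<theta> * r * q)"
      proof -
        have "\<theta> * (q - 1) * r \<le> \<theta> * (q - 1) * (t0 + 2)" using r \<theta> q by (intro mult_left_mono) auto
        then show ?thesis by (simp add: algebra_simps flip: exp_add)
      qed
      then have "k * ?U r powr q \<le> \<mu> * 3 powr (- \<bar>\<sigma>\<bar>) * c3 powr (\<beta> + 1) * (1 + t0) powr \<sigma> *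
          (exp (\<theta> * r) * exp (- \<theta> * r * q)) * ?U r powr q"
        unfolding k_def k0_def using \<mu> c3
        by (intro mult_right_mono) (simp_all add: mult_ac mult_left_mono)
      also have "\<dots> = \<mu> * exp (\<theta> * r) * (3 powr (- \<bar>\<sigma>\<bar>) * (1 + t0) powr \<sigma>) * (c3 powr (\<beta> + 1) * (exp (- \<theta> * r * q) * ?U r powr q))"
        by (simp only: mult_ac)
      also have "\<dots> \<le> \<mu> * exp (\<theta> * r) * (3 powr (- \<bar>\<sigma>\<bar>) * (1 + t0) powr \<sigma>) * M v r powr (\<beta> + 1)"
        using 1 \<mu> by (intro mult_left_mono) auto
      also have "\<dots> \<le> ?U2 r" using U2[of r] r by simp
      finally show "k * ?U r powr q \<le> ?U2 r" .
    qed (use cU nn UY Y k in auto)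
    moreover have "k * Y powr (q - 1) = k0 * g0 powr (q - 1) * ((1 + t0) powr (\<sigma> * q) * m powr ((\<beta> + 1) * (q - 1)))"
    proof -
      have "Y powr (q - 1) = g0 powr (q - 1) * (1 + t0) powr (\<sigma> * (q - 1)) * m powr ((\<beta> + 1) * (q - 1)) * exp (\<theta> * t0 * (q - 1))"
        unfolding Y_def using g0 m t0 by (simp add: powr_mult powr_powr exp_powr_real)
      moreover have "exp (\<theta> * (1 - q) * t0) * exp (\<theta> * t0 * (q - 1)) = 1"
        by (simp add: algebra_simps flip: exp_add)
      moreover have "(1 + t0) powr \<sigma> * (1 + t0) powr (\<sigma> * (q - 1)) = (1 + t0) powr (\<sigma> * q)"
        by (simp add: algebra_simps flip: powr_add)
      moreover have "k0 * x * e1 * (g * y * z * e2) = k0 * g * (w * z)"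
        if "e1 * e2 = 1" "x * y = w" for x y z w g e1 e2 :: real
      proof -
        have "k0 * x * e1 * (g * y * z * e2) = k0 * g * ((x * y) * z) * (e1 * e2)" by (simp only: mult_ac)
        then show ?thesis using that by simp
      qed
      ultimately show ?thesis unfolding k_def by (simp only:)
    qed
    ultimately show "(1 + t0) powr (\<sigma> * q) * m powr ((\<beta> + 1) * (q - 1)) < K"
      unfolding K_def using k0 g0 by (simp add: field_simps)
  qed
qed

end

section \<open>Lifespan estimates\<close>

lemma linear_dominates_ln:
  fixes A B Z :: real
  assumes A: "A > 0"
  shows "\<exists>x0\<ge>1. \<forall>x\<ge>x0. A * x - B * ln x \<ge> Z"
proof -
  define Q where "Q = 2 * \<bar>B\<bar> / A + 1"
  have Q: "Q \<ge> 1" using A by (simp add: Q_def)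
  have BQ: "\<bar>B\<bar> / Q \<le> A / 2"
  proof -
    have "\<bar>B\<bar> \<le> A / 2 * Q" using A by (simp add: Q_def field_simps)
    then show ?thesis using Q by (simp add: pos_divide_le_eq)
  qed
  define x0 where "x0 = max 1 (2 * (Z + \<bar>B\<bar> * ln Q) / A)"
  have "A * x - B * ln x \<ge> Z" if x: "x \<ge> x0" for x
  proof -
    have x1: "x \<ge> 1" "x \<ge> 2 * (Z + \<bar>B\<bar> * ln Q) / A" using x by (auto simp: x0_def)
    have "ln (x / Q) \<le> x / Q - 1" using x1 Q by (intro ln_le_minus_one) auto
    then have "ln x \<le> x / Q + ln Q" using x1 Q by (simp add: ln_div)
    then have "\<bar>B\<bar> * ln x \<le> \<bar>B\<bar> * (x / Q + ln Q)" by (intro mult_left_mono) auto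
    also have "\<dots> = \<bar>B\<bar> / Q * x + \<bar>B\<bar> * ln Q" by (simp add: algebra_simps)
    also have "\<dots> \<le> A / 2 * x + \<bar>B\<bar> * ln Q" using BQ x1 by (intro add_right_mono mult_right_mono) auto
    finally have 1: "\<bar>B\<bar> * ln x \<le> A / 2 * x + \<bar>B\<bar> * ln Q" .
    have "B * ln x \<le> \<bar>B\<bar> * ln x" using x1 by (intro mult_right_mono) auto
    moreover have "Z + \<bar>B\<bar> * ln Q \<le> A / 2 * x" using x1(2) A by (simp add: field_simps)
    ultimately show ?thesis using 1 by linarith
  qed
  then show ?thesis by (intro exI[of _ x0]) (auto simp: x0_def)
qed

context blowup_params
begin

text \<open>Two choices of g in the iteration frame: g = 0 keeps only the data, and g = m on the
  indices above a keeps a block of d steps on which M >= m is known.\<close>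

lemma M_lower_bound:
  "\<exists>c1>0. \<forall>\<epsilon> T v. \<epsilon> > 0 \<longrightarrow> sol \<epsilon> T v \<longrightarrow>
    (\<forall>t>0. ereal t < T \<longrightarrow> c1 * \<epsilon> powr p \<le> M v t) \<and>
    (\<forall>t a d m. ereal t < T \<longrightarrow> real (a + d) \<le> t \<longrightarrow> 0 < t \<longrightarrow> 0 \<le> m \<longrightarrow> (\<forall>s. real a < s \<longrightarrow> s < t \<longrightarrow> m \<le> M v s) \<longrightarrow>
      c1 * (\<Sum>j=a+1..a+d. (1 + real j) powr (\<sigma> * p) * m powr q) \<le> M v t)"
proof -
  obtain c1 where c1: "c1 > 0" and S: "\<And>\<epsilon> T v t g. \<epsilon> > 0 \<Longrightarrow> sol \<epsilon> T v \<Longrightarrow> 0 < t \<Longrightarrow> ereal t < T \<Longrightarrow>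
    (\<And>j s. 1 \<le> j \<Longrightarrow> real j \<le> t \<Longrightarrow> real j - 1 < s \<Longrightarrow> s < real j \<Longrightarrow> 0 \<le> g j \<and> g j \<le> M v s) \<Longrightarrow>
    c1 * (\<epsilon> powr p + (\<Sum>j=1..nat \<lfloor>t\<rfloor>. ((1 + real j) powr \<sigma> * g j powr (\<beta> + 1)) powr p)) \<le> M v t"
    using M_iteration_frame by blast
  show ?thesis
  proof (intro exI[of _ c1] conjI c1 allI impI)
    fix \<epsilon> T v t assume "\<epsilon> > 0" "sol \<epsilon> T v" "0 < t" "ereal t < T"
    from S[OF this, of "\<lambda>_. 0"] show "c1 * \<epsilon> powr p \<le> M v t" using M_nonneg by simp
  next
    fix \<epsilon> T v t a d m
    assume *: "\<epsilon> > 0" "sol \<epsilon> T v" and t: "ereal t < T" "real (a + d) \<le> t" "0 < t" and m: "0 \<le> m"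
      and Mm: "\<forall>s. real a < s \<longrightarrow> s < t \<longrightarrow> m \<le> M v s"
    define g where "g j = (if a < j then m else 0)" for j :: nat
    have "c1 * (\<epsilon> powr p + (\<Sum>j=1..nat \<lfloor>t\<rfloor>. ((1 + real j) powr \<sigma> * g j powr (\<beta> + 1)) powr p)) \<le> M v t"
    proof (rule S[OF * t(3,1)])
      fix j :: nat and s assume "1 \<le> j" "real j \<le> t" "real j - 1 < s" "s < real j"
      then show "0 \<le> g j \<and> g j \<le> M v s" using m Mm M_nonneg by (auto simp: g_def)
    qed
    moreover have "(\<Sum>j=a+1..a+d. (1 + real j) powr (\<sigma> * p) * m powr q)
      \<le> (\<Sum>j=1..nat \<lfloor>t\<rfloor>. ((1 + real j) powr \<sigma> * g j powr (\<beta> + 1)) powr p)"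
    proof -
      have "a + d \<le> nat \<lfloor>t\<rfloor>" using t(2) by (simp add: le_nat_floor)
      then have "(\<Sum>j=a+1..a+d. ((1 + real j) powr \<sigma> * g j powr (\<beta> + 1)) powr p)
        \<le> (\<Sum>j=1..nat \<lfloor>t\<rfloor>. ((1 + real j) powr \<sigma> * g j powr (\<beta> + 1)) powr p)"
        by (intro sum_mono2) auto
      moreover have "((1 + real j) powr \<sigma> * g j powr (\<beta> + 1)) powr p = (1 + real j) powr (\<sigma> * p) * m powr q"
        if "j \<in> {a+1..a+d}" for j
        using that by (simp add: g_def powr_mult powr_powr q_def)
      ultimately show ?thesis by simp
    qed
    then have "c1 * (\<Sum>j=a+1..a+d. (1 + real j) powr (\<sigma> * p) * m powr q)
      \<le> c1 * (\<epsilon> powr p + (\<Sum>j=1..nat \<lfloor>t\<rfloor>. ((1 + real j) powr \<sigma> * g j powr (\<beta> + 1)) powr p))"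
      using c1 by (intro mult_left_mono) (auto intro: order.trans)
    ultimately show "c1 * (\<Sum>j=a+1..a+d. (1 + real j) powr (\<sigma> * p) * m powr q) \<le> M v t" by linarith
  qed
qed

lemma lifespan_positive_weight:
  assumes \<sigma>: "\<sigma> > 0"
  shows "\<exists>C>0. \<forall>\<epsilon> T v. 0 < \<epsilon> \<longrightarrow> \<epsilon> \<le> 1 \<longrightarrow> sol \<epsilon> T v \<longrightarrow> T \<le> ereal (C * \<epsilon> powr (- ((q - 1) / \<sigma>)))"
proof -
  obtain c1 where c1: "c1 > 0" and low: "\<And>\<epsilon> T v t. \<epsilon> > 0 \<Longrightarrow> sol \<epsilon> T v \<Longrightarrow> 0 < t \<Longrightarrow> ereal t < T \<Longrightarrow> c1 * \<epsilon> powr p \<le> M v t"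
    using M_lower_bound by blast
  obtain K where K: "K > 0" and S: "\<And>\<epsilon> T v t0 m. \<epsilon> > 0 \<Longrightarrow> sol \<epsilon> T v \<Longrightarrow> 0 \<le> t0 \<Longrightarrow> ereal (t0 + 2) < T \<Longrightarrow> 0 < m \<Longrightarrow>
    (\<And>s. t0 < s \<Longrightarrow> s < t0 + 2 \<Longrightarrow> m \<le> M v s) \<Longrightarrow>
    (1 + t0) powr (\<sigma> * q) * m powr ((\<beta> + 1) * (q - 1)) < K"
    using M_blowup_criterion by blast
  define e where "e = (q - 1) / \<sigma>"
  have e: "e > 0" using q \<sigma> by (simp add: e_def)
  \<comment> \<open>Solves C'^(\<sigma>q) c1^((\<beta>+1)(q-1)) = K, so that at t0 = C'
    \<epsilon>^(-e) the data alone violate the criterion: all powers of \<epsilon> cancel. The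
    constant C' + 2 pays for the two further time units, since \<epsilon>^(-e) >= 1.\<close>
  define C' where "C' = (K / c1 powr ((\<beta> + 1) * (q - 1))) powr (1 / (\<sigma> * q))"
  have C': "C' > 0" using K c1 by (simp add: C'_def)
  have C'_pow: "C' powr (\<sigma> * q) * c1 powr ((\<beta> + 1) * (q - 1)) = K"
    unfolding C'_def using K c1 \<sigma> q by (simp add: powr_powr)
  show ?thesis
  proof (intro exI[of _ "C' + 2"] conjI allI impI)
    show "0 < C' + 2" using C' by simp
    fix \<epsilon> T v assume \<epsilon>: "0 < \<epsilon>" "\<epsilon> \<le> 1" and s: "sol \<epsilon> T v"
    have \<epsilon>1: "\<epsilon> powr (- e) \<ge> 1" using \<epsilon> e powr_mono2'[of "- e" \<epsilon> 1] by simp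
    show "T \<le> ereal ((C' + 2) * \<epsilon> powr (- ((q - 1) / \<sigma>)))"
    proof (rule ccontr)
      assume "\<not> ?thesis"
      then have big: "ereal ((C' + 2) * \<epsilon> powr (- e)) < T" by (simp add: e_def)
      define t0 where "t0 = C' * \<epsilon> powr (- e)"
      have t0: "t0 > 0" using C' \<epsilon> by (simp add: t0_def)
      have "t0 + 2 \<le> (C' + 2) * \<epsilon> powr (- e)" using \<epsilon>1 by (simp add: t0_def algebra_simps)
      then have tT: "ereal (t0 + 2) < T" using big by (meson ereal_less_eq(3) le_less_trans)
      have "(1 + t0) powr (\<sigma> * q) * (c1 * \<epsilon> powr p) powr ((\<beta> + 1) * (q - 1)) < K"
      proof (rule S[OF \<epsilon>(1) s _ tT])
        fix r assume r: "t0 < r" "r < t0 + 2"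
        then have "ereal r < T" using tT by (meson ereal_less_eq(3) le_less_trans less_imp_le)
        then show "c1 * \<epsilon> powr p \<le> M v r" using r t0 by (intro low[OF \<epsilon>(1) s]) auto
      qed (use t0 c1 \<epsilon> in auto)
      moreover have "K \<le> (1 + t0) powr (\<sigma> * q) * (c1 * \<epsilon> powr p) powr ((\<beta> + 1) * (q - 1))"
      proof -
        have "(c1 * \<epsilon> powr p) powr ((\<beta> + 1) * (q - 1)) = c1 powr ((\<beta> + 1) * (q - 1)) * \<epsilon> powr (q * (q - 1))"
          using c1 \<epsilon> by (simp add: powr_mult powr_powr q_def mult_ac)
        moreover have "t0 powr (\<sigma> * q) = C' powr (\<sigma> * q) * \<epsilon> powr (- (q * (q - 1)))"
          unfolding t0_def e_def using C' \<epsilon> \<sigma> by (simp add: powr_mult powr_powr mult_ac)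
        moreover have "\<epsilon> powr (- (q * (q - 1))) * \<epsilon> powr (q * (q - 1)) = 1"
          using \<epsilon> by (simp flip: powr_add)
        moreover have "x * y * (z * u) = (x * z) * (y * u)" for x y z u :: real by simp
        ultimately have eqK: "t0 powr (\<sigma> * q) * (c1 * \<epsilon> powr p) powr ((\<beta> + 1) * (q - 1)) = K"
          using C'_pow by (simp only: mult_1_right)
        have "t0 powr (\<sigma> * q) \<le> (1 + t0) powr (\<sigma> * q)" using t0 \<sigma> q by (intro powr_mono2) auto
        then show ?thesis unfolding eqK[symmetric] by (intro mult_right_mono) auto
      qed
      ultimately show False by simp
    qed
  qed
qed

text \<open>\<open>M \<ge> m k = 2\<^sup>k m 0\<close> after time \<open>Nk k\<close>. The doubling times \<open>d k\<close> decrease geometrically until they reach the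
  unit delay of the iteration frame, so that \<open>N / 2\<close> doublings fit between \<open>N\<close> and \<open>2 N\<close>.\<close>

lemma lifespan_nonpositive_weight:
  assumes s: "s \<le> 0" "s \<le> \<sigma>" "s > - 1 / p"
  shows "\<exists>\<epsilon>0>0. \<exists>C>0. \<forall>\<epsilon> T v. 0 < \<epsilon> \<longrightarrow> \<epsilon> \<le> \<epsilon>0 \<longrightarrow> sol \<epsilon> T v \<longrightarrow>
    T \<le> ereal (C * \<epsilon> powr (- (p * (q - 1) / (1 + s * p))))"
proof -
  from M_lower_bound obtain c1 where c1: "c1 > 0" and lower: "\<forall>\<epsilon> T v. \<epsilon> > 0 \<longrightarrow> sol \<epsilon> T v \<longrightarrow>
    (\<forall>t>0. ereal t < T \<longrightarrow> c1 * \<epsilon> powr p \<le> M v t) \<and>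
    (\<forall>t a d m. ereal t < T \<longrightarrow> real (a + d) \<le> t \<longrightarrow> 0 < t \<longrightarrow> 0 \<le> m \<longrightarrow> (\<forall>s. real a < s \<longrightarrow> s < t \<longrightarrow> m \<le> M v s) \<longrightarrow>
      c1 * (\<Sum>j=a+1..a+d. (1 + real j) powr (\<sigma> * p) * m powr q) \<le> M v t)"
    by (elim exE conjE)
  have low: "c1 * \<epsilon> powr p \<le> M v t" if "\<epsilon> > 0" "sol \<epsilon> T v" "0 < t" "ereal t < T" for \<epsilon> T v t
    by (rule conjunct1[OF lower[rule_format, OF that(1,2)], rule_format, OF that(3,4)])
  have iter: "c1 * (\<Sum>j=a+1..a+d. (1 + real j) powr (\<sigma> * p) * m powr q) \<le> M v t"
    if "\<epsilon> > 0" "sol \<epsilon> T v" "ereal t < T" "real (a + d) \<le> t" "0 < t" "0 \<le> m"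
      "\<And>s. real a < s \<Longrightarrow> s < t \<Longrightarrow> m \<le> M v s" for \<epsilon> T v t a d m
    by (rule conjunct2[OF lower[rule_format, OF that(1,2)], rule_format, OF that(3-7)])
  obtain K where K: "K > 0" and S: "\<And>\<epsilon> T v t0 m. \<epsilon> > 0 \<Longrightarrow> sol \<epsilon> T v \<Longrightarrow> 0 \<le> t0 \<Longrightarrow> ereal (t0 + 2) < T \<Longrightarrow> 0 < m \<Longrightarrow>
    (\<And>s. t0 < s \<Longrightarrow> s < t0 + 2 \<Longrightarrow> m \<le> M v s) \<Longrightarrow>
    (1 + t0) powr (\<sigma> * q) * m powr ((\<beta> + 1) * (q - 1)) < K"
    using M_blowup_criterion by blast
  have sp: "1 + s * p > 0" using s(3) p by (simp add: field_simps)
  define e where "e = p * (q - 1) / (1 + s * p)"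
  have e: "e > 0" using p q sp by (simp add: e_def)
  \<comment> \<open>One doubling takes a time proportional to m^(-(q-1)), so the next one is shorter
    by this factor.\<close>
  define r where "r = 2 powr (- (q - 1))"
  have r: "0 < r" "r < 1" using q by (auto simp: r_def powr_less_one)
  define A0 where "A0 = 2 / (c1 powr q * (1 - r)) * 4 powr (- (s * p))"
  have A0: "A0 > 0" using c1 r by (simp add: A0_def)
  \<comment> \<open>Chosen so that, starting at N >= L \<epsilon>^(-e), the doubling times add up to
    at most N/2 before rounding, see \<open>D_le\<close>. Rounding up costs at most one unit per
    doubling, hence another N/2.\<close>
  define L where "L = (2 * A0) powr (1 / (1 + s * p))"
  have L: "L > 0" using A0 by (simp add: L_def)
  have Lp: "L powr (1 + s * p) = 2 * A0" unfolding L_def using A0 sp by (simp add: powr_powr)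
  define w where "w = (\<beta> + 1) * (q - 1)"
  have w: "w > 0" using \<beta> q by (simp add: w_def)
  have "w * ln 2 / 2 > 0" using w by simp
  then obtain x0 where x0: "x0 \<ge> 1" and dom: "\<And>x. x \<ge> x0 \<Longrightarrow>
    (w * ln 2 / 2) * x - (w * (p / e) - s * q) * ln x \<ge> ln K - s * q * ln 4 + w * ln 2 / 2 - w * ln c1 - w * (p / e) * ln L"
    using linear_dominates_ln by blast
  \<comment> \<open>Beyond \<open>x0\<close> the factor 2^(N/2) beats every power of N that occurs
    below; \<open>\<epsilon>0\<close> is the value of \<epsilon> for which y = X.\<close>
  define X where "X = max x0 2"
  define \<epsilon>0 where "\<epsilon>0 = (L / X) powr (1 / e)"
  have X: "X \<ge> x0" "X \<ge> 2" by (auto simp: X_def)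
  have \<epsilon>0: "\<epsilon>0 > 0" using L X by (simp add: \<epsilon>0_def)
  show ?thesis
  proof (rule exI[of _ \<epsilon>0], rule conjI[OF \<epsilon>0], rule exI[of _ "6 * L"], intro conjI allI impI)
    show "0 < 6 * L" using L by simp
    fix \<epsilon> T v assume \<epsilon>: "0 < \<epsilon>" "\<epsilon> \<le> \<epsilon>0" and sl: "sol \<epsilon> T v"
    define y where "y = L * \<epsilon> powr (- e)"
    have yX: "y \<ge> X"
    proof -
      have "\<epsilon>0 powr (- e) \<le> \<epsilon> powr (- e)" using \<epsilon> e by (intro powr_mono2') auto
      moreover have "\<epsilon>0 powr (- e) = X / L" unfolding \<epsilon>0_def using L X e
        by (simp add: powr_powr powr_minus)
      ultimately have "X / L \<le> \<epsilon> powr (- e)" by simp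
      then show ?thesis using L by (simp add: y_def field_simps)
    qed
    define N where "N = nat \<lceil>y\<rceil>"
    have Ny: "real N \<ge> y" "real N \<le> y + 1" using yX X unfolding N_def by linarith+
    have N2: "real N \<ge> 2" "N \<ge> 2" using Ny yX X by auto
    show "T \<le> ereal (6 * L * \<epsilon> powr (- (p * (q - 1) / (1 + s * p))))"
    proof (rule ccontr)
      assume "\<not> ?thesis"
      then have big: "ereal (6 * y) < T" by (simp add: e_def y_def mult.assoc)
      \<comment> \<open>The criterion is used on [2N, 2N + 2], which ends by 3N since N >= 2;
        rounding y up to N accounts for the 6.\<close>
      have "3 * real N \<le> 6 * y" using Ny yX X by linarith
      then have NT: "ereal (3 * real N) < T" using big by (meson ereal_less_eq(3) le_less_trans)
      have tT: "ereal t < T" if "t \<le> 3 * real N" for t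
        using that NT by (meson ereal_less_eq(3) le_less_trans)
      define m where "m k = 2 ^ k * (c1 * \<epsilon> powr p)" for k :: nat
      have m0: "m k > 0" for k using c1 \<epsilon> by (simp add: m_def)
      \<comment> \<open>Up to time 3N each index adds at least c1 (4N)^(sp) m^q, because 1 + j <= 4N
        and s <= 0. D r^k such indices add exactly 2 m(k).\<close>
      define D where "D = 2 / c1 * (4 * real N) powr (- (s * p)) * (c1 * \<epsilon> powr p) powr (- (q - 1))"
      have D: "D > 0" using c1 \<epsilon> N2 by (simp add: D_def)
      define d where "d k = nat \<lceil>D * r ^ k\<rceil>" for k
      have d_ge: "real (d k) \<ge> D * r ^ k" for k unfolding d_def by linarith
      have d_le: "real (d k) \<le> D * r ^ k + 1" for k
        using D r unfolding d_def by (simp add: of_nat_nat) 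
      define Nk where "Nk k = N + (\<Sum>i<k. d i)" for k
      have Nk_le: "real (Nk k) \<le> real N + real k + D / (1 - r)" for k
      proof -
        have "(\<Sum>i<k. real (d i)) \<le> (\<Sum>i<k. D * r ^ i + 1)" by (intro sum_mono d_le)
        also have "\<dots> = D * (\<Sum>i<k. r ^ i) + real k" by (simp add: sum.distrib sum_distrib_left)
        also have "(\<Sum>i<k. r ^ i) \<le> 1 / (1 - r)"
        proof -
          have "(\<Sum>i<k. r ^ i) = (1 - r ^ k) / (1 - r)" using r by (subst sum_gp_strict) auto
          also have "\<dots> \<le> 1 / (1 - r)" using r by (intro divide_right_mono) auto
          finally show ?thesis .
        qed
        finally show ?thesis using D by (simp add: Nk_def mult_left_mono)
      qed
      have grow: "m k \<le> M v t" if "real (Nk k) < t" "t \<le> 3 * real N" for k t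
        using that
      proof (induction k arbitrary: t)
        case 0
        then show ?case using N2 tT by (auto simp: m_def Nk_def intro!: low[OF \<epsilon>(1) sl])
      next
        case (Suc k)
        have Nk_Suc: "Nk (Suc k) = Nk k + d k" by (simp add: Nk_def)
        have "c1 * (\<Sum>j=Nk k + 1..Nk k + d k. (1 + real j) powr (\<sigma> * p) * m k powr q) \<le> M v t"
        proof (rule iter[OF \<epsilon>(1) sl])
          show "ereal t < T" using Suc.prems tT by simp
          show "real (Nk k + d k) \<le> t" using Suc.prems Nk_Suc by simp
          show "0 < t" using Suc.prems by (meson le_less_trans of_nat_0_le_iff)
          show "m k \<le> M v x" if "real (Nk k) < x" "x < t" for x using Suc.IH[of x] Suc.prems that by simp
        qed (use m0[of k] in simp)
        moreover have "2 * m k \<le> c1 * (\<Sum>j=Nk k + 1..Nk k + d k. (1 + real j) powr (\<sigma> * p) * m k powr q)"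
        proof -
          have "(4 * real N) powr (s * p) \<le> (1 + real j) powr (\<sigma> * p)" if j: "j \<in> {Nk k + 1..Nk k + d k}" for j
          proof -
            have "real j \<le> real (Nk k + d k)" using j by (simp only: of_nat_le_iff) auto
            then have "1 + real j \<le> 4 * real N" using Suc.prems Nk_Suc N2 by simp
            then have "(4 * real N) powr (s * p) \<le> (1 + real j) powr (s * p)"
              using s p by (intro powr_mono2') (auto simp: mult_nonpos_nonneg)
            also have "\<dots> \<le> (1 + real j) powr (\<sigma> * p)" using s p by (intro powr_mono) auto
            finally show ?thesis .
          qed
          then have "(\<Sum>j=Nk k + 1..Nk k + d k. (4 * real N) powr (s * p) * m k powr q)
            \<le> (\<Sum>j=Nk k + 1..Nk k + d k. (1 + real j) powr (\<sigma> * p) * m k powr q)"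
            by (intro sum_mono mult_right_mono) auto
          then have 1: "real (d k) * ((4 * real N) powr (s * p) * m k powr q)
            \<le> (\<Sum>j=Nk k + 1..Nk k + d k. (1 + real j) powr (\<sigma> * p) * m k powr q)" by simp
          have mk: "m k powr (- (q - 1)) = r ^ k * (c1 * \<epsilon> powr p) powr (- (q - 1))"
          proof -
            have "m k powr (- (q - 1)) = (2 ^ k) powr (- (q - 1)) * (c1 * \<epsilon> powr p) powr (- (q - 1))"
              unfolding m_def using c1 \<epsilon> by (subst powr_mult) auto
            also have "(2 ^ k) powr (- (q - 1)) = r ^ k"
              unfolding r_def by (simp add: powr_power powr_realpow[symmetric] powr_powr mult.commute)
            finally show ?thesis .
          qed
          have "2 * m k = c1 * (D * r ^ k * ((4 * real N) powr (s * p) * m k powr q))"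
          proof -
            have "D * r ^ k = 2 / c1 * (4 * real N) powr (- (s * p)) * m k powr (- (q - 1))"
              unfolding D_def mk by (simp only: mult_ac)
            then have "c1 * (D * r ^ k * ((4 * real N) powr (s * p) * m k powr q))
              = 2 * ((4 * real N) powr (- (s * p)) * (4 * real N) powr (s * p)) * (m k powr (- (q - 1)) * m k powr q)"
              using c1 by (simp add: field_simps)
            also have "(4 * real N) powr (- (s * p)) * (4 * real N) powr (s * p) = 1"
              using N2 by (simp flip: powr_add)
            also have "m k powr (- (q - 1)) * m k powr q = m k"
              using m0[of k] by (simp flip: powr_add)
            finally show ?thesis by simp
          qed
          also have "\<dots> \<le> c1 * (real (d k) * ((4 * real N) powr (s * p) * m k powr q))"
            using c1 by (intro mult_left_mono mult_right_mono d_ge) auto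
          also have "\<dots> \<le> c1 * (\<Sum>j=Nk k + 1..Nk k + d k. (1 + real j) powr (\<sigma> * p) * m k powr q)"
            using c1 1 by (intro mult_left_mono) auto
          finally show ?thesis .
        qed
        ultimately show ?case by (simp add: m_def)
      qed
      have D_le: "D / (1 - r) \<le> real N / 2"
      proof -
        have 1: "\<epsilon> powr (- (p * (q - 1))) \<le> (real N / L) powr (1 + s * p)"
        proof -
          have "\<epsilon> powr (- (p * (q - 1))) = (\<epsilon> powr (- e)) powr (1 + s * p)"
            unfolding e_def using sp by (simp add: powr_powr)
          also have "\<epsilon> powr (- e) \<le> real N / L" using Ny L by (simp add: y_def field_simps)
          then have "(\<epsilon> powr (- e)) powr (1 + s * p) \<le> (real N / L) powr (1 + s * p)"
            using sp by (intro powr_mono2) auto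
          finally show ?thesis .
        qed
        have "(c1 * \<epsilon> powr p) powr (- (q - 1)) = c1 powr (- (q - 1)) * \<epsilon> powr (- (p * (q - 1)))"
          using c1 \<epsilon> by (simp add: powr_mult powr_powr algebra_simps)
        then have "D / (1 - r) = (2 / c1 * c1 powr (- (q - 1)) / (1 - r)) * (4 * real N) powr (- (s * p)) * \<epsilon> powr (- (p * (q - 1)))"
          unfolding D_def by simp
        also have "2 / c1 * c1 powr (- (q - 1)) = 2 / c1 powr q"
          using c1 by (simp add: powr_minus powr_diff field_simps)
        also have "2 / c1 powr q / (1 - r) * (4 * real N) powr (- (s * p)) * \<epsilon> powr (- (p * (q - 1)))
          \<le> 2 / c1 powr q / (1 - r) * (4 * real N) powr (- (s * p)) * (real N / L) powr (1 + s * p)"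
          using 1 c1 r by (intro mult_left_mono) auto
        also have "\<dots> = A0 * (real N powr (- (s * p)) * real N powr (1 + s * p)) / L powr (1 + s * p)"
          unfolding A0_def using N2 L by (simp add: powr_mult powr_divide)
        also have "real N powr (- (s * p)) * real N powr (1 + s * p) = real N"
          using N2 by (simp flip: powr_add)
        also have "A0 * real N / L powr (1 + s * p) = real N / 2" unfolding Lp using A0 by simp
        finally show ?thesis .
      qed
      define k where "k = N div 2"
      have "2 * k \<le> N" "N \<le> 2 * k + 1" unfolding k_def by presburger+
      then have "real (2 * k) \<le> real N" "real N \<le> real (2 * k + 1)" by (simp_all only: of_nat_le_iff)
      then have k: "real k \<le> real N / 2" "real k \<ge> (real N - 1) / 2" by simp_all
      have Nk2: "real (Nk k) \<le> 2 * real N" using Nk_le[of k] k D_le by linarith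
      have "(1 + 2 * real N) powr (\<sigma> * q) * m k powr ((\<beta> + 1) * (q - 1)) < K"
      proof (rule S[OF \<epsilon>(1) sl])
        show "ereal (2 * real N + 2) < T" using N2 by (intro tT) simp
        show "m k \<le> M v t" if "2 * real N < t" "t < 2 * real N + 2" for t
          using that Nk2 N2 by (intro grow) auto
      qed (use m0 in auto)
      then have lt: "(1 + 2 * real N) powr (\<sigma> * q) * m k powr w < K" by (simp add: w_def)
      have N0: "real N > 0" using N2 by simp
      have a1: "(4 * real N) powr (s * q) \<le> (1 + 2 * real N) powr (\<sigma> * q)"
      proof -
        have "(4 * real N) powr (s * q) \<le> (1 + 2 * real N) powr (s * q)"
          using s q N2 by (intro powr_mono2') (auto simp: mult_nonpos_nonneg)
        also have "\<dots> \<le> (1 + 2 * real N) powr (\<sigma> * q)" using s q by (intro powr_mono) auto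
        finally show ?thesis .
      qed
      \<comment> \<open>Since N >= L \<epsilon>^(-e), the power of \<epsilon> in m(k) becomes a
        power of N, and the comparison is reduced to one in N alone, namely
        \<open>dom\<close>.\<close>
      have ln\<epsilon>: "ln \<epsilon> \<ge> (ln L - ln (real N)) / e"
      proof -
        have "ln y \<le> ln (real N)" using Ny yX X by simp
        then have "ln L - e * ln \<epsilon> \<le> ln (real N)" unfolding y_def using L \<epsilon> by (simp add: ln_mult ln_powr)
        then show ?thesis using e by (simp add: field_simps)
      qed
      have "ln K \<le> s * q * (ln 4 + ln (real N)) + w * (real k * ln 2 + ln c1 + p * ln \<epsilon>)"
      proof -
        have "(real N - 1) / 2 * ln 2 + ln c1 + p * ((ln L - ln (real N)) / e) \<le> real k * ln 2 + ln c1 + p * ln \<epsilon>"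
          using k ln\<epsilon> p by (intro add_mono mult_right_mono mult_left_mono) auto
        then have "w * ((real N - 1) / 2 * ln 2 + ln c1 + p * ((ln L - ln (real N)) / e)) \<le> w * (real k * ln 2 + ln c1 + p * ln \<epsilon>)"
          using w by (intro mult_left_mono) auto
        moreover have "ln K \<le> s * q * (ln 4 + ln (real N)) + w * ((real N - 1) / 2 * ln 2 + ln c1 + p * ((ln L - ln (real N)) / e))"
        proof -
          have "s * q * (ln 4 + ln (real N)) + w * ((real N - 1) / 2 * ln 2 + ln c1 + p * ((ln L - ln (real N)) / e))
            = (w * ln 2 / 2) * real N - (w * (p / e) - s * q) * ln (real N)
              - (- s * q * ln 4 + w * ln 2 / 2 - w * ln c1 - w * (p / e) * ln L)"
            using e by (simp add: field_simps)
          then show ?thesis using dom[of "real N"] Ny yX X by linarith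
        qed
        ultimately show ?thesis by linarith
      qed
      also have "\<dots> = ln ((4 * real N) powr (s * q) * m k powr w)"
        unfolding m_def using c1 \<epsilon> N0 by (simp add: ln_mult ln_powr ln_realpow algebra_simps)
      finally have "K \<le> (4 * real N) powr (s * q) * m k powr w"
        using K m0[of k] N0 by (subst (asm) ln_le_cancel_iff) auto
      also have "\<dots> \<le> (1 + 2 * real N) powr (\<sigma> * q) * m k powr w"
        using a1 by (intro mult_right_mono) auto
      finally show False using lt by simp
    qed
  qed
qed

end

section \<open>The three ranges of the weight exponent\<close>

lemma Ck_on_imp_continuous: "Ck_on k f S \<Longrightarrow> continuous_on S f"
  by (cases k) (auto intro: has_derivative_continuous_on)

theorem theorem1p2:
  fixes c H b msq \<beta> p \<mu> \<sigma> R :: real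
    and v0 v1 :: "real ^ 'n \<Rightarrow> real"
    and \<Gamma> :: "real \<Rightarrow> real"
  assumes "c > 0" and "H > 0" and "b \<ge> 0" and "msq \<ge> 0" and "b\<^sup>2 \<ge> 4 * msq"
    and "\<beta> \<ge> 0" and "p > 1"
    and "real CARD('n) / 2 - sqrt (b\<^sup>2 - 4 * msq) / (2 * H) > 1 / p"
    and "\<sigma> > - 1 / p" and "\<mu> > 0"
    and \<Gamma>: "\<Gamma> = (\<lambda>t. \<mu> * exp (rho_crit CARD('n) H b msq \<beta> p * t) * (1 + t) powr \<sigma>)"
    and "v0 \<in> Ck_compact 2" and "v1 \<in> Ck_compact 1"
    and "\<forall>x. v0 x \<ge> 0" and "\<forall>x. v1 x \<ge> 0"
    and "\<exists>x. v0 x \<noteq> 0" and "\<exists>x. v1 x \<noteq> 0"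
    and "R > 0" and "supp v0 \<subseteq> cball 0 R" and "supp v1 \<subseteq> cball 0 R"
  shows "\<exists>\<epsilon>0>0. \<exists>C>0. \<forall>\<epsilon>\<in>{0<..\<epsilon>0}. \<forall>v T.
    classical_solution_with_lifespan c H b msq \<Gamma> \<beta> p
      (\<lambda>x. \<epsilon> * v0 x) (\<lambda>x. \<epsilon> * v1 x) T v \<longrightarrow>
    T < \<infinity> \<and>
    T \<le> ereal
      (if \<sigma> \<le> 0 then C * \<epsilon> powr (- (p * ((\<beta> + 1) * p - 1) / (1 + \<sigma> * p)))
       else if \<sigma> < 1 / p then C * \<epsilon> powr (- (p * ((\<beta> + 1) * p - 1)))
       else C * \<epsilon> powr (- (((\<beta> + 1) * p - 1) / \<sigma>)))"
proof -
  have outside: "f x = 0" if "supp f \<subseteq> cball 0 R" "norm x > R" for f :: "real ^ 'n \<Rightarrow> real" and x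
  proof (rule ccontr)
    assume "f x \<noteq> 0"
    then have "x \<in> supp f" using closure_subset unfolding supp_def by fastforce
    then show False using that by auto
  qed
  interpret P: blowup_params c H b msq \<beta> p \<mu> \<sigma> R v0 v1
  proof
    have "sqrt (b\<^sup>2 - 4 * msq) / (2 * H) \<ge> 0" using assms(2,5) by auto
    then show "real DIM(real ^ 'n) / 2 > 1 / p" using assms(8) by simp
    show "continuous_on UNIV v0" "continuous_on UNIV v1"
      using assms(12,13) Ck_on_imp_continuous unfolding Ck_compact_def by blast+
  qed (use assms outside in auto)
  have "\<Gamma> = P.\<Gamma>"
    unfolding \<Gamma> rho_crit_eq[OF assms(2,8)] by (simp add: fun_eq_iff P.\<Gamma>_def P.\<rho>_def P.q_def P.n_def)
  then have sol: "P.sol \<epsilon> T v"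
    if "classical_solution_with_lifespan c H b msq \<Gamma> \<beta> p (\<lambda>x. \<epsilon> * v0 x) (\<lambda>x. \<epsilon> * v1 x) T v" for \<epsilon> T v
    using that by (simp add: P.sol_def classical_solution_with_lifespan_def)
  have p: "1 / p > 0" using assms(7) by simp
  have "\<exists>\<epsilon>0>0. \<exists>C>0. \<forall>\<epsilon> T v. 0 < \<epsilon> \<longrightarrow> \<epsilon> \<le> \<epsilon>0 \<longrightarrow> P.sol \<epsilon> T v \<longrightarrow> T \<le> ereal
      (if \<sigma> \<le> 0 then C * \<epsilon> powr (- (p * ((\<beta> + 1) * p - 1) / (1 + \<sigma> * p)))
       else if \<sigma> < 1 / p then C * \<epsilon> powr (- (p * ((\<beta> + 1) * p - 1)))
       else C * \<epsilon> powr (- (((\<beta> + 1) * p - 1) / \<sigma>)))"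
  proof -
    consider "\<sigma> \<le> 0" | "0 < \<sigma>" "\<sigma> < 1 / p" | "\<sigma> \<ge> 1 / p" by linarith
    then show ?thesis
    proof cases
      case 1
      then show ?thesis using P.lifespan_nonpositive_weight[of \<sigma>] assms(9) by (simp add: P.q_def)
    next
      case 2
      \<comment> \<open>With s = 0 the weight is estimated from below by 1. From \<sigma> = 1/p on,
        the exponent (q-1)/\<sigma> of the direct argument is no larger than p(q-1), and that
        argument takes over.\<close>
      then show ?thesis using P.lifespan_nonpositive_weight[of 0] p by (simp add: P.q_def)
    next
      case 3
      \<comment> \<open>Here the bound holds for all \<epsilon> <= 1, so \<epsilon>0 = 1.\<close>
      then have "\<sigma> > 0" "\<not> \<sigma> < 1 / p" "\<not> \<sigma> \<le> 0" using p by linarith+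
      then show ?thesis using P.lifespan_positive_weight
        by (simp only: if_False P.q_def) (meson zero_less_one)
    qed
  qed
  then obtain \<epsilon>0 C where "\<epsilon>0 > 0" "C > 0" and bound: "\<And>\<epsilon> T v. 0 < \<epsilon> \<Longrightarrow> \<epsilon> \<le> \<epsilon>0 \<Longrightarrow> P.sol \<epsilon> T v \<Longrightarrow> T \<le> ereal
      (if \<sigma> \<le> 0 then C * \<epsilon> powr (- (p * ((\<beta> + 1) * p - 1) / (1 + \<sigma> * p)))
       else if \<sigma> < 1 / p then C * \<epsilon> powr (- (p * ((\<beta> + 1) * p - 1)))
       else C * \<epsilon> powr (- (((\<beta> + 1) * p - 1) / \<sigma>)))"
    by blast
  show ?thesis
  proof (rule exI[of _ \<epsilon>0], rule conjI[OF \<open>\<epsilon>0 > 0\<close>], rule exI[of _ C], rule conjI[OF \<open>C > 0\<close>],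
      intro ballI allI impI conjI)
    fix \<epsilon> v T
    assume \<epsilon>: "\<epsilon> \<in> {0<..\<epsilon>0}"
      and s: "classical_solution_with_lifespan c H b msq \<Gamma> \<beta> p (\<lambda>x. \<epsilon> * v0 x) (\<lambda>x. \<epsilon> * v1 x) T v"
    show B: "T \<le> ereal
      (if \<sigma> \<le> 0 then C * \<epsilon> powr (- (p * ((\<beta> + 1) * p - 1) / (1 + \<sigma> * p)))
       else if \<sigma> < 1 / p then C * \<epsilon> powr (- (p * ((\<beta> + 1) * p - 1)))
       else C * \<epsilon> powr (- (((\<beta> + 1) * p - 1) / \<sigma>)))"
      using bound[OF _ _ sol[OF s]] \<epsilon> by auto
    then show "T < \<infinity>" by (rule le_less_trans) simp
  qed
qed

end
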